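(* Let $D$ be a diagram of a link $L$. Then the odd Khovanov homology $\mathrm{Okh}(L)$ is a module over the exterior algebra $\Lambda^*\mathrm{Col}(D)$ of the coloring group of $D$, where the generator of $\mathrm{Col}(D)$ given by an edge $e$ of $D$ acts by the map induced by the identity cobordism of $D$ with one dot on $e$.
   Context: Coloring group. View $D$ as a 4-valent graph. $\mathrm{edge}(D)$ is the free abelian group on the edges of $D$. $\mathrm{arcs}(D)$ is the quotient of $\mathrm{edge}(D)$ by $e_i-e_j=0$ whenever $e_i,e_j$ are the two edges of the overstrand at a crossing. $\mathrm{Col}(D)$ is the quotient of $\mathrm{arcs}(D)$ by the relation $2e_i-e_j-e_k=0$ for each crossing with over-arc $e_i$ and the other two strands $e_j,e_k$. Odd Khovanov homology. At a crossing draw the overstrand vertically (ends N,S) and the understrand horizontally (ends W,E). The 0-resolution joins S to W and N to E; the 1-resolution joins N to W and S to E. Fix an orientation of every crossing: an arrow along the short arc joining the SW strand and the NE strand of the 0-resolution. If $D$ has $n$ crossings and $\alpha\in\{0,1\}^n$, $D_\alpha$ is the resulting collection of circles, $c(D,\alpha)$ their number, $\deg(\alpha)$ the number of 1's in $\alpha$, $\zeta=(0,\dots,0)$. For a collection $R$ of circles, $V(R)$ is the free abelian group on them and $\mathcal F(R)=\Lambda^*V(R)$. Each edge of the cube $\{0,1\}^n$ is a merge or a split by surgery along an arrow. A merge of $a_0,a_1$ gives the map $\Lambda^*V(R)\to\Lambda^*V(R)/(a_0-a_1)\cong\Lambda^*V(R')$; a split gives $\Lambda^*V(R)\cong\Lambda^*V(R')/(c_0'-c_1')\to\Lambda^*V(R')$,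 $x\mapsto(c_0'-c_1')\wedge x$, where the arrow rotated $90^\circ$ clockwise points from $c_0'$ to $c_1'$. For each 2-dimensional face of the cube let $\sigma=\pm1$ be the sign by which the two compositions differ if they are nonzero; otherwise the face is (up to unaffected circles) a single circle surgered along two arcs with interleaved endpoints, $a$ inside and $b$ outside the circle, and $\sigma=-1$ if counterclockwise around the circle one meets tail of $a$, head of $b$, head of $a$, tail of $b$, while $\sigma=+1$ if one meets tail of $a$, tail of $b$, head of $a$, head of $b$ (type Y convention). A valid sign assignment consists of signs $\epsilon$ on cube edges such that on each face the product of the four signs times $\sigma$ is $-1$. The complex has $\bigoplus_{\deg\alpha=k}\mathcal F(D_\alpha)$ in degree $k-n_-$ ($n_-$ = number of negative crossings) with differential the sum of the signed edge maps, and $\mathrm{Okh}(L)$ is its homology. Dotted identity cobordism. For an edge $e$ of $D$, the identity cobordism with a dot on $e$ induces the chain map which on $\mathcal F(D_\alpha)$ is $x\mapsto(-1)^{S(D,\alpha)}\,R_e\wedge x$, where $R_e$ is the circle of $D_\alpha$ containing $e$ and $S(D,\alpha)=\tfrac12\big(c(D,\alpha)+c(D,\zeta)+\deg(\alpha)\big)$. *)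

theory Defs
  imports "HOL-Algebra.Free_Abelian_Groups" "HOL-Algebra.QuotRing"
begin

section \<open>Exterior algebra of an abelian group\<close>

text \<open>
  The free associative unital ring on a set \<open>X\<close>: integral combinations of words in \<open>X\<close>,
  multiplied by concatenation.
\<close>

definition free_ring :: "'a set \<Rightarrow> ('a list \<Rightarrow>\<^sub>0 int) ring" where
  "free_ring X =
     \<lparr>carrier = {w. Poly_Mapping.keys w \<subseteq> lists X},
      monoid.mult = (\<lambda>v w. frag_extend (\<lambda>s. frag_extend (\<lambda>t. frag_of (s @ t)) w) v),
      one = frag_of [],
      zero = 0,
      add = (+)\<rparr>"

text \<open>
  The additivity relations turn the free ring on the underlying set of \<open>A\<close> into the tensor
  algebra of the \<open>\<int>\<close>-module \<open>A\<close>; the remaining relations are \<open>a \<otimes> a = 0\<close>. The groups of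
  \<open>HOL-Algebra\<close> are written multiplicatively, so the product of \<open>A\<close> is the addition of the module.
\<close>

definition ext_ideal :: "('a, 'm) monoid_scheme \<Rightarrow> ('a list \<Rightarrow>\<^sub>0 int) set" where
  "ext_ideal A = Idl\<^bsub>free_ring (carrier A)\<^esub>
     ({frag_of [a \<otimes>\<^bsub>A\<^esub> b] - frag_of [a] - frag_of [b] | a b. a \<in> carrier A \<and> b \<in> carrier A}
      \<union> {frag_of [a, a] | a. a \<in> carrier A})"

definition ext_alg :: "('a, 'm) monoid_scheme \<Rightarrow> ('a list \<Rightarrow>\<^sub>0 int) set ring" where
  "ext_alg A = free_ring (carrier A) Quot ext_ideal A"

definition ext_gen :: "('a, 'm) monoid_scheme \<Rightarrow> 'a \<Rightarrow> ('a list \<Rightarrow>\<^sub>0 int) set" where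
  "ext_gen A a = ext_ideal A +>\<^bsub>free_ring (carrier A)\<^esub> frag_of [a]"

text \<open>The ring homomorphism \<open>\<Lambda>\<^sup>*f\<close> into \<open>\<Lambda>\<^sup>*B\<close> induced by a group homomorphism \<open>f\<close> into \<open>B\<close>.\<close>

definition ext_map ::
  "('b, 'm) monoid_scheme \<Rightarrow> ('a \<Rightarrow> 'b) \<Rightarrow> ('a list \<Rightarrow>\<^sub>0 int) set \<Rightarrow> ('b list \<Rightarrow>\<^sub>0 int) set" where
  "ext_map B f X = the_elem
     ((\<lambda>w. ext_ideal B +>\<^bsub>free_ring (carrier B)\<^esub> frag_extend (\<lambda>u. frag_of (map f u)) w) ` X)"


section \<open>Left modules over a ring that need not be commutative\<close>

text \<open>The locale \<open>module\<close> of \<open>HOL-Algebra\<close> requires a commutative ring. Here \<open>M\<close> is a multiplicatively written group.\<close>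

locale left_module = R: ring R + M: comm_group M
  for R :: "('r, 'm) ring_scheme" and M :: "('a, 'n) monoid_scheme" +
  fixes act :: "'r \<Rightarrow> 'a \<Rightarrow> 'a"
  assumes act_closed: "\<lbrakk>r \<in> carrier R; x \<in> carrier M\<rbrakk> \<Longrightarrow> act r x \<in> carrier M"
    and act_add_left: "\<lbrakk>r \<in> carrier R; s \<in> carrier R; x \<in> carrier M\<rbrakk>
      \<Longrightarrow> act (r \<oplus>\<^bsub>R\<^esub> s) x = act r x \<otimes>\<^bsub>M\<^esub> act s x"
    and act_add_right: "\<lbrakk>r \<in> carrier R; x \<in> carrier M; y \<in> carrier M\<rbrakk>
      \<Longrightarrow> act r (x \<otimes>\<^bsub>M\<^esub> y) = act r x \<otimes>\<^bsub>M\<^esub> act r y"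
    and act_mult: "\<lbrakk>r \<in> carrier R; s \<in> carrier R; x \<in> carrier M\<rbrakk>
      \<Longrightarrow> act (r \<otimes>\<^bsub>R\<^esub> s) x = act r (act s x)"
    and act_one: "x \<in> carrier M \<Longrightarrow> act \<one>\<^bsub>R\<^esub> x = x"


section \<open>Link diagrams\<close>

text \<open>
  A crossing is drawn with its overstrand vertical. An oriented diagram is encoded by its
  underlying 4-valent graph: \<open>strand D c p\<close> is the edge arriving at the end \<open>p\<close> of the crossing \<open>c\<close>,
  and \<open>incoming D c p\<close> says that the link is oriented towards \<open>c\<close> on that end. Edges that
  do not meet any crossing are circle components without crossings.
\<close>

datatype compass = North | East | South | West

record ('v, 'e) diagram =
  crossings :: "'v set"
  edges :: "'e set"
  strand :: "'v \<Rightarrow> compass \<Rightarrow> 'e"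
  incoming :: "'v \<Rightarrow> compass \<Rightarrow> bool"

fun ccw :: "compass \<Rightarrow> compass" where
  "ccw North = West" | "ccw West = South" | "ccw South = East" | "ccw East = North"

definition edge_ends :: "('v, 'e) diagram \<Rightarrow> ('v \<times> compass) set" where
  "edge_ends D = crossings D \<times> UNIV"

definition ends_of :: "('v, 'e) diagram \<Rightarrow> 'e \<Rightarrow> ('v \<times> compass) set" where
  "ends_of D e = {(c, p) \<in> edge_ends D. strand D c p = e}"

definition other_end :: "('v, 'e) diagram \<Rightarrow> 'v \<times> compass \<Rightarrow> 'v \<times> compass" where
  "other_end D h = (THE h'. h' \<in> ends_of D (strand D (fst h) (snd h)) \<and> h' \<noteq> h)"

text \<open>
  The faces of the 4-valent graph are the orbits of the following permutation of the edge ends,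
  and the genus of each connected component is read off from the Euler characteristic. Since the
  genus is nonnegative on every component, the single equation in \<open>planar_diagram\<close> says
  that every component is planar.
\<close>

definition face_step :: "('v, 'e) diagram \<Rightarrow> 'v \<times> compass \<Rightarrow> 'v \<times> compass" where
  "face_step D h = (case other_end D h of (c, p) \<Rightarrow> (c, ccw p))"

definition faces :: "('v, 'e) diagram \<Rightarrow> ('v \<times> compass) set set" where
  "faces D = (\<lambda>h. range (\<lambda>n. (face_step D ^^ n) h)) ` edge_ends D"

definition adjacent :: "('v, 'e) diagram \<Rightarrow> ('v \<times> 'v) set" where
  "adjacent D = {(c, c'). c \<in> crossings D \<and> c' \<in> crossings D
                   \<and> (\<exists>p p'. strand D c p = strand D c' p')}"

definition graph_components :: "('v, 'e) diagram \<Rightarrow> 'v set set" where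
  "graph_components D = (\<lambda>c. (adjacent D)\<^sup>* `` {c}) ` crossings D"

definition planar_diagram :: "('v, 'e) diagram \<Rightarrow> bool" where
  "planar_diagram D \<longleftrightarrow>
     int (card (crossings D)) - int (card {e \<in> edges D. ends_of D e \<noteq> {}}) + int (card (faces D))
     = 2 * int (card (graph_components D))"

locale link_diagram =
  fixes D :: "('v, 'e) diagram"
  assumes finite_crossings: "finite (crossings D)"
    and finite_edges: "finite (edges D)"
    and strand_edge: "c \<in> crossings D \<Longrightarrow> strand D c p \<in> edges D"
    and two_ends: "e \<in> edges D \<Longrightarrow> ends_of D e = {} \<or> card (ends_of D e) = 2"
    and over_oriented: "c \<in> crossings D \<Longrightarrow> incoming D c North \<longleftrightarrow> \<not> incoming D c South"
    and under_oriented: "c \<in> crossings D \<Longrightarrow> incoming D c West \<longleftrightarrow> \<not> incoming D c East"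
    and edge_oriented: "\<lbrakk>e \<in> edges D; h \<in> ends_of D e; h' \<in> ends_of D e; h \<noteq> h'\<rbrakk>
      \<Longrightarrow> incoming D (fst h) (snd h) \<longleftrightarrow> \<not> incoming D (fst h') (snd h')"
    and planar: "planar_diagram D"

text \<open>With the overstrand pointing north, a crossing is negative iff the understrand points east.\<close>

definition num_negative :: "('v, 'e) diagram \<Rightarrow> nat" where
  "num_negative D = card {c \<in> crossings D. incoming D c South \<longleftrightarrow> incoming D c West}"


section \<open>The coloring group\<close>

definition edge_group :: "('v, 'e) diagram \<Rightarrow> ('e \<Rightarrow>\<^sub>0 int) monoid" where
  "edge_group D = free_Abelian_group (edges D)"

definition arc_relations :: "('v, 'e) diagram \<Rightarrow> ('e \<Rightarrow>\<^sub>0 int) set" where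
  "arc_relations D = generate (edge_group D)
     {frag_of (strand D c North) - frag_of (strand D c South) | c. c \<in> crossings D}"

definition arcs :: "('v, 'e) diagram \<Rightarrow> ('e \<Rightarrow>\<^sub>0 int) set monoid" where
  "arcs D = edge_group D Mod arc_relations D"

definition arc_of :: "('v, 'e) diagram \<Rightarrow> 'e \<Rightarrow> ('e \<Rightarrow>\<^sub>0 int) set" where
  "arc_of D e = arc_relations D #>\<^bsub>edge_group D\<^esub> frag_of e"

definition col_relations :: "('v, 'e) diagram \<Rightarrow> ('e \<Rightarrow>\<^sub>0 int) set set" where
  "col_relations D = generate (arcs D)
     {arc_of D (strand D c North) [^]\<^bsub>arcs D\<^esub> (2::nat)
        \<otimes>\<^bsub>arcs D\<^esub> inv\<^bsub>arcs D\<^esub> arc_of D (strand D c West)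
        \<otimes>\<^bsub>arcs D\<^esub> inv\<^bsub>arcs D\<^esub> arc_of D (strand D c East) | c. c \<in> crossings D}"

definition Col :: "('v, 'e) diagram \<Rightarrow> ('e \<Rightarrow>\<^sub>0 int) set set monoid" where
  "Col D = arcs D Mod col_relations D"

definition col_of :: "('v, 'e) diagram \<Rightarrow> 'e \<Rightarrow> ('e \<Rightarrow>\<^sub>0 int) set set" where
  "col_of D e = col_relations D #>\<^bsub>arcs D\<^esub> arc_of D e"


section \<open>Resolutions\<close>

text \<open>
  A vertex of the cube \<open>{0,1}\<^sup>n\<close> is given by the set \<open>\<alpha>\<close> of those crossings that get
  the 1-resolution. \<open>partner b p\<close> is the end joined to \<open>p\<close> in the 1-resolution (\<open>b\<close> true) or
  the 0-resolution (\<open>b\<close> false).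
\<close>

fun partner :: "bool \<Rightarrow> compass \<Rightarrow> compass" where
  "partner False South = West" | "partner False West = South"
| "partner False North = East" | "partner False East = North"
| "partner True North = West" | "partner True West = North"
| "partner True South = East" | "partner True East = South"

definition joined :: "('v, 'e) diagram \<Rightarrow> 'v set \<Rightarrow> ('e \<times> 'e) set" where
  "joined D \<alpha> = {(strand D c p, strand D c (partner (c \<in> \<alpha>) p)) | c p. c \<in> crossings D}"

text \<open>A circle of \<open>D\<^sub>\<alpha>\<close> is represented by the set of edges of \<open>D\<close> that it runs through.\<close>

definition circle_of :: "('v, 'e) diagram \<Rightarrow> 'v set \<Rightarrow> 'e \<Rightarrow> 'e set" where
  "circle_of D \<alpha> e = (joined D \<alpha>)\<^sup>* `` {e}"

definition circles :: "('v, 'e) diagram \<Rightarrow> 'v set \<Rightarrow> 'e set set" where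
  "circles D \<alpha> = circle_of D \<alpha> ` edges D"

type_synonym 'e ext = "(('e set \<Rightarrow>\<^sub>0 int) list \<Rightarrow>\<^sub>0 int) set"

definition circle_group :: "('v, 'e) diagram \<Rightarrow> 'v set \<Rightarrow> ('e set \<Rightarrow>\<^sub>0 int) monoid" where
  "circle_group D \<alpha> = free_Abelian_group (circles D \<alpha>)"

definition circle_alg :: "('v, 'e) diagram \<Rightarrow> 'v set \<Rightarrow> 'e ext ring" where
  "circle_alg D \<alpha> = ext_alg (circle_group D \<alpha>)"


section \<open>Edge maps of the cube\<close>

text \<open>
  The orientation of the crossings is a predicate \<open>ar\<close>: the arrow at \<open>c\<close> points from the SW arc
  to the NE arc if \<open>ar c\<close>, and from the NE arc to the SW arc otherwise. For an edge from
  \<open>\<alpha>\<close> to \<open>insert c \<alpha>\<close>, the resolution with fewer circles is a quotient of the other one;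
  \<open>super_circle D \<beta> C\<close> is the circle of \<open>D\<^sub>\<beta>\<close> to which \<open>C\<close> is mapped.
\<close>

definition super_circle :: "('v, 'e) diagram \<Rightarrow> 'v set \<Rightarrow> 'e set \<Rightarrow> 'e set" where
  "super_circle D \<beta> C = (THE C'. C' \<in> circles D \<beta> \<and> C \<subseteq> C')"

definition collapse :: "('v, 'e) diagram \<Rightarrow> 'v set \<Rightarrow> 'e ext \<Rightarrow> 'e ext" where
  "collapse D \<beta> = ext_map (circle_group D \<beta>) (frag_extend (\<lambda>C. frag_of (super_circle D \<beta> C)))"

definition merges :: "('v, 'e) diagram \<Rightarrow> 'v set \<Rightarrow> 'v \<Rightarrow> bool" where
  "merges D \<alpha> c \<longleftrightarrow> circle_of D \<alpha> (strand D c West) \<noteq> circle_of D \<alpha> (strand D c East)"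

text \<open>
  The arrow from SW to NE becomes, after rotation by 90 degrees clockwise, an arrow from
  the NW arc to the SE arc of the 1-resolution.
\<close>

definition split_factor :: "('v, 'e) diagram \<Rightarrow> ('v \<Rightarrow> bool) \<Rightarrow> 'v set \<Rightarrow> 'v \<Rightarrow> 'e ext" where
  "split_factor D ar \<alpha> c =
     (let \<beta> = insert c \<alpha>;
          nw = frag_of (circle_of D \<beta> (strand D c West));
          se = frag_of (circle_of D \<beta> (strand D c East))
      in ext_gen (circle_group D \<beta>) (if ar c then nw - se else se - nw))"

text \<open>
  In the split case the quotient of \<open>\<Lambda>\<^sup>*V(R')\<close> by \<open>c\<^sub>0' - c\<^sub>1'\<close> is identified with
  \<open>\<Lambda>\<^sup>*V(R)\<close> through \<open>collapse\<close>, and \<open>x\<close> goes to \<open>(c\<^sub>0' - c\<^sub>1') \<and> y\<close> for any \<open>y\<close> above \<open>x\<close>.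
\<close>

definition edge_map ::
  "('v, 'e) diagram \<Rightarrow> ('v \<Rightarrow> bool) \<Rightarrow> 'v set \<Rightarrow> 'v \<Rightarrow> 'e ext \<Rightarrow> 'e ext" where
  "edge_map D ar \<alpha> c x =
     (let \<beta> = insert c \<alpha> in
      if merges D \<alpha> c then collapse D \<beta> x
      else the_elem {split_factor D ar \<alpha> c \<otimes>\<^bsub>circle_alg D \<beta>\<^esub> y | y.
             y \<in> carrier (circle_alg D \<beta>) \<and> collapse D \<alpha> y = x})"


section \<open>Sign assignments of type Y\<close>

text \<open>
  \<open>traverse D \<alpha>\<close> follows a circle of \<open>D\<^sub>\<alpha>\<close>: arriving at a crossing through the given end, it passes
  along the arc of the resolution and then along the next edge. Its cycles are the
  oriented circles.
\<close>

definition traverse :: "('v, 'e) diagram \<Rightarrow> 'v set \<Rightarrow> 'v \<times> compass \<Rightarrow> 'v \<times> compass" where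
  "traverse D \<alpha> h = (case h of (c, p) \<Rightarrow> other_end D (c, partner (c \<in> \<alpha>) p))"

definition meets_in_order :: "('a \<Rightarrow> 'a) \<Rightarrow> 'a \<Rightarrow> 'a \<Rightarrow> 'a \<Rightarrow> 'a \<Rightarrow> bool" where
  "meets_in_order f p q r s \<longleftrightarrow>
     (\<exists>i j k. 0 < i \<and> i < j \<and> j < k \<and> (f ^^ i) p = q \<and> (f ^^ j) p = r \<and> (f ^^ k) p = s
        \<and> (\<forall>m \<in> {1..k}. (f ^^ m) p \<noteq> p))"

text \<open>
  In the 0-resolution the arrow lies to the left of a traveller going from W to S or from E to N,
  and to the right of one going from S to W or from N to E. The following are the ends
  through which one arrives at the tail or head of the arrow having the arrow on the left or right;
  the argument is the orientation of the crossing.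
\<close>

fun tail_left :: "bool \<Rightarrow> compass" where
  "tail_left True = West" | "tail_left False = East"

fun head_left :: "bool \<Rightarrow> compass" where
  "head_left True = East" | "head_left False = West"

fun tail_right :: "bool \<Rightarrow> compass" where
  "tail_right True = South" | "tail_right False = North"

fun head_right :: "bool \<Rightarrow> compass" where
  "head_right True = North" | "head_right False = South"

text \<open>
  Going counterclockwise around a circle, the inside is on the left. The pattern below is for
  \<open>a\<close> on the left and \<open>b\<close> on the right; it is invariant under exchanging the two sides
  together with \<open>a\<close> and \<open>b\<close>, so it does not depend on which region of the sphere is
  regarded as outer.
\<close>

definition negative_pattern ::
  "('v, 'e) diagram \<Rightarrow> ('v \<Rightarrow> bool) \<Rightarrow> 'v set \<Rightarrow> 'v \<Rightarrow> 'v \<Rightarrow> bool" where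
  "negative_pattern D ar \<alpha> a b \<longleftrightarrow>
     meets_in_order (traverse D \<alpha>)
       (a, tail_left (ar a)) (b, head_right (ar b)) (a, head_left (ar a)) (b, tail_right (ar b))"

definition face_map ::
  "('v, 'e) diagram \<Rightarrow> ('v \<Rightarrow> bool) \<Rightarrow> 'v set \<Rightarrow> 'v \<Rightarrow> 'v \<Rightarrow> 'e ext \<Rightarrow> 'e ext" where
  "face_map D ar \<alpha> c c' x = edge_map D ar (insert c \<alpha>) c' (edge_map D ar \<alpha> c x)"

definition face_map_nonzero ::
  "('v, 'e) diagram \<Rightarrow> ('v \<Rightarrow> bool) \<Rightarrow> 'v set \<Rightarrow> 'v \<Rightarrow> 'v \<Rightarrow> bool" where
  "face_map_nonzero D ar \<alpha> c c' \<longleftrightarrow>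
     (\<exists>x \<in> carrier (circle_alg D \<alpha>). face_map D ar \<alpha> c c' x \<noteq> \<zero>\<^bsub>circle_alg D (insert c' (insert c \<alpha>))\<^esub>)"

text \<open>
  If the compositions vanish, the two arcs are interleaved on one circle; the arc inside may
  be the one at \<open>c\<close> or the one at \<open>c'\<close>. The only cyclic order other than the negative pattern is
  tail of \<open>a\<close>, tail of \<open>b\<close>, head of \<open>a\<close>, head of \<open>b\<close>, with sign \<open>+1\<close>.
\<close>

definition face_sign ::
  "('v, 'e) diagram \<Rightarrow> ('v \<Rightarrow> bool) \<Rightarrow> 'v set \<Rightarrow> 'v \<Rightarrow> 'v \<Rightarrow> int" where
  "face_sign D ar \<alpha> c c' =
     (if face_map_nonzero D ar \<alpha> c c' \<and> face_map_nonzero D ar \<alpha> c' c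
      then (THE s. s \<in> {1, -1} \<and> (\<forall>x \<in> carrier (circle_alg D \<alpha>).
              face_map D ar \<alpha> c c' x
              = [s] \<cdot>\<^bsub>circle_alg D (insert c' (insert c \<alpha>))\<^esub> face_map D ar \<alpha> c' c x))
      else if negative_pattern D ar \<alpha> c c' \<or> negative_pattern D ar \<alpha> c' c then -1
      else 1)"

definition valid_sign_assignment ::
  "('v, 'e) diagram \<Rightarrow> ('v \<Rightarrow> bool) \<Rightarrow> ('v set \<Rightarrow> 'v \<Rightarrow> int) \<Rightarrow> bool" where
  "valid_sign_assignment D ar \<epsilon> \<longleftrightarrow>
     (\<forall>\<alpha> c. \<alpha> \<subseteq> crossings D \<and> c \<in> crossings D - \<alpha> \<longrightarrow> \<epsilon> \<alpha> c \<in> {1, -1}) \<and>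
     (\<forall>\<alpha> c c'. \<alpha> \<subseteq> crossings D \<and> c \<in> crossings D - \<alpha> \<and> c' \<in> crossings D - \<alpha> \<and> c \<noteq> c' \<longrightarrow>
        \<epsilon> \<alpha> c * \<epsilon> (insert c \<alpha>) c' * \<epsilon> \<alpha> c' * \<epsilon> (insert c' \<alpha>) c * face_sign D ar \<alpha> c c' = -1)"


section \<open>Odd Khovanov homology\<close>

definition vertices :: "('v, 'e) diagram \<Rightarrow> int \<Rightarrow> 'v set set" where
  "vertices D i = {\<alpha>. \<alpha> \<subseteq> crossings D \<and> int (card \<alpha>) - int (num_negative D) = i}"

definition chain_group :: "('v, 'e) diagram \<Rightarrow> int \<Rightarrow> ('v set \<Rightarrow> 'e ext) monoid" where
  "chain_group D i = product_group (vertices D i) (\<lambda>\<alpha>. add_monoid (circle_alg D \<alpha>))"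

definition differential ::
  "('v, 'e) diagram \<Rightarrow> ('v \<Rightarrow> bool) \<Rightarrow> ('v set \<Rightarrow> 'v \<Rightarrow> int) \<Rightarrow> int
     \<Rightarrow> ('v set \<Rightarrow> 'e ext) \<Rightarrow> ('v set \<Rightarrow> 'e ext)" where
  "differential D ar \<epsilon> i x =
     (\<lambda>\<beta> \<in> vertices D (i + 1).
        \<Oplus>\<^bsub>circle_alg D \<beta>\<^esub>c \<in> \<beta>. [\<epsilon> (\<beta> - {c}) c] \<cdot>\<^bsub>circle_alg D \<beta>\<^esub> edge_map D ar (\<beta> - {c}) c (x (\<beta> - {c})))"

definition cycles ::
  "('v, 'e) diagram \<Rightarrow> ('v \<Rightarrow> bool) \<Rightarrow> ('v set \<Rightarrow> 'v \<Rightarrow> int) \<Rightarrow> int \<Rightarrow> ('v set \<Rightarrow> 'e ext) set" where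
  "cycles D ar \<epsilon> i = kernel (chain_group D i) (chain_group D (i + 1)) (differential D ar \<epsilon> i)"

definition boundaries ::
  "('v, 'e) diagram \<Rightarrow> ('v \<Rightarrow> bool) \<Rightarrow> ('v set \<Rightarrow> 'v \<Rightarrow> int) \<Rightarrow> int \<Rightarrow> ('v set \<Rightarrow> 'e ext) set" where
  "boundaries D ar \<epsilon> i = differential D ar \<epsilon> (i - 1) ` carrier (chain_group D (i - 1))"

definition homology ::
  "('v, 'e) diagram \<Rightarrow> ('v \<Rightarrow> bool) \<Rightarrow> ('v set \<Rightarrow> 'v \<Rightarrow> int) \<Rightarrow> int
     \<Rightarrow> ('v set \<Rightarrow> 'e ext) set monoid" where
  "homology D ar \<epsilon> i =
     subgroup_generated (chain_group D i) (cycles D ar \<epsilon> i) Mod boundaries D ar \<epsilon> i"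

definition homology_class ::
  "('v, 'e) diagram \<Rightarrow> ('v \<Rightarrow> bool) \<Rightarrow> ('v set \<Rightarrow> 'v \<Rightarrow> int) \<Rightarrow> int
     \<Rightarrow> ('v set \<Rightarrow> 'e ext) \<Rightarrow> ('v set \<Rightarrow> 'e ext) set" where
  "homology_class D ar \<epsilon> i x = boundaries D ar \<epsilon> i #>\<^bsub>chain_group D i\<^esub> x"

definition Okh ::
  "('v, 'e) diagram \<Rightarrow> ('v \<Rightarrow> bool) \<Rightarrow> ('v set \<Rightarrow> 'v \<Rightarrow> int)
     \<Rightarrow> (int \<Rightarrow> ('v set \<Rightarrow> 'e ext) set) monoid" where
  "Okh D ar \<epsilon> = sum_group UNIV (homology D ar \<epsilon>)"


section \<open>The dotted identity cobordism\<close>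

text \<open>
  The sum in the definition of \<open>dot_exponent\<close> is even: each step along an edge of the cube changes it by
  0 or 2, and it is even at \<open>\<zeta>\<close>, which is the empty set.
\<close>

definition dot_exponent :: "('v, 'e) diagram \<Rightarrow> 'v set \<Rightarrow> nat" where
  "dot_exponent D \<alpha> = (card (circles D \<alpha>) + card (circles D {}) + card \<alpha>) div 2"

definition dot_map ::
  "('v, 'e) diagram \<Rightarrow> 'e \<Rightarrow> int \<Rightarrow> ('v set \<Rightarrow> 'e ext) \<Rightarrow> ('v set \<Rightarrow> 'e ext)" where
  "dot_map D e i x =
     (\<lambda>\<alpha> \<in> vertices D i.
        [((-1::int) ^ dot_exponent D \<alpha>)] \<cdot>\<^bsub>circle_alg D \<alpha>\<^esub>
          (ext_gen (circle_group D \<alpha>) (frag_of (circle_of D \<alpha> e)) \<otimes>\<^bsub>circle_alg D \<alpha>\<^esub> x \<alpha>))"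

end

theory Submission
  imports Defs
begin

text \<open>
  A planar diagram is checkerboard colourable, and the colouring orients the circles of all resolutions
  coherently. The circles of a resolution are then the cycles of a permutation of the incoming edge
  ends, and a surgery multiplies this permutation by a transposition. In particular each surgery merges two circles
  or splits one, and only six types of two-dimensional faces of the cube occur.

  The exterior algebra on the edges of the diagram maps onto \<open>\<Lambda>\<^sup>*V(D\<^sub>\<alpha>)\<close> for every resolution, and the
  edge maps are multiplications by 1 or by a difference of two edges on representatives. Wedging with an edge
  commutes with the differential up to the sign that \<open>S(D,\<alpha>)\<close> corrects, and distinct dots anticommute. So the edge group
  acts on homology by endomorphisms of square zero, and it remains to see that the relations of the coloring
  group act by zero. In every resolution the circles at \<open>W\<close> and \<open>E\<close> are those at \<open>N\<close> and \<open>S\<close>, so \<open>2N - W - E\<close> acts as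
  \<open>N - S\<close>. The signed surgeries from the 1-resolution back to the 0-resolution at the crossing form a
  null-homotopy of \<open>N - S\<close>: they anticommute with the surgeries at all other crossings. For the faces that pass from one
  circle to two and back to one, this is where the type Y convention and the planarity of the diagram enter.
\<close>

section \<open>Exterior algebras\<close>

text \<open>A split is defined through arbitrary preimages under \<open>collapse\<close>. Passing to
  representatives on edges makes these choices harmless at once: the only independence check is
  \<open>transport_lift\<close>, and it serves the surgeries and their reverses alike. The signs are
  the delicate point. On a face whose compositions do not vanish, \<open>face_sign\<close> is a
  definite description; it is pinned down because some image is not its own negative, which is
  tested in a torsion-free ring. On a face from one circle to two and back to one the compositions
  vanish and carry no sign, yet the homotopy sees one: the reverse surgery at one crossing and the
  split at the other separate the same two circles, and whether they do so in the same direction is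
  a question about the cyclic order of the arrow ends. To answer it, one coherently oriented
  traveller must meet all four ends, hence the two arcs must lie on different sides of the circle.
  This is a Jordan curve statement. For a planar graph given combinatorially it is obtained by
  counting: Euler's formula forces every mod 2 cycle to bound a set of faces.\<close>

abbreviation word_sum :: "('a list \<Rightarrow> 'b list) \<Rightarrow> ('a list \<Rightarrow>\<^sub>0 int) \<Rightarrow> ('b list \<Rightarrow>\<^sub>0 int)" where
  "word_sum g \<equiv> frag_extend (\<lambda>u. frag_of (g u))"

abbreviation free_mult :: "('a list \<Rightarrow>\<^sub>0 int) \<Rightarrow> ('a list \<Rightarrow>\<^sub>0 int) \<Rightarrow> ('a list \<Rightarrow>\<^sub>0 int)" where
  "free_mult v w \<equiv> frag_extend (\<lambda>s. frag_extend (\<lambda>t. frag_of (s @ t)) w) v"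

section \<open>Integral combinations of words and the free ring\<close>

lemma frag_induct [case_names zero one diff]:
  assumes "P 0" "\<And>x. P (frag_of x)" "\<And>a b. \<lbrakk>P a; P b\<rbrakk> \<Longrightarrow> P (a - b)"
  shows "P c"
  by (rule frag_induction[OF subset_UNIV]) (use assms in auto)

lemma frag_induct_on [consumes 1, case_names zero one diff]:
  assumes "Poly_Mapping.keys c \<subseteq> S" "P 0" "\<And>x. x \<in> S \<Longrightarrow> P (frag_of x)"
    and "\<And>a b. \<lbrakk>Poly_Mapping.keys a \<subseteq> S; Poly_Mapping.keys b \<subseteq> S; P a; P b\<rbrakk> \<Longrightarrow> P (a - b)"
  shows "P c"
proof -
  have "Poly_Mapping.keys c \<subseteq> S \<and> P c"
    using assms(1)
  proof (induction c rule: frag_induction)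
    case (diff a b)
    then show ?case using keys_diff[of a b] assms(4) by blast
  qed (use assms in \<open>auto simp: keys_frag_of\<close>)
  then show ?thesis ..
qed

lemma free_mult_add_right: "free_mult u (v + w) = free_mult u v + free_mult u w"
  by (induction u rule: frag_induct)
    (auto simp: frag_extend_add frag_extend_diff)

lemma free_mult_diff_right: "free_mult u (v - w) = free_mult u v - free_mult u w"
  by (induction u rule: frag_induct)
    (auto simp: frag_extend_add frag_extend_diff)

lemma free_mult_assoc: "free_mult (free_mult u v) w = free_mult u (free_mult v w)"
proof (induction u rule: frag_induct)
  case (one x)
  show ?case
  proof (induction v rule: frag_induct)
    case (one y)
    show ?case
      by (induction w rule: frag_induct)
        (auto simp: frag_extend_diff free_mult_diff_right)
  qed (auto simp: frag_extend_diff free_mult_diff_right)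
qed (auto simp: frag_extend_diff)

lemma keys_free_mult:
  assumes "Poly_Mapping.keys v \<subseteq> lists X" "Poly_Mapping.keys w \<subseteq> lists X"
  shows "Poly_Mapping.keys (free_mult v w) \<subseteq> lists X"
  using assms(1)
proof (induction v rule: frag_induct_on)
  case (one s)
  show ?case
    using assms(2)
  proof (induction w rule: frag_induct_on)
    case (one t)
    then show ?case using \<open>s \<in> lists X\<close> by (simp add: keys_frag_of)
  next
    case (diff a b)
    then show ?case using order_trans[OF keys_diff Un_least]
      by (simp add: frag_extend_diff)
  qed simp
next
  case (diff a b)
  then show ?case using order_trans[OF keys_diff Un_least] by (simp add: frag_extend_diff)
qed simp

lemma ring_free_ring: "ring (free_ring X)"
proof (rule ringI)
  show "abelian_group (free_ring X)"
  proof (rule abelian_groupI)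
    fix x assume "x \<in> carrier (free_ring X)"
    then show "\<exists>y\<in>carrier (free_ring X). y \<oplus>\<^bsub>free_ring X\<^esub> x = \<zero>\<^bsub>free_ring X\<^esub>"
      by (intro bexI[of _ "-x"]) (auto simp: free_ring_def)
  qed (use keys_add in \<open>fastforce simp: free_ring_def\<close>)+
  show "Group.monoid (free_ring X)"
  proof (rule monoidI)
    fix x assume "x \<in> carrier (free_ring X)"
    show "\<one>\<^bsub>free_ring X\<^esub> \<otimes>\<^bsub>free_ring X\<^esub> x = x"
      using frag_expansion[of x] by (simp add: free_ring_def)
    show "x \<otimes>\<^bsub>free_ring X\<^esub> \<one>\<^bsub>free_ring X\<^esub> = x"
      using frag_expansion[of x] by (simp add: free_ring_def)
  qed (auto simp: free_ring_def free_mult_assoc keys_frag_of dest: subsetD[OF keys_free_mult])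
next
  fix x y z
  show "(x \<oplus>\<^bsub>free_ring X\<^esub> y) \<otimes>\<^bsub>free_ring X\<^esub> z = x \<otimes>\<^bsub>free_ring X\<^esub> z \<oplus>\<^bsub>free_ring X\<^esub> y \<otimes>\<^bsub>free_ring X\<^esub> z"
    by (simp add: free_ring_def frag_extend_add)
  show "z \<otimes>\<^bsub>free_ring X\<^esub> (x \<oplus>\<^bsub>free_ring X\<^esub> y) = z \<otimes>\<^bsub>free_ring X\<^esub> x \<oplus>\<^bsub>free_ring X\<^esub> z \<otimes>\<^bsub>free_ring X\<^esub> y"
    by (simp add: free_ring_def free_mult_add_right)
qed

lemma free_ring_simps:
  "x \<oplus>\<^bsub>free_ring X\<^esub> y = x + y" "x \<otimes>\<^bsub>free_ring X\<^esub> y = free_mult x y"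
  "\<zero>\<^bsub>free_ring X\<^esub> = 0" "\<one>\<^bsub>free_ring X\<^esub> = frag_of []"
  "x \<in> carrier (free_ring X) \<longleftrightarrow> Poly_Mapping.keys x \<subseteq> lists X"
  by (simp_all add: free_ring_def)

lemma free_ring_minus:
  assumes "x \<in> carrier (free_ring X)" "y \<in> carrier (free_ring X)"
  shows "\<ominus>\<^bsub>free_ring X\<^esub> x = - x" "x \<ominus>\<^bsub>free_ring X\<^esub> y = x - y"
proof -
  interpret ring "free_ring X" by (rule ring_free_ring)
  have *: "\<ominus>\<^bsub>free_ring X\<^esub> z = - z" if "z \<in> carrier (free_ring X)" for z
    using that by (intro minus_equality) (auto simp: free_ring_simps)
  show "\<ominus>\<^bsub>free_ring X\<^esub> x = - x" "x \<ominus>\<^bsub>free_ring X\<^esub> y = x - y"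
    using assms * by (auto simp: a_minus_def free_ring_simps(1))
qed

lemma free_ring_word: "set u \<subseteq> X \<Longrightarrow> frag_of u \<in> carrier (free_ring X)"
  by (simp add: free_ring_simps keys_frag_of in_lists_conv_set subset_iff)

section \<open>The exterior algebra as a quotient of the free ring\<close>

definition ext_relators :: "('a, 'm) monoid_scheme \<Rightarrow> ('a list \<Rightarrow>\<^sub>0 int) set" where
  "ext_relators A = {frag_of [a \<otimes>\<^bsub>A\<^esub> b] - frag_of [a] - frag_of [b] | a b. a \<in> carrier A \<and> b \<in> carrier A}
      \<union> {frag_of [a, a] | a. a \<in> carrier A}"

lemma ext_ideal_eq: "ext_ideal A = Idl\<^bsub>free_ring (carrier A)\<^esub> (ext_relators A)"
  by (simp add: ext_ideal_def ext_relators_def)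

lemma (in comm_group) ext_relators_subset: "ext_relators G \<subseteq> carrier (free_ring (carrier G))"
proof -
  interpret F: ring "free_ring (carrier G)" by (rule ring_free_ring)
  have "frag_of [a \<otimes> b] - frag_of [a] - frag_of [b] \<in> carrier (free_ring (carrier G))"
    if "a \<in> carrier G" "b \<in> carrier G" for a b
  proof -
    have "frag_of [a \<otimes> b] \<ominus>\<^bsub>free_ring (carrier G)\<^esub> frag_of [a] \<ominus>\<^bsub>free_ring (carrier G)\<^esub> frag_of [b]
       \<in> carrier (free_ring (carrier G))"
      using that by (intro F.minus_closed free_ring_word) auto
    then show ?thesis
      using that by (simp add: free_ring_minus free_ring_word F.minus_closed)
        (metis F.minus_closed empty_subsetI free_ring_minus(2) free_ring_word insert_subset list.simps(15) empty_set m_closed)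
  qed
  then show ?thesis
    by (auto simp: ext_relators_def intro!: free_ring_word)
qed

lemma (in comm_group) ideal_ext_ideal: "ideal (ext_ideal G) (free_ring (carrier G))"
  unfolding ext_ideal_eq using ext_relators_subset ring.genideal_ideal ring_free_ring by blast

lemma (in comm_group) ring_ext_alg: "ring (ext_alg G)"
  unfolding ext_alg_def using ideal_ext_ideal ideal.quotient_is_ring by blast

definition ext_proj :: "('a, 'm) monoid_scheme \<Rightarrow> ('a list \<Rightarrow>\<^sub>0 int) \<Rightarrow> ('a list \<Rightarrow>\<^sub>0 int) set" where
  "ext_proj A w = ext_ideal A +>\<^bsub>free_ring (carrier A)\<^esub> w"

lemma ext_gen_eq: "ext_gen A a = ext_proj A (frag_of [a])"
  by (simp add: ext_gen_def ext_proj_def)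

lemma (in comm_group) ext_proj_hom: "ext_proj G \<in> ring_hom (free_ring (carrier G)) (ext_alg G)"
  using ideal.rcos_ring_hom[OF ideal_ext_ideal] unfolding ext_alg_def ext_proj_def[abs_def] .

lemma (in comm_group) carrier_ext_alg: "carrier (ext_alg G) = ext_proj G ` carrier (free_ring (carrier G))"
  by (auto simp: ext_alg_def ext_proj_def FactRing_def A_RCOSETS_defs a_r_coset_def)

lemma (in comm_group) ext_proj_relator:
  assumes "r \<in> ext_relators G"
  shows "ext_proj G r = \<zero>\<^bsub>ext_alg G\<^esub>"
proof -
  interpret F: ring "free_ring (carrier G)" by (rule ring_free_ring)
  interpret I: ideal "ext_ideal G" "free_ring (carrier G)" by (rule ideal_ext_ideal)
  have "r \<in> ext_ideal G"
    unfolding ext_ideal_eq using F.genideal_self[OF ext_relators_subset] assms by blast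
  then have "ext_proj G r = ext_ideal G"
    unfolding ext_proj_def using I.a_rcos_const by simp
  then show ?thesis by (simp add: ext_alg_def FactRing_def)
qed

locale ext_algebra = comm_group
begin

sublocale E: ring "ext_alg G" by (rule ring_ext_alg)
sublocale F: ring "free_ring (carrier G)" by (rule ring_free_ring)
sublocale P: ring_hom_ring "free_ring (carrier G)" "ext_alg G" "ext_proj G"
  by (intro ring_hom_ringI2 F.ring_axioms E.ring_axioms ext_proj_hom)

abbreviation gen where "gen \<equiv> ext_gen G"

lemma gen_closed [simp, intro]: "a \<in> carrier G \<Longrightarrow> gen a \<in> carrier (ext_alg G)"
  unfolding ext_gen_eq by (intro P.hom_closed free_ring_word) auto

lemma gen_mult:
  assumes "a \<in> carrier G" "b \<in> carrier G"
  shows "gen (a \<otimes> b) = gen a \<oplus>\<^bsub>ext_alg G\<^esub> gen b"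
proof -
  let ?F = "free_ring (carrier G)"
  have c: "frag_of [a \<otimes> b] \<in> carrier ?F" "frag_of [a] \<in> carrier ?F" "frag_of [b] \<in> carrier ?F"
    using assms by (auto intro!: free_ring_word)
  have "frag_of [a \<otimes> b] - frag_of [a] - frag_of [b] \<in> ext_relators G"
    using assms by (auto simp: ext_relators_def)
  then have "ext_proj G (frag_of [a \<otimes> b] \<ominus>\<^bsub>?F\<^esub> (frag_of [a] \<oplus>\<^bsub>?F\<^esub> frag_of [b])) = \<zero>\<^bsub>ext_alg G\<^esub>"
    using ext_proj_relator c F.a_closed[OF c(2,3)]
    by (simp add: free_ring_minus diff_diff_eq) (simp add: free_ring_simps)
  then show ?thesis
    unfolding ext_gen_eq using c by (simp add: a_minus_def P.hom_a_inv E.minus_equality E.r_neg2 E.minus_minus)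
      (metis E.add.inv_closed E.minus_equality E.minus_minus P.hom_closed E.a_closed)
qed

lemma gen_square:
  assumes "a \<in> carrier G"
  shows "gen a \<otimes>\<^bsub>ext_alg G\<^esub> gen a = \<zero>\<^bsub>ext_alg G\<^esub>"
proof -
  have "frag_of [a, a] \<in> ext_relators G" using assms by (auto simp: ext_relators_def)
  then have "ext_proj G (frag_of [a] \<otimes>\<^bsub>free_ring (carrier G)\<^esub> frag_of [a]) = \<zero>\<^bsub>ext_alg G\<^esub>"
    using ext_proj_relator by (simp add: free_ring_simps)
  then show ?thesis
    unfolding ext_gen_eq using assms by (simp add: free_ring_word)
qed

lemma gen_one [simp]: "gen \<one> = \<zero>\<^bsub>ext_alg G\<^esub>"
  using gen_mult[of \<one> \<one>] E.add.r_cancel_one[of "gen \<one>" "gen \<one>"] by auto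

lemma gen_inv: "a \<in> carrier G \<Longrightarrow> gen (inv a) = \<ominus>\<^bsub>ext_alg G\<^esub> gen a"
  using gen_mult[of "inv a" a] by (intro E.minus_equality[symmetric]) auto

lemma gen_anticomm:
  assumes "a \<in> carrier G" "b \<in> carrier G"
  shows "gen a \<otimes>\<^bsub>ext_alg G\<^esub> gen b = \<ominus>\<^bsub>ext_alg G\<^esub> (gen b \<otimes>\<^bsub>ext_alg G\<^esub> gen a)"
proof -
  have "\<zero>\<^bsub>ext_alg G\<^esub> = gen (a \<otimes> b) \<otimes>\<^bsub>ext_alg G\<^esub> gen (a \<otimes> b)"
    using assms by (simp add: gen_square)
  also have "\<dots> = gen a \<otimes>\<^bsub>ext_alg G\<^esub> gen b \<oplus>\<^bsub>ext_alg G\<^esub> gen b \<otimes>\<^bsub>ext_alg G\<^esub> gen a"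
    using assms by (simp add: gen_mult E.l_distr E.r_distr gen_square E.a_comm)
  finally show ?thesis
    using assms by (intro E.minus_equality[symmetric]) auto
qed

text \<open>Words generate the algebra additively, and a nonempty word is a generator times a
  shorter word. Stepping by left multiplication with a single generator suits the maps to come,
  which are given by left multiplications.\<close>

lemma ext_alg_induct [consumes 1, case_names one minus add gen]:
  assumes "x \<in> carrier (ext_alg G)"
    and one: "P \<one>\<^bsub>ext_alg G\<^esub>"
    and minus: "\<And>x. \<lbrakk>x \<in> carrier (ext_alg G); P x\<rbrakk> \<Longrightarrow> P (\<ominus>\<^bsub>ext_alg G\<^esub> x)"
    and add: "\<And>x y. \<lbrakk>x \<in> carrier (ext_alg G); y \<in> carrier (ext_alg G); P x; P y\<rbrakk> \<Longrightarrow> P (x \<oplus>\<^bsub>ext_alg G\<^esub> y)"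
    and gen: "\<And>a x. \<lbrakk>a \<in> carrier G; x \<in> carrier (ext_alg G); P x\<rbrakk> \<Longrightarrow> P (gen a \<otimes>\<^bsub>ext_alg G\<^esub> x)"
  shows "P x"
proof -
  have word: "P (ext_proj G (frag_of u))" if "set u \<subseteq> carrier G" for u
    using that
  proof (induction u)
    case Nil
    have "ext_proj G (frag_of []) = \<one>\<^bsub>ext_alg G\<^esub>"
      using P.hom_one by (simp add: free_ring_simps)
    then show ?case using one by simp
  next
    case (Cons a u)
    have "ext_proj G (frag_of (a # u)) = ext_proj G (frag_of [a] \<otimes>\<^bsub>free_ring (carrier G)\<^esub> frag_of u)"
      by (simp add: free_ring_simps)
    also have "\<dots> = gen a \<otimes>\<^bsub>ext_alg G\<^esub> ext_proj G (frag_of u)"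
      unfolding ext_gen_eq using Cons.prems by (intro P.hom_mult free_ring_word) auto
    finally show ?case using Cons by (auto intro!: gen P.hom_closed free_ring_word)
  qed
  obtain w where w: "Poly_Mapping.keys w \<subseteq> lists (carrier G)" "x = ext_proj G w"
    using assms(1) by (auto simp: carrier_ext_alg free_ring_simps)
  have "P (ext_proj G w)"
    using w(1)
  proof (induction w rule: frag_induct_on)
    case zero
    \<comment> \<open>Zero is not a case of the rule; it is obtained as 1 + (-1).\<close>
    have "P (\<one>\<^bsub>ext_alg G\<^esub> \<oplus>\<^bsub>ext_alg G\<^esub> \<ominus>\<^bsub>ext_alg G\<^esub> \<one>\<^bsub>ext_alg G\<^esub>)"
      by (intro add minus one) auto
    then show ?case using P.hom_zero by (simp add: E.r_neg free_ring_simps)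
  next
    case (one u)
    then show ?case using word by (auto simp: in_lists_conv_set keys_frag_of)
  next
    case (diff a b)
    then have c: "a \<in> carrier (free_ring (carrier G))" "b \<in> carrier (free_ring (carrier G))"
      by (auto simp: free_ring_simps)
    then have "ext_proj G (a - b) = ext_proj G a \<oplus>\<^bsub>ext_alg G\<^esub> \<ominus>\<^bsub>ext_alg G\<^esub> ext_proj G b"
      using free_ring_minus(2)[of a "carrier G" b] by (simp add: a_minus_def P.hom_a_inv flip: free_ring_minus(2))
    moreover have "P (ext_proj G a \<oplus>\<^bsub>ext_alg G\<^esub> \<ominus>\<^bsub>ext_alg G\<^esub> ext_proj G b)"
      using c diff by (intro add minus P.hom_closed E.a_inv_closed) auto
    ultimately show ?case by simp
  qed
  then show ?thesis using w by simp
qed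

end

section \<open>Homomorphisms out of an exterior algebra\<close>

lemma the_elem_hom_ext_proj:
  assumes G: "comm_group G" and R: "ring R"
    and h: "h \<in> ring_hom (free_ring (carrier G)) R"
    and relators: "\<And>r. r \<in> ext_relators G \<Longrightarrow> h r = \<zero>\<^bsub>R\<^esub>"
  shows "(\<lambda>X. the_elem (h ` X)) \<in> ring_hom (ext_alg G) R"
    and "w \<in> carrier (free_ring (carrier G)) \<Longrightarrow> the_elem (h ` ext_proj G w) = h w"
proof -
  interpret ext_algebra G using G by (simp add: ext_algebra_def)
  interpret R: ring R by fact
  interpret h: ring_hom_ring "free_ring (carrier G)" R h
    by (intro ring_hom_ringI2 F.ring_axioms R.ring_axioms h)
  have "ext_ideal G \<subseteq> a_kernel (free_ring (carrier G)) R h"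
    unfolding ext_ideal_eq
  proof (rule F.genideal_minimal[OF h.kernel_is_ideal], rule subsetI)
    fix r assume "r \<in> ext_relators G"
    then have "r \<in> carrier (free_ring (carrier G))" "h r = \<zero>\<^bsub>R\<^esub>"
      using relators ext_relators_subset by blast+
    then show "r \<in> a_kernel (free_ring (carrier G)) R h"
      unfolding AbelCoset.a_kernel_def' by blast
  qed
  then have ker: "h j = \<zero>\<^bsub>R\<^esub>" "j \<in> carrier (free_ring (carrier G))" if "j \<in> ext_ideal G" for j
    using that unfolding AbelCoset.a_kernel_def' by blast+
  \<comment> \<open>All elements of a coset have the same image because h kills the ideal, so
    \<open>the_elem\<close> picks a well-defined value. \<open>ext_map\<close> has this form by
    definition.\<close>
  have elem: "the_elem (h ` ext_proj G w) = h w" if w: "w \<in> carrier (free_ring (carrier G))" for w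
  proof -
    have "h v = h w" if "v \<in> ext_proj G w" for v
      using that w ker by (auto simp: ext_proj_def a_r_coset_def' h.hom_add)
    moreover have "w \<in> ext_proj G w"
      unfolding ext_proj_def a_r_coset_def' using w additive_subgroup.zero_closed[OF ideal.axioms(1)[OF ideal_ext_ideal]]
      by (intro UN_I[of "\<zero>\<^bsub>free_ring (carrier G)\<^esub>"]) simp_all
    ultimately have "h ` ext_proj G w = {h w}" by blast
    then show ?thesis by simp
  qed
  then show "w \<in> carrier (free_ring (carrier G)) \<Longrightarrow> the_elem (h ` ext_proj G w) = h w" .
  show "(\<lambda>X. the_elem (h ` X)) \<in> ring_hom (ext_alg G) R"
  proof (rule ring_hom_memI)
    fix X Y assume "X \<in> carrier (ext_alg G)" "Y \<in> carrier (ext_alg G)"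
    then obtain v w where vw: "v \<in> carrier (free_ring (carrier G))" "w \<in> carrier (free_ring (carrier G))"
      "X = ext_proj G v" "Y = ext_proj G w"
      by (auto simp: carrier_ext_alg)
    show "the_elem (h ` (X \<otimes>\<^bsub>ext_alg G\<^esub> Y)) = the_elem (h ` X) \<otimes>\<^bsub>R\<^esub> the_elem (h ` Y)"
      using vw by (simp add: elem F.m_closed h.hom_mult flip: P.hom_mult)
    show "the_elem (h ` (X \<oplus>\<^bsub>ext_alg G\<^esub> Y)) = the_elem (h ` X) \<oplus>\<^bsub>R\<^esub> the_elem (h ` Y)"
      using vw by (simp add: elem F.a_closed h.hom_add flip: P.hom_add)
  qed (auto simp: carrier_ext_alg elem simp flip: P.hom_one)
qed

text \<open>Multiplying the values of \<phi> along a word (\<open>W\<close>) and extending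
  additively gives a ring homomorphism on the free ring; additivity and the square condition say
  precisely that it kills the two kinds of relators. The target may be noncommutative, as is the
  case for endomorphism rings.\<close>

lemma ext_alg_universal:
  assumes G: "comm_group G" and R: "ring R"
    and closed: "\<And>a. a \<in> carrier G \<Longrightarrow> \<phi> a \<in> carrier R"
    and add: "\<And>a b. \<lbrakk>a \<in> carrier G; b \<in> carrier G\<rbrakk> \<Longrightarrow> \<phi> (a \<otimes>\<^bsub>G\<^esub> b) = \<phi> a \<oplus>\<^bsub>R\<^esub> \<phi> b"
    and square: "\<And>a. a \<in> carrier G \<Longrightarrow> \<phi> a \<otimes>\<^bsub>R\<^esub> \<phi> a = \<zero>\<^bsub>R\<^esub>"
  obtains \<Phi> where "\<Phi> \<in> ring_hom (ext_alg G) R" "\<And>a. a \<in> carrier G \<Longrightarrow> \<Phi> (ext_gen G a) = \<phi> a"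
proof -
  interpret ext_algebra G using G by (simp add: ext_algebra_def)
  interpret R: ring R by fact
  define W where "W u = foldr (\<lambda>a z. \<phi> a \<otimes>\<^bsub>R\<^esub> z) u \<one>\<^bsub>R\<^esub>" for u
  have Wc: "W u \<in> carrier R" if "set u \<subseteq> carrier G" for u
    using that by (induction u) (auto simp: W_def closed)
  have Wapp: "W (u @ v) = W u \<otimes>\<^bsub>R\<^esub> W v" if "set u \<subseteq> carrier G" "set v \<subseteq> carrier G" for u v
    using that(1)
  proof (induction u)
    case Nil
    then show ?case using Wc[OF that(2)] by (simp add: W_def)
  next
    case (Cons a u)
    then show ?case using Wc[OF that(2)] Wc[of u] by (simp add: W_def closed R.m_assoc)
  qed
  obtain h where h: "h \<in> hom (free_Abelian_group (lists (carrier G))) (add_monoid R)"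
    and h_of: "\<And>u. u \<in> lists (carrier G) \<Longrightarrow> h (frag_of u) = W u"
  proof (rule comm_group.free_Abelian_group_universal[OF R.a_comm_group, of W "lists (carrier G)"])
    show "W ` lists (carrier G) \<subseteq> carrier (add_monoid R)"
      using Wc by (auto simp: in_lists_conv_set subset_iff)
  qed blast
  have hc: "h v \<in> carrier R" if "Poly_Mapping.keys v \<subseteq> lists (carrier G)" for v
    using hom_in_carrier[OF h, of v] that by simp
  have h_add: "h (v + w) = h v \<oplus>\<^bsub>R\<^esub> h w"
    if "Poly_Mapping.keys v \<subseteq> lists (carrier G)" "Poly_Mapping.keys w \<subseteq> lists (carrier G)" for v w
    using hom_mult[OF h, of v w] that by simp
  have h_diff: "h (v - w) = h v \<oplus>\<^bsub>R\<^esub> \<ominus>\<^bsub>R\<^esub> h w"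
    if "Poly_Mapping.keys v \<subseteq> lists (carrier G)" "Poly_Mapping.keys w \<subseteq> lists (carrier G)" for v w
  proof -
    have "Poly_Mapping.keys (v - w) \<subseteq> lists (carrier G)"
      using keys_diff[of v w] that by blast
    then have "h (v - w) \<in> carrier R" "h v = h (v - w) \<oplus>\<^bsub>R\<^esub> h w"
      using h_add[of "v - w" w] hc that by auto
    then show ?thesis using hc[OF that(2)] by (simp add: R.a_assoc R.r_neg)
  qed
  have h_0: "h 0 = \<zero>\<^bsub>R\<^esub>"
    using h_diff[of 0 0] hc[of 0] by (simp add: R.r_neg)
  have hW: "h (free_mult (frag_of u) w) = W u \<otimes>\<^bsub>R\<^esub> h w"
    if "u \<in> lists (carrier G)" "Poly_Mapping.keys w \<subseteq> lists (carrier G)" for u w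
    using that(2)
  proof (induction w rule: frag_induct_on)
    case zero
    then show ?case using that Wc[of u] by (simp add: h_0 in_lists_conv_set subset_iff)
  next
    case (one v)
    then have "h (frag_of (u @ v)) = W (u @ v)" using h_of[of "u @ v"] that by simp
    then show ?case using that one Wapp[of u v] by (simp add: h_of in_lists_conv_set subset_iff)
  next
    case (diff a b)
    have "W u \<in> carrier R" using that Wc[of u] by (simp add: in_lists_conv_set subset_iff)
    then show ?case
      using diff hc[of a] hc[of b] keys_free_mult[of "frag_of u" "carrier G"] that
      by (simp add: free_mult_diff_right h_diff keys_frag_of R.r_distr R.r_minus del: frag_extend_of)
  qed
  have h_hom: "h \<in> ring_hom (free_ring (carrier G)) R"
  proof (rule ring_hom_memI)
    fix v w assume vw: "v \<in> carrier (free_ring (carrier G))" "w \<in> carrier (free_ring (carrier G))"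
    then show "h (v \<oplus>\<^bsub>free_ring (carrier G)\<^esub> w) = h v \<oplus>\<^bsub>R\<^esub> h w"
      by (simp add: free_ring_simps h_add)
    have "Poly_Mapping.keys v \<subseteq> lists (carrier G)" "Poly_Mapping.keys w \<subseteq> lists (carrier G)"
      using vw by (auto simp: free_ring_simps)
    then have "h (free_mult v w) = h v \<otimes>\<^bsub>R\<^esub> h w"
    proof (induction v rule: frag_induct_on)
      case zero
      then show ?case using hc[of w] by (simp add: h_0)
    next
      case (one u)
      then show ?case using hW[of u w] by (simp add: h_of)
    next
      case (diff a b)
      then show ?case
        using hc[of a] hc[of b] hc[of w] keys_free_mult[of _ "carrier G" w]
        by (simp add: frag_extend_diff h_diff R.l_distr R.l_minus)
    qed
    then show "h (v \<otimes>\<^bsub>free_ring (carrier G)\<^esub> w) = h v \<otimes>\<^bsub>R\<^esub> h w"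
      by (simp add: free_ring_simps)
  next
    have "h (frag_of []) = \<one>\<^bsub>R\<^esub>" by (simp add: h_of W_def)
    then show "h \<one>\<^bsub>free_ring (carrier G)\<^esub> = \<one>\<^bsub>R\<^esub>" by (simp add: free_ring_simps)
  qed (auto simp: free_ring_simps hc)
  have W1: "W [a] = \<phi> a" if "a \<in> carrier G" for a using that by (simp add: W_def closed)
  have rel: "h r = \<zero>\<^bsub>R\<^esub>" if "r \<in> ext_relators G" for r
    using that unfolding ext_relators_def
  proof (elim UnE CollectE exE conjE)
    fix a b assume ab: "r = frag_of [a \<otimes>\<^bsub>G\<^esub> b] - frag_of [a] - frag_of [b]" "a \<in> carrier G" "b \<in> carrier G"
    have "Poly_Mapping.keys (frag_of [a \<otimes>\<^bsub>G\<^esub> b] - frag_of [a]) \<subseteq> lists (carrier G)"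
      using keys_diff[of "frag_of [a \<otimes>\<^bsub>G\<^esub> b]" "frag_of [a]"] ab(2,3) by (auto simp: keys_frag_of)
    then show "h r = \<zero>\<^bsub>R\<^esub>"
      using ab by (simp add: h_diff keys_frag_of h_of W1 add closed R.a_ac)
        (metis R.a_assoc R.a_comm R.add.inv_closed R.r_neg R.r_neg1 closed)
  next
    fix a assume "r = frag_of [a, a]" "a \<in> carrier G"
    then show "h r = \<zero>\<^bsub>R\<^esub>" using closed[of a] by (simp add: h_of W_def square)
  qed
  show ?thesis
  proof (rule that)
    show "(\<lambda>X. the_elem (h ` X)) \<in> ring_hom (ext_alg G) R"
      by (rule the_elem_hom_ext_proj(1)[OF G R h_hom rel])
    fix a assume a: "a \<in> carrier G"
    then show "the_elem (h ` ext_gen G a) = \<phi> a"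
      unfolding ext_gen_eq using the_elem_hom_ext_proj(2)[OF G R h_hom rel, of "frag_of [a]"]
      by (simp add: free_ring_word h_of W1)
  qed
qed

text \<open>Applying f letter by letter is multiplicative on words and sends each relator of A to
  the relator of B formed from the images, so it descends to the quotients.\<close>

lemma
  assumes A: "comm_group A" and B: "comm_group B" and f: "f \<in> hom A B"
  shows ext_map_hom: "ext_map B f \<in> ring_hom (ext_alg A) (ext_alg B)"
    and ext_map_gen: "a \<in> carrier A \<Longrightarrow> ext_map B f (ext_gen A a) = ext_gen B (f a)"
proof -
  interpret A: ext_algebra A using A by (simp add: ext_algebra_def)
  interpret B: ext_algebra B using B by (simp add: ext_algebra_def)
  let ?m = "word_sum (map f) :: ('a list \<Rightarrow>\<^sub>0 int) \<Rightarrow> ('c list \<Rightarrow>\<^sub>0 int)"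
  define h where "h w = ext_proj B (?m w)" for w
  have fc: "f a \<in> carrier B" if "a \<in> carrier A" for a using f that by (rule hom_in_carrier)
  have keys: "Poly_Mapping.keys (?m w) \<subseteq> lists (carrier B)" if "Poly_Mapping.keys w \<subseteq> lists (carrier A)" for w
  proof
    fix u assume "u \<in> Poly_Mapping.keys (?m w)"
    then obtain v where "v \<in> Poly_Mapping.keys w" "u = map f v"
      using keys_frag_extend[of "\<lambda>u. frag_of (map f u)" w] by (auto simp: keys_frag_of)
    then show "u \<in> lists (carrier B)"
      using that fc by (auto simp: in_lists_conv_set dest!: subsetD)
  qed
  have mult: "?m (free_mult v w) = free_mult (?m v) (?m w)" for v w
  proof (induction v rule: frag_induct)
    case (one u)
    show ?case
      by (induction w rule: frag_induct) (auto simp: frag_extend_diff free_mult_diff_right)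
  qed (auto simp: frag_extend_diff)
  have h: "h \<in> ring_hom (free_ring (carrier A)) (ext_alg B)"
  proof (rule ring_hom_memI)
    fix v w assume vw: "v \<in> carrier (free_ring (carrier A))" "w \<in> carrier (free_ring (carrier A))"
    then have c: "?m v \<in> carrier (free_ring (carrier B))" "?m w \<in> carrier (free_ring (carrier B))"
      using keys by (auto simp: free_ring_simps)
    show "h v \<in> carrier (ext_alg B)" using c by (simp add: h_def)
    show "h (v \<oplus>\<^bsub>free_ring (carrier A)\<^esub> w) = h v \<oplus>\<^bsub>ext_alg B\<^esub> h w"
      using B.P.hom_add[OF c] by (simp add: h_def free_ring_simps frag_extend_add)
    show "h (v \<otimes>\<^bsub>free_ring (carrier A)\<^esub> w) = h v \<otimes>\<^bsub>ext_alg B\<^esub> h w"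
      using B.P.hom_mult[OF c] by (simp add: h_def free_ring_simps mult)
  next
    show "h \<one>\<^bsub>free_ring (carrier A)\<^esub> = \<one>\<^bsub>ext_alg B\<^esub>"
      using B.P.hom_one by (simp add: h_def free_ring_simps)
  qed
  have rel: "h r = \<zero>\<^bsub>ext_alg B\<^esub>" if "r \<in> ext_relators A" for r
  proof -
    have "?m r \<in> ext_relators B"
      using that f fc unfolding ext_relators_def
      by (auto simp: frag_extend_diff hom_mult) (metis hom_mult)
    then show ?thesis unfolding h_def by (rule B.ext_proj_relator)
  qed
  have eq: "ext_map B f = (\<lambda>X. the_elem (h ` X))"
    by (rule ext) (simp add: ext_map_def h_def ext_proj_def)
  show "ext_map B f \<in> ring_hom (ext_alg A) (ext_alg B)"
    unfolding eq by (rule the_elem_hom_ext_proj(1)[OF A B.E.ring_axioms h rel])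
  show "ext_map B f (ext_gen A a) = ext_gen B (f a)" if "a \<in> carrier A"
    unfolding eq ext_gen_eq using the_elem_hom_ext_proj(2)[OF A B.E.ring_axioms h rel, of "frag_of [a]"] that
    by (simp add: free_ring_word h_def)
qed

lemma ext_alg_hom_eqI:
  assumes "comm_group G" "ring R" and h: "h \<in> ring_hom (ext_alg G) R" and h': "h' \<in> ring_hom (ext_alg G) R"
    and gen: "\<And>a. a \<in> carrier G \<Longrightarrow> h (ext_gen G a) = h' (ext_gen G a)"
    and "x \<in> carrier (ext_alg G)"
  shows "h x = h' x"
proof -
  interpret ext_algebra G using assms by (simp add: ext_algebra_def)
  interpret h: ring_hom_ring "ext_alg G" R h
    by (intro ring_hom_ringI2 E.ring_axioms assms)
  interpret h': ring_hom_ring "ext_alg G" R h'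
    by (intro ring_hom_ringI2 E.ring_axioms assms)
  show ?thesis
    using \<open>x \<in> carrier (ext_alg G)\<close>
    by (induction x rule: ext_alg_induct) (auto simp: h.hom_a_inv h'.hom_a_inv gen)
qed

section \<open>Planarity and colourings of faces\<close>

abbreviation end_edge :: "('v, 'e) diagram \<Rightarrow> 'v \<times> compass \<Rightarrow> 'e" where
  "end_edge D h \<equiv> strand D (fst h) (snd h)"

lemma UNIV_compass: "UNIV = {North, East, South, West}"
  using compass.exhaust by auto

lemma finite_compass: "finite (UNIV :: compass set)"
  by (simp add: UNIV_compass)

text \<open>By the pigeonhole principle two iterates of x coincide; injectivity cancels the common
  initial steps until x itself recurs.\<close>

lemma funpow_bij_cycle:
  assumes "finite S" "bij_betw f S S" "x \<in> S"
  obtains n where "0 < n" "(f ^^ n) x = x"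
proof -
  have in_S: "(f ^^ n) x \<in> S" for n
    using assms by (induction n) (auto simp: bij_betw_def)
  have "\<not> inj_on (\<lambda>n. (f ^^ n) x) (UNIV :: nat set)"
  proof
    assume "inj_on (\<lambda>n. (f ^^ n) x) (UNIV :: nat set)"
    then have "finite (UNIV :: nat set)"
      by (rule inj_on_finite[OF _ _ assms(1)]) (use in_S in auto)
    then show False by simp
  qed
  then obtain i j where "i < j" "(f ^^ i) x = (f ^^ j) x"
    by (auto simp: inj_on_def) (metis linorder_neqE_nat)
  then have "0 < j - i \<and> (f ^^ (j - i)) x = x"
  proof (induction i arbitrary: j)
    case (Suc i)
    obtain j' where j: "j = Suc j'" using Suc.prems by (cases j) auto
    have "(f ^^ i) x = (f ^^ j') x"
      using Suc.prems j in_S assms(2) by (auto simp: bij_betw_def dest: inj_onD)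
    then show ?case using Suc.IH[of j'] Suc.prems j by simp
  qed simp
  then show ?thesis using that by blast
qed

section \<open>Ends of edges, faces, and boundaries of sets of faces modulo 2\<close>

context link_diagram
begin

lemma finite_edge_ends: "finite (edge_ends D)"
  by (simp add: edge_ends_def finite_crossings finite_compass)

lemma mem_edge_ends [simp]: "(c, p) \<in> edge_ends D \<longleftrightarrow> c \<in> crossings D"
  by (simp add: edge_ends_def)

lemma end_edge_in: "h \<in> edge_ends D \<Longrightarrow> end_edge D h \<in> edges D"
  by (cases h) (simp add: strand_edge)

lemma other_end_unique:
  assumes "h \<in> edge_ends D"
  shows "\<exists>!h'. h' \<in> ends_of D (end_edge D h) \<and> h' \<noteq> h"
proof -
  have "h \<in> ends_of D (end_edge D h)"
    using assms by (cases h) (simp add: ends_of_def)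
  moreover have "card (ends_of D (end_edge D h)) = 2"
    using two_ends[OF end_edge_in[OF assms]] calculation by auto
  ultimately show ?thesis
    by (auto simp: card_2_iff)
qed

lemma
  assumes "h \<in> edge_ends D"
  shows other_end_in [simp]: "other_end D h \<in> edge_ends D"
    and end_edge_other_end [simp]: "end_edge D (other_end D h) = end_edge D h"
    and other_end_neq: "other_end D h \<noteq> h"
    and end_edge_eqD: "\<lbrakk>h' \<in> edge_ends D; end_edge D h' = end_edge D h\<rbrakk> \<Longrightarrow> h' = h \<or> h' = other_end D h"
proof -
  have *: "other_end D h \<in> ends_of D (end_edge D h) \<and> other_end D h \<noteq> h"
    unfolding other_end_def by (rule theI'[OF other_end_unique[OF assms]])
  then show "other_end D h \<in> edge_ends D" "end_edge D (other_end D h) = end_edge D h" "other_end D h \<noteq> h"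
    by (auto simp: ends_of_def)
  show "h' = h \<or> h' = other_end D h" if "h' \<in> edge_ends D" "end_edge D h' = end_edge D h"
  proof -
    have "h' \<in> ends_of D (end_edge D h)" using that by (cases h') (simp add: ends_of_def)
    then show ?thesis using * other_end_unique[OF assms] by blast
  qed
qed

lemma other_end_other_end [simp]: "h \<in> edge_ends D \<Longrightarrow> other_end D (other_end D h) = h"
  using end_edge_eqD[of "other_end D h" h] other_end_neq[of h] by auto

definition face_of :: "'v \<times> compass \<Rightarrow> ('v \<times> compass) set" where
  "face_of h = range (\<lambda>n. (face_step D ^^ n) h)"

lemma faces_eq: "faces D = face_of ` edge_ends D"
  by (simp add: faces_def face_of_def)

lemma face_step_other_end: "c \<in> crossings D \<Longrightarrow> face_step D (other_end D (c, p)) = (c, ccw p)"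
  by (simp add: face_step_def)

lemma ccw_inj: "ccw p = ccw q \<Longrightarrow> p = q"
  by (cases p; cases q) auto

lemma bij_face_step: "bij_betw (face_step D) (edge_ends D) (edge_ends D)"
proof (rule bij_betw_imageI)
  show inj: "inj_on (face_step D) (edge_ends D)"
  proof (rule inj_onI)
    fix x y assume xy: "x \<in> edge_ends D" "y \<in> edge_ends D" "face_step D x = face_step D y"
    then have "other_end D x = other_end D y"
      by (auto simp: face_step_def split: prod.splits dest: ccw_inj)
    then show "x = y" using xy other_end_other_end by metis
  qed
  have "face_step D ` edge_ends D \<subseteq> edge_ends D"
  proof (rule image_subsetI)
    fix h assume "h \<in> edge_ends D"
    then have "other_end D h \<in> edge_ends D" by simp
    then show "face_step D h \<in> edge_ends D"
      unfolding face_step_def by (cases "other_end D h") simp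
  qed
  then show "face_step D ` edge_ends D = edge_ends D"
    using finite_edge_ends inj by (intro card_subset_eq) (auto simp: card_image)
qed

lemma face_of_face_step:
  assumes "h \<in> edge_ends D"
  shows "face_of (face_step D h) = face_of h"
proof
  show "face_of (face_step D h) \<subseteq> face_of h"
  proof
    fix x assume "x \<in> face_of (face_step D h)"
    then obtain n where "x = (face_step D ^^ n) (face_step D h)" by (auto simp: face_of_def)
    then have "x = (face_step D ^^ Suc n) h" by (simp add: funpow_swap1)
    then show "x \<in> face_of h" unfolding face_of_def by blast
  qed
next
  obtain n where n: "0 < n" "(face_step D ^^ n) h = h"
    using funpow_bij_cycle[OF finite_edge_ends bij_face_step assms] .
  show "face_of h \<subseteq> face_of (face_step D h)"
  proof
    fix x assume "x \<in> face_of h"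
    then obtain m where "x = (face_step D ^^ m) h" by (auto simp: face_of_def)
    then have "x = (face_step D ^^ (m + (n - 1))) (face_step D h)"
      using n by (cases n) (simp_all add: funpow_add funpow_swap1)
    then show "x \<in> face_of (face_step D h)" by (auto simp: face_of_def)
  qed
qed

text \<open>Exclusive or over the four ends at the crossing: the degree of C there is odd. An edge
  with both ends at c counts twice and cancels.\<close>

definition parity :: "'e set \<Rightarrow> 'v \<Rightarrow> bool" where
  "parity C c \<longleftrightarrow> ((strand D c North \<in> C) \<noteq> (strand D c South \<in> C)) \<noteq> ((strand D c West \<in> C) \<noteq> (strand D c East \<in> C))"

definition proper_edges :: "'e set" where
  "proper_edges = {e \<in> edges D. ends_of D e \<noteq> {}}"

lemma end_edge_proper: "h \<in> edge_ends D \<Longrightarrow> end_edge D h \<in> proper_edges"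
  using end_edge_in by (cases h) (auto simp: proper_edges_def ends_of_def)

lemma strand_proper: "c \<in> crossings D \<Longrightarrow> strand D c p \<in> proper_edges"
  using end_edge_proper[of "(c, p)"] by simp

lemma proper_edgeE:
  assumes "e \<in> proper_edges"
  obtains h where "h \<in> edge_ends D" "end_edge D h = e"
  using assms by (auto simp: proper_edges_def ends_of_def)

text \<open>The regions on the two sides of an edge are the faces of its two ends, so this is the
  boundary modulo 2 of the 2-chain A.\<close>

definition dual_boundary :: "('v \<times> compass) set set \<Rightarrow> 'e set" where
  "dual_boundary A = {e \<in> proper_edges. \<exists>h \<in> edge_ends D. end_edge D h = e \<and> (face_of h \<in> A) \<noteq> (face_of (other_end D h) \<in> A)}"

lemma end_edge_dual_boundary:
  assumes "h \<in> edge_ends D"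
  shows "end_edge D h \<in> dual_boundary A \<longleftrightarrow> (face_of h \<in> A) \<noteq> (face_of (other_end D h) \<in> A)"
proof
  assume "end_edge D h \<in> dual_boundary A"
  then obtain h' where h': "h' \<in> edge_ends D" "end_edge D h' = end_edge D h"
    "(face_of h' \<in> A) \<noteq> (face_of (other_end D h') \<in> A)"
    by (auto simp: dual_boundary_def)
  then show "(face_of h \<in> A) \<noteq> (face_of (other_end D h) \<in> A)"
    using end_edge_eqD[OF assms h'(1,2)] assms by auto
qed (use assms end_edge_proper in \<open>auto simp: dual_boundary_def\<close>)

text \<open>From the other end of (c, p) a face step leads to (c, ccw p), so the face across the
  strand p is the face of the next end at c.\<close>

lemma strand_dual_boundary:
  assumes "c \<in> crossings D"
  shows "strand D c p \<in> dual_boundary A \<longleftrightarrow> (face_of (c, p) \<in> A) \<noteq> (face_of (c, ccw p) \<in> A)"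
  using end_edge_dual_boundary[of "(c, p)" A] face_of_face_step[of "other_end D (c, p)"] assms
  by (simp add: face_step_other_end)

definition cycle_space :: "'e set set" where
  "cycle_space = {C. C \<subseteq> proper_edges \<and> (\<forall>c \<in> crossings D. \<not> parity C c)}"

text \<open>A walk around a crossing returns to the face where it started, so it changes between A
  and its complement an even number of times.\<close>

lemma dual_boundary_cycle: "dual_boundary A \<in> cycle_space"
proof -
  have "\<not> parity (dual_boundary A) c" if "c \<in> crossings D" for c
    using that by (auto simp: parity_def strand_dual_boundary)
  then show ?thesis by (auto simp: cycle_space_def dual_boundary_def)
qed

section \<open>Counting cycles and boundaries\<close>

lemma adjacent_sym: "(c, c') \<in> adjacent D \<Longrightarrow> (c', c) \<in> adjacent D"
  by (auto simp: adjacent_def) metis+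

lemma adjacent_rtrancl_sym: "(c, c') \<in> (adjacent D)\<^sup>* \<Longrightarrow> (c', c) \<in> (adjacent D)\<^sup>*"
  by (metis adjacent_sym sym_rtrancl symD symI)

lemma adjacent_rtrancl_in: "\<lbrakk>(c, c') \<in> (adjacent D)\<^sup>*; c \<in> crossings D\<rbrakk> \<Longrightarrow> c' \<in> crossings D"
  by (induction rule: rtrancl_induct) (auto simp: adjacent_def)

text \<open>A base crossing in each component. It absorbs the redundant parity condition of the
  component in \<open>card_cycle_space\<close>, and the face at it removes the ambiguity of a face
  set with given boundary in \<open>card_dual_boundaries\<close>.\<close>

definition root :: "'v set \<Rightarrow> 'v" where "root K = (SOME c. c \<in> K)"

lemma root_in: "K \<in> graph_components D \<Longrightarrow> root K \<in> K"
  unfolding root_def by (rule someI_ex) (auto simp: graph_components_def)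

lemma component_eq:
  assumes "K \<in> graph_components D" "c \<in> K"
  shows "K = (adjacent D)\<^sup>* `` {c}"
  using assms adjacent_rtrancl_sym by (auto simp: graph_components_def) (meson rtrancl_trans)+

lemma component_crossings: "K \<in> graph_components D \<Longrightarrow> K \<subseteq> crossings D"
  using adjacent_rtrancl_in by (auto simp: graph_components_def)

lemma inj_root: "inj_on root (graph_components D)"
  by (rule inj_onI) (metis component_eq root_in)

lemma finite_components: "finite (graph_components D)"
  by (simp add: graph_components_def finite_crossings)

lemma finite_faces: "finite (faces D)"
  by (simp add: faces_eq finite_edge_ends)

lemma finite_proper_edges: "finite proper_edges"
  by (simp add: proper_edges_def finite_edges)

lemma ccw_closed_all:
  assumes "\<And>p. P p \<Longrightarrow> P (ccw p)" "P p"
  shows "P q"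
proof -
  have "P (ccw p)" "P (ccw (ccw p))" "P (ccw (ccw (ccw p)))" using assms by blast+
  then show ?thesis using assms(2) by (cases p; cases q) auto
qed

text \<open>Whether A and A' agree on a face does not change when an edge is crossed, since the
  boundaries are equal. So it is constant over the faces along a connected component, and the face
  at \<open>root\<close> decides.\<close>

lemma dual_boundary_inj:
  assumes A: "A \<subseteq> faces D" "A' \<subseteq> faces D" and eq: "dual_boundary A = dual_boundary A'"
    and root: "\<And>K. K \<in> graph_components D \<Longrightarrow> face_of (root K, North) \<in> A \<longleftrightarrow> face_of (root K, North) \<in> A'"
  shows "A = A'"
proof -
  define d where "d h \<longleftrightarrow> (face_of h \<in> A) = (face_of h \<in> A')" for h
  have d_ccw: "d (c, ccw p) \<longleftrightarrow> d (c, p)" if "c \<in> crossings D" for c p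
    using that eq strand_dual_boundary[of c p A] strand_dual_boundary[of c p A'] by (auto simp: d_def)
  have d_other: "d (other_end D h) \<longleftrightarrow> d h" if "h \<in> edge_ends D" for h
    using that eq end_edge_dual_boundary[of h A] end_edge_dual_boundary[of h A'] by (auto simp: d_def)
  have d_all: "d (c, q)" if "c \<in> crossings D" "d (c, p)" for c p q
    by (rule ccw_closed_all[where P="\<lambda>p. d (c, p)"]) (use that d_ccw in auto)
  have d_conn: "d (c', q)" if "(c, c') \<in> (adjacent D)\<^sup>*" "c \<in> crossings D" "d (c, p)" for c c' p q
    using that(1)
  proof (induction arbitrary: q rule: rtrancl_induct)
    case base
    show ?case using d_all that by blast
  next
    case (step y z)
    then obtain p p' where p: "strand D y p = strand D z p'" "y \<in> crossings D" "z \<in> crossings D"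
      by (auto simp: adjacent_def)
    have "(z, p') = (y, p) \<or> (z, p') = other_end D (y, p)"
      using end_edge_eqD[of "(y, p)" "(z, p')"] p by simp
    then have "d (z, p')" using step.IH[of p] d_other[of "(y, p)"] p by auto
    then show ?case using d_all p by blast
  qed
  have "d (c, p)" if "c \<in> crossings D" for c p
  proof -
    let ?K = "(adjacent D)\<^sup>* `` {c}"
    have K: "?K \<in> graph_components D" using that by (auto simp: graph_components_def)
    have "(root ?K, c) \<in> (adjacent D)\<^sup>*" "root ?K \<in> crossings D"
      using root_in[OF K] component_crossings[OF K] adjacent_rtrancl_sym by auto
    then show ?thesis using d_conn[of "root ?K" c North p] root[OF K] by (simp add: d_def)
  qed
  then have "face_of h \<in> A \<longleftrightarrow> face_of h \<in> A'" if "h \<in> edge_ends D" for h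
    using that by (cases h) (auto simp: d_def)
  then show ?thesis using A unfolding faces_eq by blast
qed

definition symdiff :: "'e set \<Rightarrow> 'e set \<Rightarrow> 'e set" where
  "symdiff A B = {e. (e \<in> A) \<noteq> (e \<in> B)}"

lemma parity_symdiff: "parity (symdiff A B) c \<longleftrightarrow> parity A c \<noteq> parity B c"
  by (auto simp: parity_def symdiff_def)

text \<open>The edges of a walk from c to c' are added modulo 2: each new edge changes the parity at
  its two ends. A step from a crossing to itself adds nothing.\<close>

lemma parity_path:
  assumes "(c, c') \<in> (adjacent D)\<^sup>*" "c \<in> crossings D"
  shows "\<exists>C \<subseteq> proper_edges. \<forall>x \<in> crossings D. parity C x \<longleftrightarrow> (x = c) \<noteq> (x = c')"
  using assms(1)
proof (induction rule: rtrancl_induct)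
  case base
  show ?case by (intro exI[of _ "{}"]) (auto simp: parity_def)
next
  case (step y z)
  then obtain C where C: "C \<subseteq> proper_edges" "\<forall>x \<in> crossings D. parity C x \<longleftrightarrow> (x = c) \<noteq> (x = y)"
    by blast
  show ?case
  proof (cases "y = z")
    case True
    then show ?thesis using C by blast
  next
    case False
    obtain p p' where p: "strand D y p = strand D z p'" "y \<in> crossings D" "z \<in> crossings D"
      using step by (auto simp: adjacent_def)
    have zp: "(z, p') = other_end D (y, p)"
      using end_edge_eqD[of "(y, p)" "(z, p')"] p False by auto
    have iff: "strand D x q = strand D y p \<longleftrightarrow> (x, q) = (y, p) \<or> (x, q) = (z, p')" if "x \<in> crossings D" for x q
    proof
      show "(x, q) = (y, p) \<or> (x, q) = (z, p')" if "strand D x q = strand D y p"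
        using end_edge_eqD[of "(y, p)" "(x, q)"] p \<open>x \<in> crossings D\<close> zp that by simp
    qed (use p in auto)
    have "parity {strand D y p} x \<longleftrightarrow> (x = y) \<noteq> (x = z)" if "x \<in> crossings D" for x
      unfolding parity_def singleton_iff iff[OF that] prod.inject
      using False by (cases "x = y"; cases "x = z"; cases p; cases p'; simp)
    then have "\<forall>x \<in> crossings D. parity (symdiff C {strand D y p}) x \<longleftrightarrow> (x = c) \<noteq> (x = z)"
      using C(2) by (auto simp: parity_symdiff)
    moreover have "symdiff C {strand D y p} \<subseteq> proper_edges"
      using C(1) strand_proper p by (auto simp: symdiff_def)
    ultimately show ?thesis by blast
  qed
qed

text \<open>Odd parity can be moved along a path to the root of the component, so the parities at
  all other crossings can be prescribed freely.\<close>

lemma parity_surj: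
  assumes "B \<subseteq> crossings D - root ` graph_components D"
  shows "\<exists>C \<subseteq> proper_edges. \<forall>x \<in> crossings D - root ` graph_components D. parity C x \<longleftrightarrow> x \<in> B"
  using finite_subset[OF assms finite_Diff[OF finite_crossings]] assms
proof (induction B rule: finite_induct)
  case empty
  show ?case by (intro exI[of _ "{}"]) (auto simp: parity_def)
next
  case (insert v B)
  then obtain C where C: "C \<subseteq> proper_edges"
    "\<forall>x \<in> crossings D - root ` graph_components D. parity C x \<longleftrightarrow> x \<in> B" by blast
  let ?K = "(adjacent D)\<^sup>* `` {v}"
  have v: "v \<in> crossings D" using insert by blast
  have K: "?K \<in> graph_components D" using v by (auto simp: graph_components_def)
  obtain P where P: "P \<subseteq> proper_edges" "\<forall>x \<in> crossings D. parity P x \<longleftrightarrow> (x = v) \<noteq> (x = root ?K)"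
    using parity_path[of v "root ?K"] root_in[OF K] v by auto
  have "\<forall>x \<in> crossings D - root ` graph_components D. parity (symdiff C P) x \<longleftrightarrow> x \<in> insert v B"
    using C(2) P(2) K insert.hyps by (auto simp: parity_symdiff)
  moreover have "symdiff C P \<subseteq> proper_edges"
    using C(1) P(1) by (auto simp: symdiff_def)
  ultimately show ?case by blast
qed

text \<open>Adding \<open>pre B\<close> to a cycle is injective in the pair, because the parities
  recover B. In dimensions: with E edges at V crossings and K components, the cycle space has
  dimension at most E - (V - K).\<close>

lemma card_cycle_space:
  "card cycle_space * 2 ^ (card (crossings D) - card (graph_components D)) \<le> 2 ^ card proper_edges"
proof -
  let ?N = "crossings D - root ` graph_components D"
  have "\<forall>B. \<exists>C. B \<subseteq> ?N \<longrightarrow> C \<subseteq> proper_edges \<and> (\<forall>x \<in> ?N. parity C x \<longleftrightarrow> x \<in> B)"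
    using parity_surj by metis
  then obtain pre where pre: "\<And>B. B \<subseteq> ?N \<Longrightarrow> pre B \<subseteq> proper_edges \<and> (\<forall>x \<in> ?N. parity (pre B) x \<longleftrightarrow> x \<in> B)"
    by metis
  have "inj_on (\<lambda>(z, B). symdiff z (pre B)) (cycle_space \<times> Pow ?N)"
  proof (rule inj_onI, clarify)
    fix z B z' B' assume h: "z \<in> cycle_space" "z' \<in> cycle_space" "B \<subseteq> ?N" "B' \<subseteq> ?N"
      "symdiff z (pre B) = symdiff z' (pre B')"
    have "x \<in> B \<longleftrightarrow> x \<in> B'" if "x \<in> ?N" for x
    proof -
      have "parity (symdiff z (pre B)) x \<longleftrightarrow> x \<in> B" "parity (symdiff z' (pre B')) x \<longleftrightarrow> x \<in> B'"
        using h(1-4) pre that by (auto simp: parity_symdiff cycle_space_def)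
      then show ?thesis using h(5) by simp
    qed
    then have "B = B'" using h(3,4) by blast
    moreover have "z = z'" using h(5) unfolding \<open>B = B'\<close> by (auto simp: symdiff_def set_eq_iff)
    ultimately show "z = z' \<and> B = B'" by simp
  qed
  moreover have "(\<lambda>(z, B). symdiff z (pre B)) ` (cycle_space \<times> Pow ?N) \<subseteq> Pow proper_edges"
  proof clarify
    fix z B e assume "z \<in> cycle_space" "B \<subseteq> ?N" "e \<in> symdiff z (pre B)"
    then show "e \<in> proper_edges" using pre[of B] by (auto simp: symdiff_def cycle_space_def)
  qed
  ultimately have "card (cycle_space \<times> Pow ?N) \<le> card (Pow proper_edges)"
    by (intro card_inj_on_le) (auto simp: finite_proper_edges)
  moreover have "card ?N = card (crossings D) - card (graph_components D)"
    using root_in component_crossings finite_components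
    by (subst card_Diff_subset) (auto simp: card_image inj_root)
  ultimately show ?thesis
    by (simp add: card_cartesian_product card_Pow finite_proper_edges finite_crossings)
qed

text \<open>A set of faces is recovered from its boundary up to one binary choice per component,
  namely whether it contains the face at the root.\<close>

lemma card_dual_boundaries:
  "2 ^ card (faces D) \<le> card (dual_boundary ` Pow (faces D)) * 2 ^ card (graph_components D)"
proof -
  let ?f = "\<lambda>A. (dual_boundary A, {K \<in> graph_components D. face_of (root K, North) \<in> A})"
  have "inj_on ?f (Pow (faces D))"
  proof (rule inj_onI)
    fix A A' assume h: "A \<in> Pow (faces D)" "A' \<in> Pow (faces D)" "?f A = ?f A'"
    show "A = A'"
    proof (rule dual_boundary_inj)
      fix K assume "K \<in> graph_components D"
      then show "face_of (root K, North) \<in> A \<longleftrightarrow> face_of (root K, North) \<in> A'"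
        using h(3) by blast
    qed (use h in auto)
  qed
  moreover have "?f ` Pow (faces D) \<subseteq> dual_boundary ` Pow (faces D) \<times> Pow (graph_components D)"
    by auto
  ultimately have "card (Pow (faces D)) \<le> card (dual_boundary ` Pow (faces D) \<times> Pow (graph_components D))"
    by (intro card_inj_on_le) (auto simp: finite_faces finite_components)
  then show ?thesis
    by (simp add: card_cartesian_product card_Pow finite_faces finite_components)
qed

text \<open>By Euler's formula there are at least as many boundaries of sets of faces as mod 2 cycles.\<close>

lemma cycle_is_dual_boundary: "dual_boundary ` Pow (faces D) = cycle_space"
proof (rule card_subset_eq)
  show fin: "finite cycle_space"
    by (rule finite_subset[of _ "Pow proper_edges"]) (auto simp: cycle_space_def finite_proper_edges)
  show sub: "dual_boundary ` Pow (faces D) \<subseteq> cycle_space"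
    using dual_boundary_cycle by blast
  let ?V = "card (crossings D)" and ?K = "card (graph_components D)" and ?E = "card proper_edges"
    and ?F = "card (faces D)"
  have KV: "?K \<le> ?V"
    using card_inj_on_le[OF inj_root _ finite_crossings] root_in component_crossings by blast
  \<comment> \<open>V - E + F = 2K rearranged; with K \<le> V the truncated subtraction is a true
    one. This is where planarity enters.\<close>
  have euler: "?F + (?V - ?K) = ?E + ?K"
    using planar KV unfolding planar_diagram_def proper_edges_def by linarith
  have "card cycle_space * 2 ^ (?V - ?K) * 2 ^ ?K \<le> 2 ^ ?E * 2 ^ ?K"
    using card_cycle_space by simp
  also have "\<dots> = (2 ^ ?F :: nat) * 2 ^ (?V - ?K)"
    by (simp add: euler flip: power_add)
  also have "\<dots> \<le> card (dual_boundary ` Pow (faces D)) * 2 ^ ?K * 2 ^ (?V - ?K)"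
    using card_dual_boundaries by simp
  finally have "card cycle_space \<le> card (dual_boundary ` Pow (faces D))"
    by (simp add: mult.assoc mult.commute[of "2 ^ ?K"])
  then show "card (dual_boundary ` Pow (faces D)) = card cycle_space"
    using card_mono[OF fin sub] by simp
qed

section \<open>Two-colourings of the regions\<close>

lemma cycle_colouring:
  assumes "\<And>c. c \<in> crossings D \<Longrightarrow> \<not> parity C c"
  obtains g :: "'v \<times> compass \<Rightarrow> bool" where "\<And>h. h \<in> edge_ends D \<Longrightarrow> g (other_end D h) \<noteq> g h \<longleftrightarrow> end_edge D h \<in> C"
    and "\<And>c p. c \<in> crossings D \<Longrightarrow> g (c, ccw p) \<noteq> g (c, p) \<longleftrightarrow> strand D c p \<in> C"
proof -
  \<comment> \<open>Edges without crossings have no ends to colour and are cut off. The remaining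
    cycle bounds a set A of faces, and membership in A is the colouring.\<close>
  have "C \<inter> proper_edges \<in> cycle_space"
    using assms strand_proper by (auto simp: cycle_space_def parity_def)
  then obtain A where A: "C \<inter> proper_edges = dual_boundary A"
    using cycle_is_dual_boundary by blast
  show ?thesis
  proof (rule that[of "\<lambda>h. face_of h \<in> A"])
    fix h assume "h \<in> edge_ends D"
    then show "(face_of (other_end D h) \<in> A) \<noteq> (face_of h \<in> A) \<longleftrightarrow> end_edge D h \<in> C"
      using end_edge_dual_boundary[of h A] end_edge_proper[of h] A by blast
  next
    fix c p assume "c \<in> crossings D"
    then show "(face_of (c, ccw p) \<in> A) \<noteq> (face_of (c, p) \<in> A) \<longleftrightarrow> strand D c p \<in> C"
      using strand_dual_boundary[of c p A] strand_proper[of c p] A by blast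
  qed
qed

text \<open>The value \<open>g h\<close> is the colour of the region on the left of a traveller arriving through the end \<open>h\<close>.\<close>

lemma traverse_colouring:
  assumes C: "\<And>c p. c \<in> crossings D \<Longrightarrow> strand D c (partner (c \<in> \<beta>) p) \<in> C \<longleftrightarrow> strand D c p \<in> C"
  obtains g :: "'v \<times> compass \<Rightarrow> bool" where "\<And>h. h \<in> edge_ends D \<Longrightarrow> g (other_end D h) \<noteq> g h \<longleftrightarrow> end_edge D h \<in> C"
    and "\<And>c p. c \<in> crossings D \<Longrightarrow> g (c, ccw p) \<noteq> g (c, p) \<longleftrightarrow> strand D c p \<in> C"
    and "\<And>h. h \<in> edge_ends D \<Longrightarrow> g (traverse D \<beta> h) = g h"
proof -
  have par: "\<not> parity C c" if "c \<in> crossings D" for c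
    unfolding parity_def using C[OF that, of North] C[OF that, of South] by (cases "c \<in> \<beta>") auto
  show ?thesis
  proof (rule cycle_colouring[OF par])
    fix g :: "'v \<times> compass \<Rightarrow> bool"
    assume g: "\<And>h. h \<in> edge_ends D \<Longrightarrow> g (other_end D h) \<noteq> g h \<longleftrightarrow> end_edge D h \<in> C"
      "\<And>c p. c \<in> crossings D \<Longrightarrow> g (c, ccw p) \<noteq> g (c, p) \<longleftrightarrow> strand D c p \<in> C"
  have "g (traverse D \<beta> h) = g h" if h: "h \<in> edge_ends D" for h
  proof -
    obtain c p where cp: "h = (c, p)" "c \<in> crossings D" using h by (cases h) auto
    let ?q = "partner (c \<in> \<beta>) p"
    have t: "traverse D \<beta> h = other_end D (c, ?q)" by (simp add: traverse_def cp)
    have 1: "g (traverse D \<beta> h) \<noteq> g (c, ?q) \<longleftrightarrow> strand D c ?q \<in> C"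
      unfolding t using g(1)[of "(c, ?q)"] cp by simp
    \<comment> \<open>Turning from p to its partner passes exactly one of the two strands, and C
      contains both or neither. So the colour changes in the turn iff it changes along the following
      edge, and the two changes cancel.\<close>
    have "?q = ccw p \<or> p = ccw ?q" by (cases "c \<in> \<beta>"; cases p) auto
    then have 2: "g (c, ?q) \<noteq> g (c, p) \<longleftrightarrow> strand D c p \<in> C"
      using g(2)[of c p] g(2)[of c ?q] C[of c p] cp by metis
    show ?thesis using 1 2 C[of c p] cp by blast
  qed
    then show thesis using that[of g] g by blast
  qed
qed

end

section \<open>Permutations composed with transpositions\<close>

definition reach :: "('a \<Rightarrow> 'a) \<Rightarrow> 'a \<Rightarrow> 'a \<Rightarrow> bool" where
  "reach f x y \<longleftrightarrow> (\<exists>n. (f ^^ n) x = y)"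

lemma reach_refl [simp]: "reach f x x"
  unfolding reach_def by (intro exI[of _ 0]) simp

lemma reach_step: "reach f x (f x)"
  unfolding reach_def by (intro exI[of _ 1]) simp

lemma reach_trans: "\<lbrakk>reach f x y; reach f y z\<rbrakk> \<Longrightarrow> reach f x z"
  unfolding reach_def by (metis comp_apply funpow_add)

lemma reach_induct [consumes 1, case_names refl step]:
  assumes "reach f x y" "P x" "\<And>z. \<lbrakk>reach f x z; P z\<rbrakk> \<Longrightarrow> P (f z)"
  shows "P y"
proof -
  obtain n where n: "(f ^^ n) x = y" using assms(1) by (auto simp: reach_def)
  have "P ((f ^^ n) x)" for n
    by (induction n) (use assms in \<open>auto simp: reach_def\<close>)
  then show ?thesis using n by blast
qed

locale finite_perm =
  fixes S :: "'a set" and f :: "'a \<Rightarrow> 'a"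
  assumes finite_S: "finite S" and bij: "bij_betw f S S"
begin

lemma f_in: "x \<in> S \<Longrightarrow> f x \<in> S"
  using bij by (auto simp: bij_betw_def)

lemma funpow_in: "x \<in> S \<Longrightarrow> (f ^^ n) x \<in> S"
  by (induction n) (auto simp: f_in)

lemma reach_in: "\<lbrakk>reach f x y; x \<in> S\<rbrakk> \<Longrightarrow> y \<in> S"
  by (auto simp: reach_def funpow_in)

lemma reach_back: "x \<in> S \<Longrightarrow> reach f (f x) x"
proof -
  assume "x \<in> S"
  then obtain n where n: "0 < n" "(f ^^ n) x = x" using funpow_bij_cycle[OF finite_S bij] by blast
  then have "(f ^^ (n - 1)) (f x) = x" by (cases n) (auto simp: funpow_swap1)
  then show ?thesis by (auto simp: reach_def)
qed

lemma reach_sym: "\<lbrakk>reach f x y; x \<in> S\<rbrakk> \<Longrightarrow> reach f y x"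
proof (induction rule: reach_induct)
  case (step z)
  then show ?case using reach_back[of z] reach_in[of x z] reach_trans by metis
qed simp

text \<open>Here n is the least return time: below it all iterates differ, and from it on they
  repeat.\<close>

lemma period:
  assumes "x \<in> S"
  obtains n where "0 < n" "(f ^^ n) x = x" "\<And>i j. \<lbrakk>i < n; j < n; (f ^^ i) x = (f ^^ j) x\<rbrakk> \<Longrightarrow> i = j"
    "\<And>y. reach f x y \<Longrightarrow> \<exists>i<n. (f ^^ i) x = y"
proof -
  define n where "n = (LEAST n. 0 < n \<and> (f ^^ n) x = x)"
  obtain m where "0 < m \<and> (f ^^ m) x = x" using funpow_bij_cycle[OF finite_S bij assms] by blast
  then have n: "0 < n" "(f ^^ n) x = x" unfolding n_def by (metis (mono_tags, lifting) LeastI)+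
  have least: "\<not> (0 < k \<and> (f ^^ k) x = x)" if "k < n" for k
    using not_less_Least that unfolding n_def by blast
  have aux: "(f ^^ (j - i)) x = x" if "i \<le> j" "(f ^^ i) x = (f ^^ j) x" for i j
    using that
  proof (induction i arbitrary: j)
    case (Suc i)
    then obtain j' where j: "j = Suc j'" by (cases j) auto
    have "(f ^^ i) x = (f ^^ j') x"
      using Suc.prems j funpow_in[OF assms] bij by (auto simp: bij_betw_def dest: inj_onD)
    then show ?case using Suc.IH[of j'] Suc.prems j by simp
  qed simp
  show ?thesis
  proof (rule that[OF n])
    fix i j assume ij: "i < n" "j < n" "(f ^^ i) x = (f ^^ j) x"
    then have "\<not> 0 < j - i" "\<not> 0 < i - j"
      using aux[of i j] aux[of j i] least[of "j - i"] least[of "i - j"] by auto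
    then show "i = j" by simp
  next
    fix y assume "reach f x y"
    then show "\<exists>i<n. (f ^^ i) x = y"
    proof (induction rule: reach_induct)
      case refl
      show ?case using n by (intro exI[of _ 0]) simp
    next
      case (step z)
      then obtain i where i: "i < n" "(f ^^ i) x = z" by blast
      show ?case
      proof (cases "Suc i = n")
        case True
        then show ?thesis using i n by (intro exI[of _ 0]) auto
      next
        case False
        then show ?thesis using i by (intro exI[of _ "Suc i"]) auto
      qed
    qed
  qed
qed

end

section \<open>Merging and splitting orbits by a transposition\<close>

locale perm_swap = finite_perm S f for S :: "'a set" and f +
  fixes f' :: "'a \<Rightarrow> 'a" and x y :: 'a
  assumes x_in: "x \<in> S" and y_in: "y \<in> S" and neq: "x \<noteq> y"
    and swap_x: "f' x = f y" and swap_y: "f' y = f x"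
    and swap_other: "\<And>z. \<lbrakk>z \<in> S; z \<noteq> x; z \<noteq> y\<rbrakk> \<Longrightarrow> f' z = f z"
begin

lemma bij': "bij_betw f' S S"
proof -
  let ?t = "\<lambda>z. if z = x then y else if z = y then x else z"
  have "bij_betw ?t S S"
    by (rule bij_betw_byWitness[where f'="?t"]) (use x_in y_in in auto)
  then have "bij_betw (f \<circ> ?t) S S" by (rule bij_betw_trans[OF _ bij])
  moreover have "(f \<circ> ?t) z = f' z" if "z \<in> S" for z
    using that swap_x swap_y swap_other by auto
  ultimately show ?thesis by (simp cong: bij_betw_cong)
qed

sublocale swapped: finite_perm S f'
  by unfold_locales (use finite_S bij' in auto)

lemma perm_swap_sym: "perm_swap S f' f x y"
  by unfold_locales (use x_in y_in neq swap_x swap_y swap_other in auto)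

lemma perm_swap_comm: "perm_swap S f f' y x"
  by unfold_locales (use x_in y_in neq swap_x swap_y swap_other in auto)

lemma funpow_swap_eq:
  assumes "z \<in> S" "\<And>m. \<lbrakk>a \<le> m; m < a + n\<rbrakk> \<Longrightarrow> (f ^^ m) z \<noteq> x \<and> (f ^^ m) z \<noteq> y"
  shows "(f' ^^ n) ((f ^^ a) z) = (f ^^ (a + n)) z"
  using assms(2)
proof (induction n)
  case (Suc n)
  then have "(f' ^^ n) ((f ^^ a) z) = (f ^^ (a + n)) z" "(f ^^ (a + n)) z \<noteq> x" "(f ^^ (a + n)) z \<noteq> y"
    by auto
  then show ?case using swap_other funpow_in[OF assms(1)] by simp
qed simp

text \<open>\<open>f\<close> and \<open>f'\<close> agree away from x and y. The last point of the
  segment is exempt, so a segment may run into x or y.\<close>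

lemma reach_swap_segment:
  assumes "z \<in> S" "a \<le> b" "\<And>m. \<lbrakk>a \<le> m; m < b\<rbrakk> \<Longrightarrow> (f ^^ m) z \<noteq> x \<and> (f ^^ m) z \<noteq> y"
  shows "reach f' ((f ^^ a) z) ((f ^^ b) z)"
  using funpow_swap_eq[of z a "b - a"] assms unfolding reach_def by auto

lemma reach_swap_x:
  assumes "0 < b" "\<And>m. \<lbrakk>0 < m; m < b\<rbrakk> \<Longrightarrow> (f ^^ m) y \<noteq> x \<and> (f ^^ m) y \<noteq> y"
  shows "reach f' x ((f ^^ b) y)"
proof -
  have "reach f' ((f ^^ 1) y) ((f ^^ b) y)"
    using assms by (intro reach_swap_segment y_in) auto
  then show ?thesis using reach_step[of f' x] swap_x by (auto intro: reach_trans)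
qed

text \<open>Leaving x, \<open>f'\<close> continues where \<open>f\<close> would leave y. If x is not
  on the \<open>f\<close>-cycle of y, this leads once around that cycle and arrives at y.\<close>

lemma reach_swap_merge:
  assumes "\<not> reach f x y"
  shows "reach f' x y"
proof -
  obtain n where n: "0 < n" "(f ^^ n) y = y" "\<And>i j. \<lbrakk>i < n; j < n; (f ^^ i) y = (f ^^ j) y\<rbrakk> \<Longrightarrow> i = j"
    using period[OF y_in] by metis
  have "reach f' x ((f ^^ n) y)"
  proof (rule reach_swap_x[OF n(1)])
    fix m assume m: "0 < m" "m < n"
    have "(f ^^ m) y \<noteq> y" using n(3)[of m 0] m n(1) by auto
    moreover have "(f ^^ m) y \<noteq> x" using assms reach_sym[of y x] y_in by (auto simp: reach_def)
    ultimately show "(f ^^ m) y \<noteq> x \<and> (f ^^ m) y \<noteq> y" by simp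
  qed
  then show ?thesis using n by simp
qed

text \<open>From x, \<open>f'\<close> enters the \<open>f\<close>-cycle just behind y, follows it up
  to x and jumps back behind y, so its orbit closes up without meeting y.\<close>

lemma reach_swap_split:
  assumes "reach f x y"
  shows "\<not> reach f' x y"
proof
  assume r': "reach f' x y"
  obtain n where n: "0 < n" "(f ^^ n) y = y" "\<And>i j. \<lbrakk>i < n; j < n; (f ^^ i) y = (f ^^ j) y\<rbrakk> \<Longrightarrow> i = j"
    "\<And>z. reach f y z \<Longrightarrow> \<exists>i<n. (f ^^ i) y = z"
    using period[OF y_in] by metis
  obtain k where k: "k < n" "(f ^^ k) y = x" using n(4) reach_sym[OF assms x_in] by blast
  have k0: "0 < k" using k neq by (cases k) auto
  have nxy: "(f ^^ m) y \<noteq> x \<and> (f ^^ m) y \<noteq> y" if "0 < m" "m < k" for m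
    using n(3)[of m k] n(3)[of m 0] that k by auto
  have "\<exists>m. 0 < m \<and> m \<le> k \<and> z = (f ^^ m) y" if "reach f' x z" for z
    using that
  proof (induction rule: reach_induct)
    case refl
    show ?case using k k0 by blast
  next
    case (step z)
    then obtain m where m: "0 < m" "m \<le> k" "z = (f ^^ m) y" by blast
    show ?case
    proof (cases "m = k")
      case True
      then show ?thesis using m k k0 swap_x by (intro exI[of _ 1]) auto
    next
      case False
      then have "f' z = f z" using swap_other[of z] nxy[of m] m funpow_in[OF y_in] by auto
      then show ?thesis using m False by (intro exI[of _ "Suc m"]) auto
    qed
  qed
  then obtain m where "0 < m" "m \<le> k" "y = (f ^^ m) y" using r' by metis
  then show False using n(3)[of m 0] k n(1) by auto
qed

lemma reach_swap_iff: "reach f' x y \<longleftrightarrow> \<not> reach f x y"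
  using reach_swap_merge reach_swap_split by blast

text \<open>A step of \<open>f'\<close> is a step of \<open>f\<close>, or leaves one of x and y for
  the successor of the other. So no orbits other than those of x and y can become connected, and
  these two are connected by assumption.\<close>

lemma reach_merge_iff:
  assumes r': "reach f' x y" and a: "a \<in> S"
  shows "reach f' a b \<longleftrightarrow> reach f a b \<or> ((reach f x a \<or> reach f y a) \<and> (reach f x b \<or> reach f y b))"
proof
  have yx: "reach f' y x" by (rule swapped.reach_sym[OF r' x_in])
  have sub: "reach f' u v" if "reach f u v" "u \<in> S" for u v
    using that
  proof (induction rule: reach_induct)
    case (step z)
    have "reach f' z (f z)"
      using swap_x swap_y swap_other[of z] reach_in[OF step(1,3)] reach_step[of f'] r' yx reach_trans by metis
    then show ?case using step reach_trans by metis
  qed simp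
  show "reach f' a b" if "reach f a b \<or> ((reach f x a \<or> reach f y a) \<and> (reach f x b \<or> reach f y b))"
  proof -
    have xz: "reach f' x z" "reach f' z x" if "reach f x z \<or> reach f y z" for z
    proof -
      show "reach f' x z" using that sub x_in y_in r' reach_trans by metis
      then show "reach f' z x" using swapped.reach_sym x_in by blast
    qed
    show ?thesis using that sub a xz reach_trans by metis
  qed
  assume "reach f' a b"
  then show "reach f a b \<or> ((reach f x a \<or> reach f y a) \<and> (reach f x b \<or> reach f y b))"
  proof (induction rule: reach_induct)
    case (step z)
    have zS: "z \<in> S" using swapped.reach_in[OF step(1) a] .
    consider "z = x" | "z = y" | "f' z = f z" using swap_other zS by blast
    then show ?case
    proof cases
      case 1
      then show ?thesis using step.IH swap_x reach_step[of f y] reach_sym[of a x] a by auto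
    next
      case 2
      then show ?thesis using step.IH swap_y reach_step[of f x] reach_sym[of a y] a by auto
    next
      case 3
      then show ?thesis using step.IH reach_step[of f z] reach_trans[of f] by metis
    qed
  qed simp
qed

text \<open>Starting from p, if r came before both swapped points or after both, an
  \<open>f'\<close>-path from p to r would survive: in the first case the segment is undisturbed, in
  the second it takes a short cut from the first swapped point to behind the second one. So r lies
  between them.\<close>

lemma interleaved_order:
  assumes p: "p \<in> S" and "reach f p x" "reach f p y" "reach f p r" and neq': "p \<noteq> x" "p \<noteq> y" "r \<noteq> x" "r \<noteq> y" "p \<noteq> r"
    and sep: "\<not> reach f' p r"
  shows "meets_in_order f p x r y \<or> meets_in_order f p y r x"
proof -
  obtain n where n: "0 < n" "(f ^^ n) p = p" "\<And>i j. \<lbrakk>i < n; j < n; (f ^^ i) p = (f ^^ j) p\<rbrakk> \<Longrightarrow> i = j"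
    "\<And>z. reach f p z \<Longrightarrow> \<exists>i<n. (f ^^ i) p = z"
    using period[OF p] by metis
  obtain i j k where ijk: "i < n" "j < n" "k < n" "(f ^^ i) p = x" "(f ^^ j) p = r" "(f ^^ k) p = y"
    using n(4) assms(2-4) by metis
  have pos: "0 < i" "0 < j" "0 < k" "i \<noteq> j" "j \<noteq> k" "i \<noteq> k"
    using ijk neq' neq by (auto intro!: gr0I)
  have hit: "m = i" if "(f ^^ m) p = x" "m < n" for m using n(3)[of m i] that ijk by auto
  have hit': "m = k" if "(f ^^ m) p = y" "m < n" for m using n(3)[of m k] that ijk by auto
  have noret: "\<forall>m\<in>{1..l}. (f ^^ m) p \<noteq> p" if "l < n" for l
  proof
    fix m assume "m \<in> {1..l}"
    then show "(f ^^ m) p \<noteq> p" using n(3)[of m 0] that by auto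
  qed
  have "\<not> (j < i \<and> j < k)"
  proof
    assume j: "j < i \<and> j < k"
    have "reach f' ((f ^^ 0) p) ((f ^^ j) p)"
      by (rule reach_swap_segment[OF p]) (use j hit hit' ijk in fastforce)+
    then show False using sep ijk by simp
  qed
  moreover have "\<not> (i < j \<and> k < j)"
  proof
    assume j: "i < j \<and> k < j"
    have seg: "reach f' ((f ^^ Suc (max i k)) p) r"
      using reach_swap_segment[OF p, of "Suc (max i k)" j] hit hit' ijk j by fastforce
    have "reach f' ((f ^^ 0) p) ((f ^^ min i k) p)"
      by (rule reach_swap_segment[OF p]) (use hit hit' ijk in fastforce)+
    moreover have "f' ((f ^^ min i k) p) = (f ^^ Suc (max i k)) p"
      using ijk swap_x swap_y by (auto simp: min_def max_def)
    ultimately have "reach f' p ((f ^^ Suc (max i k)) p)"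
      using reach_step[of f' "(f ^^ min i k) p"] reach_trans by fastforce
    then show False using sep seg reach_trans by metis
  qed
  ultimately consider "i < j" "j < k" | "k < j" "j < i" using pos by linarith
  then show ?thesis
  proof cases
    case 1
    then have "meets_in_order f p x r y"
      unfolding meets_in_order_def using pos ijk noret by blast
    then show ?thesis ..
  next
    case 2
    then have "meets_in_order f p y r x"
      unfolding meets_in_order_def using pos ijk noret by blast
    then show ?thesis ..
  qed
qed

end

section \<open>Cyclic order read off from connectivity after a transposition\<close>

context finite_perm
begin

lemma meets_in_orderE:
  assumes "meets_in_order f p q r s" "p \<in> S"
  obtains i j k n where "0 < i" "i < j" "j < k" "k < n" "(f ^^ i) p = q" "(f ^^ j) p = r" "(f ^^ k) p = s" "(f ^^ n) p = p"
    "\<And>i j. \<lbrakk>i < n; j < n; (f ^^ i) p = (f ^^ j) p\<rbrakk> \<Longrightarrow> i = j"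
proof -
  obtain n where n: "0 < n" "(f ^^ n) p = p" "\<And>i j. \<lbrakk>i < n; j < n; (f ^^ i) p = (f ^^ j) p\<rbrakk> \<Longrightarrow> i = j"
    using period[OF assms(2)] by metis
  obtain i j k where ijk: "0 < i" "i < j" "j < k" "(f ^^ i) p = q" "(f ^^ j) p = r" "(f ^^ k) p = s"
    "\<forall>m\<in>{1..k}. (f ^^ m) p \<noteq> p"
    using assms(1) unfolding meets_in_order_def by blast
  have "k < n" using ijk(7) n(1,2) by (rule_tac ccontr) (auto simp: not_less)
  then show ?thesis using that n ijk by blast
qed

end

text \<open>The second and the fourth point are swapped, so the segment from the first to the second
  is undisturbed.\<close>

lemma (in perm_swap) meets_in_order_swap_even:
  assumes "meets_in_order f p x r y" "p \<in> S"
  shows "reach f' p x"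
proof -
  obtain i j k n where o: "0 < i" "i < j" "j < k" "k < n" "(f ^^ i) p = x" "(f ^^ k) p = y"
    "\<And>i j. \<lbrakk>i < n; j < n; (f ^^ i) p = (f ^^ j) p\<rbrakk> \<Longrightarrow> i = j"
    using meets_in_orderE[OF assms] by metis
  have "reach f' ((f ^^ 0) p) ((f ^^ i) p)"
  proof (rule reach_swap_segment[OF assms(2)])
    fix m assume "m < i"
    then have "(f ^^ m) p \<noteq> (f ^^ i) p" "(f ^^ m) p \<noteq> (f ^^ k) p"
      using o(7)[of m i] o(7)[of m k] o(1-4) by linarith+
    then show "(f ^^ m) p \<noteq> x \<and> (f ^^ m) p \<noteq> y" using o(5,6) by simp
  qed simp
  then show ?thesis using o by simp
qed

text \<open>The first and the third point are swapped, so the segment from the fourth around to the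
  first is undisturbed.\<close>

lemma (in perm_swap) meets_in_order_swap_odd:
  assumes "meets_in_order f x q y s"
  shows "reach f' s x"
proof -
  obtain i j k n where o: "0 < i" "i < j" "j < k" "k < n" "(f ^^ j) x = y" "(f ^^ k) x = s" "(f ^^ n) x = x"
    "\<And>i j. \<lbrakk>i < n; j < n; (f ^^ i) x = (f ^^ j) x\<rbrakk> \<Longrightarrow> i = j"
    using meets_in_orderE[OF assms x_in] by metis
  have "reach f' ((f ^^ k) x) ((f ^^ n) x)"
  proof (rule reach_swap_segment[OF x_in])
    fix m assume "k \<le> m" "m < n"
    then have "(f ^^ m) x \<noteq> (f ^^ 0) x" "(f ^^ m) x \<noteq> (f ^^ j) x"
      using o(8)[of m 0] o(8)[of m j] o(1-4) by linarith+
    then show "(f ^^ m) x \<noteq> x \<and> (f ^^ m) x \<noteq> y" using o(5) by simp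
  qed (use o in simp)
  then show ?thesis using o by simp
qed

text \<open>The separations leave only the cyclic orders p q r s and p s r q. After the swap of q
  and s, p stays with whichever of them follows it; after the swap of p and r, it stays with
  whichever precedes it. This turns an order on a circle into equality of circles in the two
  intermediate resolutions.\<close>

lemma meets_in_order_iff:
  assumes "perm_swap S f f' q s" "perm_swap S f f'' p r"
    and reach: "reach f p q" "reach f p s" "reach f p r" and distinct: "p \<noteq> q" "p \<noteq> s" "r \<noteq> q" "r \<noteq> s"
    and sep: "\<not> reach f' p r" "\<not> reach f'' q s"
  shows "meets_in_order f p q r s \<longleftrightarrow> reach f' p q"
    and "meets_in_order f p q r s \<longleftrightarrow> reach f'' s p"
proof -
  interpret A: perm_swap S f f' q s by fact
  interpret B: perm_swap S f f'' p r by fact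
  have split: "\<not> reach f' q s"
    using A.reach_swap_split reach_trans[OF A.reach_sym[OF reach(1)] reach(2)] B.x_in
    by (metis A.reach_sym reach_trans reach(1,2))
  have tot: "meets_in_order f p q r s \<or> meets_in_order f p s r q"
    using A.interleaved_order[OF B.x_in reach] distinct B.neq sep by blast
  show "meets_in_order f p q r s \<longleftrightarrow> reach f' p q"
  proof
    show "meets_in_order f p q r s \<Longrightarrow> reach f' p q"
      using A.meets_in_order_swap_even B.x_in by blast
    assume pq: "reach f' p q"
    have "\<not> meets_in_order f p s r q"
    proof
      assume "meets_in_order f p s r q"
      then have "reach f' p s"
        using perm_swap.meets_in_order_swap_even[OF A.perm_swap_comm] B.x_in by blast
      then show False using split A.swapped.reach_sym[OF pq B.x_in] reach_trans by metis
    qed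
    then show "meets_in_order f p q r s" using tot by blast
  qed
  show "meets_in_order f p q r s \<longleftrightarrow> reach f'' s p"
  proof
    show "meets_in_order f p q r s \<Longrightarrow> reach f'' s p"
      using B.meets_in_order_swap_odd by blast
    assume sp: "reach f'' s p"
    have "\<not> meets_in_order f p s r q"
    proof
      assume "meets_in_order f p s r q"
      then have "reach f'' q p" using B.meets_in_order_swap_odd by blast
      then show False using sep(2) B.swapped.reach_sym[OF sp A.y_in] reach_trans by metis
    qed
    then show "meets_in_order f p q r s" using tot by blast
  qed
qed

section \<open>Surgery on the circles of a resolution\<close>

fun opp :: "compass \<Rightarrow> compass" where
  "opp North = South" | "opp South = North" | "opp East = West" | "opp West = East"

lemma opp_opp [simp]: "opp (opp p) = p"
  by (cases p) auto

lemma partner_partner [simp]: "partner b (partner b p) = p"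
  by (cases b; cases p) auto

text \<open>This is what makes a surgery a transposition: in passing to the other resolution the
  ends p and opp p exchange their successors.\<close>

lemma partner_opp: "partner (\<not> b) p = partner b (opp p)"
  by (cases b; cases p) auto

lemma partner_ccw: "partner b p = ccw p \<or> p = ccw (partner b p)"
  by (cases b; cases p) auto

lemma opp_neq [simp]: "opp p \<noteq> p" "p \<noteq> opp p"
  by (cases p; simp)+

text \<open>Equality of values of C, coarsened by identifying the classes of u and v.\<close>

definition glued :: "('e \<Rightarrow> 'e set) \<Rightarrow> 'e \<Rightarrow> 'e \<Rightarrow> 'e \<Rightarrow> 'e \<Rightarrow> bool" where
  "glued C u v e e' \<longleftrightarrow> C e = C e' \<or> ((C e = C u \<or> C e = C v) \<and> (C e' = C u \<or> C e' = C v))"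

section \<open>Circles of a resolution as orbits of \<open>traverse\<close>\<close>

context link_diagram
begin

abbreviation end_circle :: "'v set \<Rightarrow> 'v \<Rightarrow> compass \<Rightarrow> 'e set" where
  "end_circle \<alpha> c p \<equiv> circle_of D \<alpha> (strand D c p)"

lemma joined_sym: "(e, e') \<in> joined D \<alpha> \<Longrightarrow> (e', e) \<in> joined D \<alpha>"
  unfolding joined_def by clarsimp (metis partner_partner)

lemma joined_rtrancl_sym: "(e, e') \<in> (joined D \<alpha>)\<^sup>* \<Longrightarrow> (e', e) \<in> (joined D \<alpha>)\<^sup>*"
  by (metis joined_sym sym_rtrancl symD symI)

lemma circle_of_eq_iff: "circle_of D \<alpha> e = circle_of D \<alpha> e' \<longleftrightarrow> (e, e') \<in> (joined D \<alpha>)\<^sup>*"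
proof
  assume "circle_of D \<alpha> e = circle_of D \<alpha> e'"
  then show "(e, e') \<in> (joined D \<alpha>)\<^sup>*" unfolding circle_of_def by blast
next
  assume "(e, e') \<in> (joined D \<alpha>)\<^sup>*"
  then show "circle_of D \<alpha> e = circle_of D \<alpha> e'"
    unfolding circle_of_def using joined_rtrancl_sym[of e e' \<alpha>] by (auto intro: rtrancl_trans)
qed

lemma mem_circle_of: "e' \<in> circle_of D \<alpha> e \<longleftrightarrow> circle_of D \<alpha> e = circle_of D \<alpha> e'"
  unfolding circle_of_eq_iff by (simp add: circle_of_def)

lemma circle_of_self: "e \<in> circle_of D \<alpha> e"
  by (simp add: mem_circle_of)

lemma circle_of_partner:
  "c \<in> crossings D \<Longrightarrow> end_circle \<alpha> c (partner (c \<in> \<alpha>) p) = end_circle \<alpha> c p"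
  unfolding circle_of_eq_iff by (rule joined_rtrancl_sym, rule r_into_rtrancl) (auto simp: joined_def)

lemma circle_of_partner0:
  assumes "c \<in> crossings D" "c \<notin> \<alpha>"
  shows "end_circle \<alpha> c South = end_circle \<alpha> c West"
    "end_circle \<alpha> c North = end_circle \<alpha> c East"
  using circle_of_partner[of c \<alpha> West] circle_of_partner[of c \<alpha> East] assms by auto

lemma circle_of_partner1:
  assumes "c \<in> crossings D" "c \<in> \<alpha>"
  shows "end_circle \<alpha> c South = end_circle \<alpha> c East"
    "end_circle \<alpha> c North = end_circle \<alpha> c West"
  using circle_of_partner[of c \<alpha> West] circle_of_partner[of c \<alpha> East] assms by auto

lemma circle_of_improper:
  assumes "e \<notin> proper_edges"
  shows "circle_of D \<alpha> e = circle_of D \<alpha> e' \<longleftrightarrow> e = e'"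
proof -
  have "e = e'" if "(e, e') \<in> (joined D \<alpha>)\<^sup>*"
    using that
  proof (induction rule: rtrancl_induct)
    case (step y z)
    then show ?case using assms strand_proper by (auto simp: joined_def)
  qed simp
  then show ?thesis by (auto simp: circle_of_eq_iff)
qed

lemma traverse_in: "h \<in> edge_ends D \<Longrightarrow> traverse D \<alpha> h \<in> edge_ends D"
  by (cases h) (simp add: traverse_def)

lemma bij_traverse: "bij_betw (traverse D \<alpha>) (edge_ends D) (edge_ends D)"
proof (rule bij_betw_imageI)
  show inj: "inj_on (traverse D \<alpha>) (edge_ends D)"
  proof (rule inj_onI)
    fix x y assume xy: "x \<in> edge_ends D" "y \<in> edge_ends D" "traverse D \<alpha> x = traverse D \<alpha> y"
    obtain c p c' p' where "x = (c, p)" "y = (c', p')" "c \<in> crossings D" "c' \<in> crossings D"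
      using xy by (cases x; cases y) auto
    then have "(c, partner (c \<in> \<alpha>) p) = (c', partner (c' \<in> \<alpha>) p')"
      using arg_cong[OF xy(3), of "other_end D"] by (auto simp: traverse_def)
    then show "x = y" using \<open>x = (c, p)\<close> \<open>y = (c', p')\<close> by (metis partner_partner prod.inject)
  qed
  show "traverse D \<alpha> ` edge_ends D = edge_ends D"
    using finite_edge_ends inj traverse_in by (intro card_subset_eq) (auto simp: card_image)
qed

sublocale ends: finite_perm "edge_ends D" "traverse D \<alpha>" for \<alpha>
  by unfold_locales (use finite_edge_ends bij_traverse in auto)

lemma end_edge_traverse:
  assumes "h \<in> edge_ends D"
  shows "circle_of D \<alpha> (end_edge D (traverse D \<alpha> h)) = circle_of D \<alpha> (end_edge D h)"
proof -
  obtain c p where h: "h = (c, p)" "c \<in> crossings D" using assms by (cases h) auto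
  show ?thesis using circle_of_partner[OF h(2), of \<alpha> p] h by (simp add: traverse_def)
qed

lemma reach_circle_of:
  assumes "reach (traverse D \<alpha>) h h'" "h \<in> edge_ends D"
  shows "circle_of D \<alpha> (end_edge D h) = circle_of D \<alpha> (end_edge D h')"
  using assms
proof (induction rule: reach_induct)
  case (step z)
  then show ?case using end_edge_traverse[OF ends.reach_in[OF step(1,3)]] by simp
qed simp

text \<open>A walk along joined edges has no direction, whereas \<open>reach\<close> has one. If an
  edge is met at its other end, the wanted end lies one step back on the orbit, and on a finite
  orbit this is reached by going all the way around (\<open>reach_back\<close>).\<close>

lemma circle_of_reach:
  assumes "(end_edge D h, e) \<in> (joined D \<alpha>)\<^sup>*" "h \<in> edge_ends D"
  shows "\<exists>h' \<in> edge_ends D. end_edge D h' = e \<and> reach (traverse D \<alpha>) h h'"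
  using assms(1)
proof (induction rule: rtrancl_induct)
  case base
  show ?case using assms(2) by auto
next
  case (step y z)
  then obtain h' where h': "h' \<in> edge_ends D" "end_edge D h' = y" "reach (traverse D \<alpha>) h h'" by blast
  obtain c p where c: "c \<in> crossings D" "y = strand D c p" "z = strand D c (partner (c \<in> \<alpha>) p)"
    using step(2) by (auto simp: joined_def)
  consider "h' = (c, p)" | "h' = other_end D (c, p)"
    using end_edge_eqD[of "(c, p)" h'] c h' by auto
  then show ?case
  proof cases
    case 1
    then have "reach (traverse D \<alpha>) h (traverse D \<alpha> h')" using h'(3) reach_step reach_trans by metis
    moreover have "end_edge D (traverse D \<alpha> h') = z" using 1 c by (simp add: traverse_def)
    ultimately show ?thesis using traverse_in h'(1) by blast
  next
    case 2
    let ?k = "(c, partner (c \<in> \<alpha>) p)"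
    have "traverse D \<alpha> ?k = h'" using 2 c by (simp add: traverse_def)
    then have "reach (traverse D \<alpha>) h' ?k" using ends.reach_back[of ?k \<alpha>] c by simp
    then have "reach (traverse D \<alpha>) h ?k" using h'(3) reach_trans by metis
    then show ?thesis using c by (intro bexI[of _ ?k]) auto
  qed
qed

text \<open>
  In a checkerboard colouring, the colour on the left of a traveller is constant along each circle of
  each resolution. It orients all circles coherently, so that changing the resolution at a crossing
  composes the permutation \<open>traverse\<close> with the transposition of the two incoming ends.
\<close>

lemma checkerboard:
  "\<exists>g :: 'v \<times> compass \<Rightarrow> bool. (\<forall>h \<in> edge_ends D. g (other_end D h) \<noteq> g h)
     \<and> (\<forall>c \<in> crossings D. \<forall>p. g (c, ccw p) \<noteq> g (c, p))"
\<comment> \<open>The set of all edges is a mod 2 cycle because the graph is 4-valent.\<close>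
proof (rule cycle_colouring[of UNIV])
  fix g :: "'v \<times> compass \<Rightarrow> bool"
  assume "\<And>h. h \<in> edge_ends D \<Longrightarrow> g (other_end D h) \<noteq> g h \<longleftrightarrow> end_edge D h \<in> UNIV"
    "\<And>c p. c \<in> crossings D \<Longrightarrow> g (c, ccw p) \<noteq> g (c, p) \<longleftrightarrow> strand D c p \<in> UNIV"
  then show ?thesis by (intro exI[of _ g]) blast
qed (simp add: parity_def)

definition side :: "'v \<times> compass \<Rightarrow> bool" where
  "side = (SOME g. (\<forall>h \<in> edge_ends D. g (other_end D h) \<noteq> g h)
     \<and> (\<forall>c \<in> crossings D. \<forall>p. g (c, ccw p) \<noteq> g (c, p)))"

lemma side_other_end: "h \<in> edge_ends D \<Longrightarrow> side (other_end D h) \<longleftrightarrow> \<not> side h"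
  and side_ccw: "c \<in> crossings D \<Longrightarrow> side (c, ccw p) \<longleftrightarrow> \<not> side (c, p)"
  using someI_ex[OF checkerboard, folded side_def] by blast+

lemma side_partner: "c \<in> crossings D \<Longrightarrow> side (c, partner b p) \<longleftrightarrow> \<not> side (c, p)"
  using partner_ccw[of b p] side_ccw[of c] by metis

lemma side_opp: "c \<in> crossings D \<Longrightarrow> side (c, opp p) \<longleftrightarrow> side (c, p)"
  using side_ccw[of c p] side_ccw[of c "ccw p"] by (cases p) auto

lemma side_eq_iff: "c \<in> crossings D \<Longrightarrow> side (c, q) = side (c, p) \<longleftrightarrow> q = p \<or> q = opp p"
  using side_ccw[of c p] side_opp[of c p] side_opp[of c "ccw p"] by (cases p; cases q) auto

lemma side_traverse: "h \<in> edge_ends D \<Longrightarrow> side (traverse D \<alpha> h) \<longleftrightarrow> side h"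
  by (cases h) (simp add: traverse_def side_other_end side_partner)

lemma side_reach: "\<lbrakk>reach (traverse D \<alpha>) h h'; h \<in> edge_ends D\<rbrakk> \<Longrightarrow> side h' = side h"
proof (induction rule: reach_induct)
  case (step z)
  then show ?case using side_traverse[OF ends.reach_in[OF step(1,3)]] by simp
qed simp

text \<open>A circle through a crossing carries two orbits, one for each direction of travel, and
  the colour on the left tells them apart. Among ends of one colour, circles and orbits are the
  same.\<close>

lemma circle_of_eq_reach:
  assumes h: "h \<in> edge_ends D" "h' \<in> edge_ends D" "side h = side h'"
  shows "circle_of D \<alpha> (end_edge D h) = circle_of D \<alpha> (end_edge D h') \<longleftrightarrow> reach (traverse D \<alpha>) h h'"
proof
  assume "circle_of D \<alpha> (end_edge D h) = circle_of D \<alpha> (end_edge D h')"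
  then obtain k where k: "k \<in> edge_ends D" "end_edge D k = end_edge D h'" "reach (traverse D \<alpha>) h k"
    using circle_of_reach[of h "end_edge D h'" \<alpha>] h unfolding circle_of_eq_iff by blast
  have "k = h' \<or> k = other_end D h'" using end_edge_eqD[of h' k] h k by simp
  moreover have "side k = side h'" using side_reach[OF k(3) h(1)] h(3) by simp
  ultimately have "k = h'" using side_other_end[OF h(2)] by metis
  then show "reach (traverse D \<alpha>) h h'" using k by simp
qed (use reach_circle_of h in blast)

lemma proper_edge_side:
  assumes "e \<in> proper_edges"
  obtains h where "h \<in> edge_ends D" "end_edge D h = e" "side h = b"
proof -
  obtain h where h: "h \<in> edge_ends D" "end_edge D h = e" using proper_edgeE[OF assms] .
  show ?thesis
  proof (cases "side h = b")
    case True
    then show ?thesis using that h by blast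
  next
    case False
    then show ?thesis using that[of "other_end D h"] h side_other_end by auto
  qed
qed

text \<open>Every edge that meets a crossing has exactly one end in this set, so that the
  permutation \<open>traverse\<close> restricted to it has one cycle for each circle through a
  crossing.\<close>

definition side_ends :: "bool \<Rightarrow> ('v \<times> compass) set" where
  "side_ends b = {h \<in> edge_ends D. side h = b}"

lemma finite_perm_side_ends: "finite_perm (side_ends b) (traverse D \<alpha>)"
proof
  show fin: "finite (side_ends b)" by (simp add: side_ends_def finite_edge_ends)
  show "bij_betw (traverse D \<alpha>) (side_ends b) (side_ends b)"
  proof (rule bij_betw_imageI)
    show inj: "inj_on (traverse D \<alpha>) (side_ends b)"
      using bij_traverse by (auto simp: bij_betw_def side_ends_def intro: inj_on_subset)
    show "traverse D \<alpha> ` side_ends b = side_ends b"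
      using fin inj traverse_in side_traverse by (intro card_subset_eq) (auto simp: card_image side_ends_def)
  qed
qed

text \<open>Among the four ends at c only p and opp p have the colour b; \<open>partner_opp\<close>
  exchanges their images, and nothing changes at the other crossings.\<close>

lemma perm_swap_traverse:
  assumes c: "c \<in> crossings D" "c \<notin> \<alpha>" and "side (c, p) = b"
  shows "perm_swap (side_ends b) (traverse D \<alpha>) (traverse D (insert c \<alpha>)) (c, p) (c, opp p)"
proof -
  interpret finite_perm "side_ends b" "traverse D \<alpha>" by (rule finite_perm_side_ends)
  show ?thesis
  proof
    show "(c, p) \<in> side_ends b" "(c, opp p) \<in> side_ends b"
      using assms side_opp by (auto simp: side_ends_def)
    show "traverse D (insert c \<alpha>) (c, p) = traverse D \<alpha> (c, opp p)"
      "traverse D (insert c \<alpha>) (c, opp p) = traverse D \<alpha> (c, p)"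
      using c partner_opp[of False p] partner_opp[of False "opp p"] by (simp_all add: traverse_def)
    fix z assume z: "z \<in> side_ends b" "z \<noteq> (c, p)" "z \<noteq> (c, opp p)"
    obtain c' q where cq: "z = (c', q)" by (cases z)
    have "c' \<noteq> c"
      using z cq assms side_eq_iff[of c q p] by (auto simp: side_ends_def)
    then show "traverse D (insert c \<alpha>) z = traverse D \<alpha> z"
      by (simp add: traverse_def cq)
  qed simp
qed

section \<open>Merges and splits\<close>

lemma reach_merges:
  assumes c: "c \<in> crossings D"
  shows "merges D \<alpha> c \<longleftrightarrow> \<not> reach (traverse D \<alpha>) (c, West) (c, East)"
  using circle_of_eq_reach[of "(c, West)" "(c, East)" \<alpha>] c side_opp[of c West] by (simp add: merges_def)

text \<open>The swap may go in either direction: with \<beta> as the later vertex the statement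
  describes a merge, with \<beta> as the earlier one it describes a split read backwards. Edges that
  meet no crossing are circles by themselves and are treated apart.\<close>

lemma glued_of_reach:
  assumes c: "c \<in> crossings D" and swap: "perm_swap (side_ends (side (c, West))) (traverse D \<alpha>) (traverse D \<beta>) (c, West) (c, East)"
    and r: "reach (traverse D \<beta>) (c, West) (c, East)"
  shows "circle_of D \<beta> e = circle_of D \<beta> e' \<longleftrightarrow> glued (circle_of D \<alpha>) (strand D c West) (strand D c East) e e'"
proof -
  interpret perm_swap "side_ends (side (c, West))" "traverse D \<alpha>" "traverse D \<beta>" "(c, West)" "(c, East)"
    by (rule swap)
  have W: "end_circle \<alpha> c p \<noteq> circle_of D \<alpha> x" "circle_of D \<alpha> x \<noteq> end_circle \<alpha> c p"
    if "x \<notin> proper_edges" for x p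
    using circle_of_improper[OF that, of \<alpha> "strand D c p"] strand_proper[OF c] that by metis+
  show ?thesis
  proof (cases "e \<in> proper_edges \<and> e' \<in> proper_edges")
    case False
    then show ?thesis
      using W circle_of_improper[of e] circle_of_improper[of e'] unfolding glued_def by metis
  next
    case True
    then obtain h h' where h: "h \<in> edge_ends D" "end_edge D h = e" "side h = side (c, West)"
      "h' \<in> edge_ends D" "end_edge D h' = e'" "side h' = side (c, West)"
      using proper_edge_side by metis
    have E: "side (c, East) = side (c, West)" using side_opp[OF c, of West] by simp
    have eq: "circle_of D \<gamma> (end_edge D k) = circle_of D \<gamma> (end_edge D k') \<longleftrightarrow> reach (traverse D \<gamma>) k k'"
      if "k \<in> side_ends (side (c, West))" "k' \<in> side_ends (side (c, West))" for k k' \<gamma>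
      using that circle_of_eq_reach[of k k'] by (auto simp: side_ends_def)
    have hS: "h \<in> side_ends (side (c, West))" "h' \<in> side_ends (side (c, West))"
      using h by (auto simp: side_ends_def)
    have "circle_of D \<beta> e = circle_of D \<beta> e' \<longleftrightarrow> reach (traverse D \<beta>) h h'"
      using eq hS h by blast
    also have "\<dots> \<longleftrightarrow> reach (traverse D \<alpha>) h h' \<or>
      ((reach (traverse D \<alpha>) (c, West) h \<or> reach (traverse D \<alpha>) (c, East) h) \<and>
       (reach (traverse D \<alpha>) (c, West) h' \<or> reach (traverse D \<alpha>) (c, East) h'))"
      by (rule reach_merge_iff[OF r hS(1)])
    also have "\<dots> \<longleftrightarrow> glued (circle_of D \<alpha>) (strand D c West) (strand D c East) e e'"
      unfolding glued_def eq[OF hS, symmetric] eq[OF x_in hS(1), symmetric] eq[OF x_in hS(2), symmetric]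
        eq[OF y_in hS(1), symmetric] eq[OF y_in hS(2), symmetric] h(2,5) fst_conv snd_conv
      by metis
    finally show ?thesis .
  qed
qed

lemma perm_swap_West:
  assumes c: "c \<in> crossings D" "c \<notin> \<alpha>"
  shows "perm_swap (side_ends (side (c, West))) (traverse D \<alpha>) (traverse D (insert c \<alpha>)) (c, West) (c, East)"
  using perm_swap_traverse[OF c, of West] by simp

lemma merge_glued:
  assumes c: "c \<in> crossings D" "c \<notin> \<alpha>" "merges D \<alpha> c"
  shows "circle_of D (insert c \<alpha>) e = circle_of D (insert c \<alpha>) e'
     \<longleftrightarrow> glued (circle_of D \<alpha>) (strand D c West) (strand D c East) e e'"
  using glued_of_reach[OF c(1) perm_swap_West[OF c(1,2)]] perm_swap.reach_swap_iff[OF perm_swap_West[OF c(1,2)]]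
    reach_merges[OF c(1)] c(3) by blast

lemma split_separates:
  assumes c: "c \<in> crossings D" "c \<notin> \<alpha>" "\<not> merges D \<alpha> c"
  shows "end_circle (insert c \<alpha>) c West \<noteq> end_circle (insert c \<alpha>) c East"
  using perm_swap.reach_swap_iff[OF perm_swap_West[OF c(1,2)]]
    reach_merges[OF c(1)] c(3) circle_of_eq_reach[of "(c, West)" "(c, East)" "insert c \<alpha>"] c side_opp[of c West] by auto

lemma split_glued:
  assumes c: "c \<in> crossings D" "c \<notin> \<alpha>" "\<not> merges D \<alpha> c"
  shows "circle_of D \<alpha> e = circle_of D \<alpha> e'
     \<longleftrightarrow> glued (circle_of D (insert c \<alpha>)) (strand D c West) (strand D c East) e e'"
  using glued_of_reach[OF c(1) perm_swap.perm_swap_sym[OF perm_swap_West[OF c(1,2)]]] reach_merges[OF c(1)] c(3)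
  by blast

end

lemma glued_imp: "C e = C e' \<Longrightarrow> glued C u v e e'"
  by (simp add: glued_def)

lemma glued_ends: "glued C u v u v"
  by (simp add: glued_def)

lemma glued_match: "\<lbrakk>glued C u v a b; C a \<noteq> C b\<rbrakk> \<Longrightarrow> (C a = C u \<and> C b = C v) \<or> (C a = C v \<and> C b = C u)"
  by (auto simp: glued_def)

lemma card_image_eq:
  assumes "\<And>a b. \<lbrakk>a \<in> A; b \<in> A\<rbrakk> \<Longrightarrow> f a = f b \<longleftrightarrow> g a = g b"
  shows "card (f ` A) = card (g ` A)"
proof -
  let ?h = "\<lambda>X. g (inv_into A f X)"
  have h: "?h (f a) = g a" if "a \<in> A" for a
    using that assms[of "inv_into A f (f a)" a] by (simp add: inv_into_into f_inv_into_f)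
  have "inj_on ?h (f ` A)"
    by (rule inj_onI) (use h assms in auto)
  moreover have "?h ` f ` A = g ` A"
    using h by (auto simp: image_image)
  ultimately show ?thesis using card_image by metis
qed

text \<open>Drop the edges in the class of v. The values of C' are still all taken, since u is left,
  and on the remaining edges C and C' have the same fibres.\<close>

lemma card_glued:
  assumes "finite E" "u \<in> E" "v \<in> E" "C u \<noteq> C v"
    and glued: "\<And>e e'. C' e = C' e' \<longleftrightarrow> glued C u v e e'"
  shows "card (C ` E) = card (C' ` E) + 1"
proof -
  let ?A = "{e \<in> E. C e \<noteq> C v}"
  have "C' ` E = C' ` ?A"
  proof
    show "C' ` E \<subseteq> C' ` ?A"
    proof (rule image_subsetI)
      fix e assume "e \<in> E"
      have "C e = C v \<Longrightarrow> C' e = C' u" unfolding glued by (simp add: glued_def)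
      then show "C' e \<in> C' ` ?A" using \<open>e \<in> E\<close> assms(2,4) by (cases "C e = C v") auto
    qed
  qed auto
  moreover have "card (C' ` ?A) = card (C ` ?A)"
    by (rule card_image_eq) (use glued in \<open>auto simp: glued_def\<close>)
  moreover have "C ` E = insert (C v) (C ` ?A)" using assms(3) by auto
  moreover have "C v \<notin> C ` ?A" by auto
  ultimately show ?thesis using assms(1) by simp
qed

section \<open>Counting circles, and planarity in the faces with vanishing compositions\<close>

context link_diagram
begin

lemma card_circles_merge:
  assumes "c \<in> crossings D" "c \<notin> \<alpha>" "merges D \<alpha> c"
  shows "card (circles D \<alpha>) = card (circles D (insert c \<alpha>)) + 1"
  unfolding circles_def
  by (rule card_glued[OF finite_edges strand_edge strand_edge _ merge_glued]) (use assms in \<open>auto simp: merges_def\<close>)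

lemma card_circles_split:
  assumes "c \<in> crossings D" "c \<notin> \<alpha>" "\<not> merges D \<alpha> c"
  shows "card (circles D (insert c \<alpha>)) = card (circles D \<alpha>) + 1"
  unfolding circles_def
  by (rule card_glued[OF finite_edges strand_edge strand_edge _ split_glued])
    (use assms split_separates[OF assms] in auto)

lemma dot_exponent_insert:
  assumes "c \<in> crossings D" "c \<notin> \<alpha>" "\<alpha> \<subseteq> crossings D"
  shows "dot_exponent D (insert c \<alpha>) = dot_exponent D \<alpha> + (if merges D \<alpha> c then 0 else 1)"
proof -
  have "card (insert c \<alpha>) = card \<alpha> + 1"
    using assms finite_subset[OF assms(3) finite_crossings] by simp
  then show ?thesis
    using card_circles_merge[OF assms(1,2)] card_circles_split[OF assms(1,2)]
    by (simp add: dot_exponent_def)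
qed

text \<open>Both routes across the face end at the same vertex, hence with the same number of
  circles. This admits six of the sixteen combinations.\<close>

lemma merges_count:
  assumes "c \<in> crossings D" "c' \<in> crossings D" "c \<noteq> c'" "c \<notin> b" "c' \<notin> b"
  shows "of_bool (merges D b c) + of_bool (merges D (insert c b) c')
    = (of_bool (merges D b c') + of_bool (merges D (insert c' b) c) :: nat)"
proof -
  have *: "card (circles D (insert x a)) + 2 * of_bool (merges D a x) = card (circles D a) + 1"
    if "x \<in> crossings D" "x \<notin> a" for x a
    using card_circles_merge[OF that] card_circles_split[OF that] by (cases "merges D a x") auto
  show ?thesis
    using *[of c b] *[of c' "insert c b"] *[of c' b] *[of c "insert c' b"] assms
    by (simp add: insert_commute[of c c'])
qed

lemma merge_circle_of:
  assumes "c \<in> crossings D" "c \<notin> \<alpha>" "merges D \<alpha> c" "circle_of D \<alpha> e = circle_of D \<alpha> e'"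
  shows "circle_of D (insert c \<alpha>) e = circle_of D (insert c \<alpha>) e'"
  using merge_glued[OF assms(1-3)] assms(4) by (simp add: glued_imp)

lemma split_circle_of:
  assumes "c \<in> crossings D" "c \<notin> \<alpha>" "\<not> merges D \<alpha> c" "circle_of D (insert c \<alpha>) e = circle_of D (insert c \<alpha>) e'"
  shows "circle_of D \<alpha> e = circle_of D \<alpha> e'"
  using split_glued[OF assms(1-3)] assms(4) by (simp add: glued_imp)

lemma merge_joins:
  assumes "c \<in> crossings D" "c \<notin> \<alpha>" "merges D \<alpha> c"
  shows "end_circle (insert c \<alpha>) c West = end_circle (insert c \<alpha>) c East"
  using merge_glued[OF assms] by (simp add: glued_ends)

text \<open>The circle \<open>?C\<close> bounds a set of faces, and g says on which side of
  \<open>?C\<close> the region to the left of a traveller lies. At c, in the 1-resolution, turning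
  from W to E crosses \<open>?C\<close> once; at c', in the 0-resolution, it crosses
  \<open>?C\<close> twice or not at all. As g is constant along circles, coherent orientations of W
  at both crossings would carry its values from the ends at c to the matching ends at c', which is a
  contradiction.\<close>

lemma sides_differ:
  assumes c: "c \<in> crossings D" "c \<in> \<beta>" and c': "c' \<in> crossings D" "c' \<notin> \<beta>"
    and sep: "end_circle \<beta> c West \<noteq> end_circle \<beta> c East"
    and match: "(end_circle \<beta> c' West = end_circle \<beta> c West
        \<and> end_circle \<beta> c' East = end_circle \<beta> c East)
      \<or> (end_circle \<beta> c' West = end_circle \<beta> c East
        \<and> end_circle \<beta> c' East = end_circle \<beta> c West)"
  shows "side (c', West) \<noteq> side (c, West)"
proof
  assume side: "side (c', West) = side (c, West)"
  let ?C = "end_circle \<beta> c West"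
  have closed: "strand D x (partner (x \<in> \<beta>) p) \<in> ?C \<longleftrightarrow> strand D x p \<in> ?C" if "x \<in> crossings D" for x p
    unfolding mem_circle_of using circle_of_partner[OF that] by simp
  show False
  proof (rule traverse_colouring[OF closed])
    fix g :: "'v \<times> compass \<Rightarrow> bool"
    assume g: "\<And>x p. x \<in> crossings D \<Longrightarrow> g (x, ccw p) \<noteq> g (x, p) \<longleftrightarrow> strand D x p \<in> ?C"
      "\<And>h. h \<in> edge_ends D \<Longrightarrow> g (traverse D \<beta> h) = g h"
    have g_reach: "g h' = g h" if "reach (traverse D \<beta>) h h'" "h \<in> edge_ends D" for h h'
      using that
    proof (induction rule: reach_induct)
      case (step z)
      then show ?case using g(2)[OF ends.reach_in[OF step(1,3)]] by simp
    qed simp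
    have g_eq: "g (c, p) = g (c', p')"
      if "end_circle \<beta> c' p' = end_circle \<beta> c p"
        "p \<in> {West, East}" "p' \<in> {West, East}" for p p'
    proof -
      have "side (c', p') = side (c, p)"
        using side that(2,3) side_opp[OF c(1), of West] side_opp[OF c'(1), of West] by auto
      then have "reach (traverse D \<beta>) (c', p') (c, p)"
        using circle_of_eq_reach[of "(c', p')" "(c, p)" \<beta>] that c c' by simp
      then show ?thesis using g_reach c' by simp
    qed
    have "strand D c North \<in> ?C" "strand D c East \<notin> ?C"
      unfolding mem_circle_of using circle_of_partner1[OF c] sep by simp_all
    then have "g (c, West) \<noteq> g (c, East)"
      using g(1)[OF c(1), of North] g(1)[OF c(1), of East] by simp
    moreover have "strand D c' South \<in> ?C \<longleftrightarrow> strand D c' West \<in> ?C"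
      unfolding mem_circle_of using circle_of_partner0[OF c'] by simp
    then have "g (c', West) = g (c', East)"
      using g(1)[OF c'(1), of South] g(1)[OF c'(1), of West] by auto
    ultimately show False
      using match g_eq[of West West] g_eq[of East East] g_eq[of West East] g_eq[of East West] by auto
  qed
qed

text \<open>
  In a face of type one circle, two circles, one circle, the endpoints of the two arcs are
  interleaved on the circle, and planarity puts the two arcs on different sides.
\<close>

lemma negative_pattern_aux:
  assumes c: "c \<in> crossings D" "c' \<in> crossings D" "c \<noteq> c'" "c \<notin> b" "c' \<notin> b"
    and m: "\<not> merges D b c" "\<not> merges D b c'" "merges D (insert c b) c'" "merges D (insert c' b) c"
  shows "negative_pattern D ar b c c' \<longleftrightarrow>
      end_circle (insert c' b) c (tail_left (ar c)) = end_circle (insert c' b) c' (head_right (ar c'))"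
    and "negative_pattern D ar b c c' \<longleftrightarrow>
      end_circle (insert c b) c' (tail_right (ar c')) = end_circle (insert c b) c (tail_left (ar c))"
proof -
  let ?S = "side_ends (side (c, West))"
  let ?p = "(c, tail_left (ar c))" and ?r = "(c, head_left (ar c))"
    and ?q = "(c', head_right (ar c'))" and ?s = "(c', tail_right (ar c'))"
  have sep: "end_circle (insert c' b) c West \<noteq> end_circle (insert c' b) c East"
    "end_circle (insert c b) c' West \<noteq> end_circle (insert c b) c' East"
    using m(3,4) by (auto simp: merges_def)
  have b: "end_circle b c West = end_circle b c East"
    "end_circle b c' West = end_circle b c' East"
    using m(1,2) by (auto simp: merges_def)
  have m1: "(end_circle (insert c b) c' West = end_circle (insert c b) c West
        \<and> end_circle (insert c b) c' East = end_circle (insert c b) c East)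
      \<or> (end_circle (insert c b) c' West = end_circle (insert c b) c East
        \<and> end_circle (insert c b) c' East = end_circle (insert c b) c West)"
    by (rule glued_match) (use split_glued[OF c(1,4) m(1)] b(2) sep(2) in auto)
  have "side (c', West) \<noteq> side (c, West)"
    by (rule sides_differ[of c "insert c b" c']) (use c m1 split_separates[OF c(1,4) m(1)] in auto)
  \<comment> \<open>Since the colours at the two crossings are opposite, the ends W, E of c and N, S
    of c' are incoming for one and the same direction of travel. These are the ends that occur in
    the pattern.\<close>
  then have sides: "side ?p = side (c, West)" "side ?r = side (c, West)" "side ?q = side (c, West)" "side ?s = side (c, West)"
    using side_opp[OF c(1), of West] side_ccw[OF c(2), of North] side_ccw[OF c(2), of West]
    by (cases "ar c"; cases "ar c'"; simp)+
  have opps: "?r = (c, opp (tail_left (ar c)))" "?s = (c', opp (head_right (ar c')))"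
    by (cases "ar c"; cases "ar c'"; simp)+
  have swap1: "perm_swap ?S (traverse D b) (traverse D (insert c' b)) ?q ?s"
    unfolding opps by (rule perm_swap_traverse[OF c(2,5) sides(3)])
  have swap2: "perm_swap ?S (traverse D b) (traverse D (insert c b)) ?p ?r"
    unfolding opps by (rule perm_swap_traverse[OF c(1,4) sides(1)])
  have ends: "?p \<in> edge_ends D" "?r \<in> edge_ends D" "?q \<in> edge_ends D" "?s \<in> edge_ends D"
    using c by auto
  have bb: "end_circle b c' West = end_circle b c West"
    using m1 split_circle_of[OF c(1,4) m(1)] b by metis
  have all_b: "end_circle b c (tail_left (ar c)) = end_circle b c West"
    "end_circle b c (head_left (ar c)) = end_circle b c West"
    "end_circle b c' (head_right (ar c')) = end_circle b c West"
    "end_circle b c' (tail_right (ar c')) = end_circle b c West"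
    using b bb circle_of_partner0[OF c(2,5)] by (cases "ar c"; cases "ar c'"; simp)+
  have r: "reach (traverse D b) ?p ?q" "reach (traverse D b) ?p ?s" "reach (traverse D b) ?p ?r"
    using circle_of_eq_reach[of ?p ?q b] circle_of_eq_reach[of ?p ?s b] circle_of_eq_reach[of ?p ?r b]
      ends sides all_b by simp_all
  have "end_circle (insert c' b) c (tail_left (ar c)) \<noteq> end_circle (insert c' b) c (head_left (ar c))"
    using sep(1) by (cases "ar c") auto
  then have s1: "\<not> reach (traverse D (insert c' b)) ?p ?r"
    using circle_of_eq_reach[of ?p ?r "insert c' b"] ends sides by simp
  have "end_circle (insert c b) c' (head_right (ar c')) \<noteq> end_circle (insert c b) c' (tail_right (ar c'))"
    using sep(2) circle_of_partner0[of c' "insert c b"] c by (cases "ar c'") auto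
  then have s2: "\<not> reach (traverse D (insert c b)) ?q ?s"
    using circle_of_eq_reach[of ?q ?s "insert c b"] ends sides by simp
  have d: "?p \<noteq> ?q" "?p \<noteq> ?s" "?r \<noteq> ?q" "?r \<noteq> ?s" using c(3) by auto
  note iff = meets_in_order_iff[OF swap1 swap2 r d s1 s2]
  show "negative_pattern D ar b c c' \<longleftrightarrow>
      end_circle (insert c' b) c (tail_left (ar c)) = end_circle (insert c' b) c' (head_right (ar c'))"
    using iff(1) circle_of_eq_reach[of ?p ?q "insert c' b"] ends sides by (simp add: negative_pattern_def)
  show "negative_pattern D ar b c c' \<longleftrightarrow>
      end_circle (insert c b) c' (tail_right (ar c')) = end_circle (insert c b) c (tail_left (ar c))"
    using iff(2) circle_of_eq_reach[of ?s ?p "insert c b"] ends sides by (simp add: negative_pattern_def)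
qed

text \<open>The two alternatives hold together. With the crossings exchanged the question is about
  the same two circles of \<open>insert c b\<close>: there \<open>tail_right\<close> and
  \<open>tail_left\<close> at c' are ends of one arc, and so are \<open>head_right\<close> and
  \<open>tail_left\<close> at c.\<close>

lemma negative_pattern_iff:
  assumes c: "c \<in> crossings D" "c' \<in> crossings D" "c \<noteq> c'" "c \<notin> b" "c' \<notin> b"
    and m: "\<not> merges D b c" "\<not> merges D b c'" "merges D (insert c b) c'" "merges D (insert c' b) c"
  shows "negative_pattern D ar b c c' \<or> negative_pattern D ar b c' c \<longleftrightarrow>
      end_circle (insert c' b) c (tail_left (ar c)) = end_circle (insert c' b) c' (head_right (ar c'))"
proof -
  have "end_circle (insert c b) c' (tail_right (ar c')) = end_circle (insert c b) c' (tail_left (ar c'))"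
    using circle_of_partner0[of c' "insert c b"] c by (cases "ar c'") auto
  moreover have "end_circle (insert c b) c (head_right (ar c)) = end_circle (insert c b) c (tail_left (ar c))"
    using circle_of_partner1[of c "insert c b"] c by (cases "ar c") auto
  ultimately have "negative_pattern D ar b c' c \<longleftrightarrow> negative_pattern D ar b c c'"
    using negative_pattern_aux(2)[OF c m, of ar] negative_pattern_aux(1)[OF c(2,1) c(3)[symmetric] c(5,4) m(2,1,4,3), of ar]
    by simp
  then show ?thesis using negative_pattern_aux(1)[OF c m, of ar] by blast
qed

end

section \<open>Edge maps on representatives\<close>

type_synonym 'e edge_ext = "(('e \<Rightarrow>\<^sub>0 int) list \<Rightarrow>\<^sub>0 int) set"

text \<open>Here s is the direction of an arrow; reversing it changes the sign, as in
  \<open>split_factor\<close>.\<close>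

definition sdiff :: "bool \<Rightarrow> 'a \<Rightarrow> 'a \<Rightarrow> ('a \<Rightarrow>\<^sub>0 int)" where
  "sdiff s x y = (if s then frag_of x - frag_of y else frag_of y - frag_of x)"

lemma keys_sdiff: "\<lbrakk>x \<in> S; y \<in> S\<rbrakk> \<Longrightarrow> Poly_Mapping.keys (sdiff s x y) \<subseteq> S"
  using keys_diff[of "frag_of x" "frag_of y"] keys_diff[of "frag_of y" "frag_of x"]
  by (auto simp: sdiff_def keys_frag_of split: if_splits)

lemma sdiff_swap: "sdiff s y x = - sdiff s x y"
  by (simp add: sdiff_def)

lemma sdiff_same [simp]: "sdiff s x x = 0"
  by (simp add: sdiff_def)

lemma frag_hom:
  assumes "\<And>s. s \<in> S \<Longrightarrow> g s \<in> T"
  shows "frag_extend (\<lambda>s. frag_of (g s)) \<in> hom (free_Abelian_group S) (free_Abelian_group T)"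
proof (rule homI)
  fix x assume "x \<in> carrier (free_Abelian_group S)"
  then show "frag_extend (\<lambda>s. frag_of (g s)) x \<in> carrier (free_Abelian_group T)"
    using keys_frag_extend[of "\<lambda>s. frag_of (g s)" x] assms by (fastforce simp: keys_frag_of)
qed (simp add: frag_extend_add)

context link_diagram
begin

abbreviation "L \<equiv> ext_alg (edge_group D)"
abbreviation "K \<alpha> \<equiv> ext_alg (circle_group D \<alpha>)"

lemma comm_group_edge_group: "comm_group (edge_group D)"
  by (simp add: edge_group_def abelian_free_Abelian_group)

lemma comm_group_circle_group: "comm_group (circle_group D \<alpha>)"
  by (simp add: circle_group_def abelian_free_Abelian_group)

sublocale L: ext_algebra "edge_group D"
  by (simp add: ext_algebra_def comm_group_edge_group)

sublocale K: ext_algebra "circle_group D \<alpha>" for \<alpha>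
  by (simp add: ext_algebra_def comm_group_circle_group)

lemma edge_group_simps [simp]:
  "a \<in> carrier (edge_group D) \<longleftrightarrow> Poly_Mapping.keys a \<subseteq> edges D"
  "a \<otimes>\<^bsub>edge_group D\<^esub> b = a + b" "\<one>\<^bsub>edge_group D\<^esub> = 0"
  by (simp_all add: edge_group_def)

lemma circle_group_simps [simp]:
  "x \<in> carrier (circle_group D \<alpha>) \<longleftrightarrow> Poly_Mapping.keys x \<subseteq> circles D \<alpha>"
  "x \<otimes>\<^bsub>circle_group D \<alpha>\<^esub> y = x + y" "\<one>\<^bsub>circle_group D \<alpha>\<^esub> = 0"
  by (simp_all add: circle_group_def)

abbreviation edge_mult :: "'e edge_ext \<Rightarrow> 'e edge_ext \<Rightarrow> 'e edge_ext" (infixl "\<odot>" 70) where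
  "x \<odot> y \<equiv> x \<otimes>\<^bsub>L\<^esub> y"

abbreviation edge_chain :: "('e \<Rightarrow>\<^sub>0 int) \<Rightarrow> bool" where
  "edge_chain a \<equiv> Poly_Mapping.keys a \<subseteq> edges D"

abbreviation circle_chain :: "'v set \<Rightarrow> ('e set \<Rightarrow>\<^sub>0 int) \<Rightarrow> bool" where
  "circle_chain \<alpha> x \<equiv> Poly_Mapping.keys x \<subseteq> circles D \<alpha>"

lemma L_gen_minus: "edge_chain a \<Longrightarrow> L.gen (- a) = \<ominus>\<^bsub>L\<^esub> L.gen a"
  using L.gen_inv[of a] by (simp add: edge_group_def)

lemma K_gen_minus: "circle_chain \<alpha> x \<Longrightarrow> K.gen \<alpha> (- x) = \<ominus>\<^bsub>K \<alpha>\<^esub> K.gen \<alpha> x"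
  using K.gen_inv[of x \<alpha>] by (simp add: circle_group_def)

lemma K_gen_zero [simp]: "K.gen \<alpha> 0 = \<zero>\<^bsub>K \<alpha>\<^esub>"
  using K.gen_one[of \<alpha>] by simp

lemma circle_in: "e \<in> edges D \<Longrightarrow> circle_of D \<alpha> e \<in> circles D \<alpha>"
  by (simp add: circles_def)

abbreviation circ :: "'v set \<Rightarrow> ('e \<Rightarrow>\<^sub>0 int) \<Rightarrow> ('e set \<Rightarrow>\<^sub>0 int)" where
  "circ \<alpha> \<equiv> frag_extend (\<lambda>e. frag_of (circle_of D \<alpha> e))"

lemma circ_hom: "circ \<alpha> \<in> hom (edge_group D) (circle_group D \<alpha>)"
  unfolding edge_group_def circle_group_def by (rule frag_hom) (rule circle_in)

lemma keys_circ: "edge_chain a \<Longrightarrow> circle_chain \<alpha> (circ \<alpha> a)"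
  using hom_in_carrier[OF circ_hom, of a \<alpha>] by simp

lemma circ_sdiff: "circ \<alpha> (sdiff s e e') = sdiff s (circle_of D \<alpha> e) (circle_of D \<alpha> e')"
  by (simp add: sdiff_def frag_extend_diff)

section \<open>Between the exterior algebra on edges and those on circles\<close>

definition proj :: "'v set \<Rightarrow> 'e edge_ext \<Rightarrow> 'e ext" where
  "proj \<alpha> = ext_map (circle_group D \<alpha>) (circ \<alpha>)"

sublocale proj: ring_hom_ring L "K \<alpha>" "proj \<alpha>" for \<alpha>
  unfolding proj_def
  by (intro ring_hom_ringI2 L.E.ring_axioms K.E.ring_axioms ext_map_hom comm_group_edge_group comm_group_circle_group circ_hom)

lemma proj_gen: "edge_chain a \<Longrightarrow> proj \<alpha> (L.gen a) = K.gen \<alpha> (circ \<alpha> a)"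
  unfolding proj_def
  by (intro ext_map_gen comm_group_edge_group comm_group_circle_group circ_hom) simp

definition representative :: "'v set \<Rightarrow> 'e set \<Rightarrow> 'e" where
  "representative \<alpha> C = (SOME e. e \<in> edges D \<and> circle_of D \<alpha> e = C)"

lemma representative:
  "C \<in> circles D \<alpha> \<Longrightarrow> representative \<alpha> C \<in> edges D \<and> circle_of D \<alpha> (representative \<alpha> C) = C"
  unfolding representative_def by (rule someI_ex) (auto simp: circles_def)

abbreviation repr :: "'v set \<Rightarrow> ('e set \<Rightarrow>\<^sub>0 int) \<Rightarrow> ('e \<Rightarrow>\<^sub>0 int)" where
  "repr \<alpha> \<equiv> frag_extend (\<lambda>C. frag_of (representative \<alpha> C))"

lemma repr_hom: "repr \<alpha> \<in> hom (circle_group D \<alpha>) (edge_group D)"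
  unfolding edge_group_def circle_group_def by (rule frag_hom) (use representative in blast)

lemma keys_repr: "circle_chain \<alpha> x \<Longrightarrow> edge_chain (repr \<alpha> x)"
  using hom_in_carrier[OF repr_hom, of x \<alpha>] by simp

lemma circ_repr: "circle_chain \<alpha> x \<Longrightarrow> circ \<alpha> (repr \<alpha> x) = x"
  by (induction x rule: frag_induct_on) (auto simp: frag_extend_diff representative)

text \<open>A ring section of \<open>proj\<close> that depends on the edge chosen on each circle. It
  does not commute with surgeries, so each use of it requires a proof that the choice does not
  matter.\<close>

definition lift :: "'v set \<Rightarrow> 'e ext \<Rightarrow> 'e edge_ext" where
  "lift \<alpha> = ext_map (edge_group D) (repr \<alpha>)"

sublocale lift: ring_hom_ring "K \<alpha>" L "lift \<alpha>" for \<alpha>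
  unfolding lift_def
  by (intro ring_hom_ringI2 L.E.ring_axioms K.E.ring_axioms ext_map_hom comm_group_edge_group comm_group_circle_group repr_hom)

lemma lift_gen: "circle_chain \<alpha> x \<Longrightarrow> lift \<alpha> (K.gen \<alpha> x) = L.gen (repr \<alpha> x)"
  unfolding lift_def
  by (intro ext_map_gen comm_group_edge_group comm_group_circle_group repr_hom) simp

lemma proj_lift: "x \<in> carrier (K \<alpha>) \<Longrightarrow> proj \<alpha> (lift \<alpha> x) = x"
proof (induction x rule: K.ext_alg_induct)
  case (gen a x)
  then show ?case by (simp add: lift_gen proj_gen keys_repr circ_repr)
qed (auto simp: lift.hom_a_inv proj.hom_a_inv)

lemma proj_surj:
  assumes "x \<in> carrier (K \<alpha>)"
  obtains y where "y \<in> carrier L" "x = proj \<alpha> y"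
  using that[of "lift \<alpha> x"] assms proj_lift by simp

text \<open>A generator on the right of u can be moved to its left at the cost of changing the
  generator. This is the form in which anticommutation enters the induction of
  \<open>transport_lift\<close>.\<close>

definition factor :: "'e edge_ext \<Rightarrow> bool" where
  "factor u \<longleftrightarrow> u \<in> carrier L \<and>
    (\<forall>a \<in> carrier (edge_group D). \<exists>b \<in> carrier (edge_group D). u \<odot> L.gen a = L.gen b \<odot> u)"

lemma factor_one: "factor \<one>\<^bsub>L\<^esub>"
  unfolding factor_def by (auto intro!: bexI)

lemma factor_gen: "edge_chain a \<Longrightarrow> factor (L.gen a)"
  unfolding factor_def
proof (intro conjI ballI)
  fix b assume a: "edge_chain a" and b: "b \<in> carrier (edge_group D)"
  have "L.gen a \<odot> L.gen b = \<ominus>\<^bsub>L\<^esub> (L.gen b \<odot> L.gen a)"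
    using a b by (intro L.gen_anticomm) auto
  also have "\<dots> = L.gen (- b) \<odot> L.gen a"
    using a b by (simp add: L_gen_minus L.E.l_minus)
  finally show "\<exists>x \<in> carrier (edge_group D). L.gen a \<odot> L.gen b = L.gen x \<odot> L.gen a"
    using b by (intro bexI[of _ "- b"]) auto
qed auto

text \<open>y and its lifted projection differ by an element of the ideal generated by differences
  of edges on a common circle of \<alpha>, and u kills such a difference in \<beta>. As the
  difference may stand behind other generators, u is first moved past them.\<close>

lemma transport_lift:
  assumes u: "factor u"
    and vanish: "\<And>e e'. \<lbrakk>e \<in> edges D; e' \<in> edges D; circle_of D \<alpha> e = circle_of D \<alpha> e'\<rbrakk>
      \<Longrightarrow> proj \<beta> (u \<odot> L.gen (frag_of e - frag_of e')) = \<zero>\<^bsub>K \<beta>\<^esub>"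
    and y: "y \<in> carrier L"
  shows "proj \<beta> (u \<odot> lift \<alpha> (proj \<alpha> y)) = proj \<beta> (u \<odot> y)"
proof -
  have uL [simp]: "u \<in> carrier L" using u by (simp add: factor_def)
  have dgen: "proj \<beta> (u \<odot> L.gen (repr \<alpha> (circ \<alpha> a))) = proj \<beta> (u \<odot> L.gen a)"
    if "edge_chain a" for a
    using that
  proof (induction a rule: frag_induct_on)
    case zero
    then show ?case by simp
  next
    case (one e)
    let ?e = "representative \<alpha> (circle_of D \<alpha> e)"
    have e: "?e \<in> edges D" "circle_of D \<alpha> ?e = circle_of D \<alpha> e"
      using representative[OF circle_in[OF one]] by auto
    have k: "edge_chain (frag_of ?e - frag_of e)"
      using keys_diff[of "frag_of ?e" "frag_of e"] e one by (auto simp: keys_frag_of)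
    have "proj \<beta> (u \<odot> L.gen (frag_of ?e)) = proj \<beta> (u \<odot> L.gen ((frag_of ?e - frag_of e) \<otimes>\<^bsub>edge_group D\<^esub> frag_of e))"
      by simp
    also have "\<dots> = proj \<beta> (u \<odot> L.gen (frag_of ?e - frag_of e)) \<oplus>\<^bsub>K \<beta>\<^esub> proj \<beta> (u \<odot> L.gen (frag_of e))"
      using k one by (subst L.gen_mult) (simp_all add: keys_frag_of L.E.r_distr del: proj.hom_mult)
    also have "\<dots> = proj \<beta> (u \<odot> L.gen (frag_of e))"
      using vanish[OF e(1) one e(2)] one by (simp add: keys_frag_of del: proj.hom_mult)
    finally show ?case by simp
  next
    case (diff a b)
    have split: "proj \<beta> (u \<odot> L.gen (x - z)) = proj \<beta> (u \<odot> L.gen x) \<ominus>\<^bsub>K \<beta>\<^esub> proj \<beta> (u \<odot> L.gen z)"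
      if "edge_chain x" "edge_chain z" for x z
    proof -
      have "L.gen (x - z) = L.gen x \<oplus>\<^bsub>L\<^esub> \<ominus>\<^bsub>L\<^esub> L.gen z"
        using L.gen_mult[of x "- z"] that by (simp add: L_gen_minus)
      then show ?thesis
        using that by (simp add: a_minus_def L.E.r_distr L.E.r_minus proj.hom_a_inv K.E.r_minus K.E.r_distr)
    qed
    show ?case
      using diff by (simp add: frag_extend_diff split keys_repr keys_circ del: proj.hom_mult)
  qed
  show ?thesis
    using y
  proof (induction y rule: L.ext_alg_induct)
    case one
    show ?case by simp
  next
    case (minus x)
    then show ?case
      by (simp add: lift.hom_a_inv proj.hom_a_inv L.E.r_minus K.E.r_minus)
  next
    case (add x y)
    then show ?case
      by (simp add: L.E.r_distr K.E.r_distr)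
  next
    case (gen a y)
    then have a: "edge_chain a" by simp
    let ?a = "repr \<alpha> (circ \<alpha> a)" and ?y = "lift \<alpha> (proj \<alpha> y)"
    have [simp]: "edge_chain ?a" "?a \<in> carrier (edge_group D)" "?y \<in> carrier L"
      using a keys_repr keys_circ gen by auto
    \<comment> \<open>Moving the generator in front of u exposes \<open>u \<odot> ?y\<close> to the
      induction hypothesis; afterwards it is moved back and \<open>?a\<close> is exchanged for a by
      \<open>dgen\<close>.\<close>
    obtain b where b: "b \<in> carrier (edge_group D)" "u \<odot> L.gen ?a = L.gen b \<odot> u"
      using u \<open>?a \<in> carrier (edge_group D)\<close> unfolding factor_def by blast
    have "lift \<alpha> (proj \<alpha> (L.gen a \<odot> y)) = L.gen ?a \<odot> ?y"
      using gen a by (simp add: proj_gen lift_gen keys_circ)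
    then have "proj \<beta> (u \<odot> lift \<alpha> (proj \<alpha> (L.gen a \<odot> y))) = proj \<beta> ((u \<odot> L.gen ?a) \<odot> ?y)"
      by (simp add: L.E.m_assoc del: proj.hom_mult)
    also have "\<dots> = proj \<beta> (L.gen b) \<otimes>\<^bsub>K \<beta>\<^esub> proj \<beta> (u \<odot> ?y)"
      unfolding b(2) using b(1) by (simp add: L.E.m_assoc K.E.m_assoc)
    also have "\<dots> = proj \<beta> (L.gen b \<odot> u \<odot> y)"
      unfolding gen(3) using b(1) gen(2) by (simp add: K.E.m_assoc)
    also have "\<dots> = proj \<beta> (u \<odot> L.gen ?a) \<otimes>\<^bsub>K \<beta>\<^esub> proj \<beta> y"
      unfolding b(2)[symmetric] using gen(2) by simp
    also have "\<dots> = proj \<beta> (u \<odot> L.gen a) \<otimes>\<^bsub>K \<beta>\<^esub> proj \<beta> y"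
      using dgen[OF a] by simp
    also have "\<dots> = proj \<beta> (u \<odot> (L.gen a \<odot> y))"
      using gen(1,2) by (simp add: K.E.m_assoc)
    finally show ?case .
  qed
qed

lemma proj_sdiff_eq:
  assumes "e \<in> edges D" "e' \<in> edges D" "d \<in> edges D" "d' \<in> edges D"
    "circle_of D \<alpha> e = circle_of D \<alpha> d" "circle_of D \<alpha> e' = circle_of D \<alpha> d'"
  shows "proj \<alpha> (L.gen (sdiff s e e')) = proj \<alpha> (L.gen (sdiff s d d'))"
  using assms by (simp add: proj_gen keys_sdiff circ_sdiff)

lemma proj_sdiff_zero:
  assumes "e \<in> edges D" "e' \<in> edges D" "circle_of D \<alpha> e = circle_of D \<alpha> e'"
  shows "proj \<alpha> (L.gen (sdiff s e e')) = \<zero>\<^bsub>K \<alpha>\<^esub>"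
  using assms by (simp add: proj_gen keys_sdiff circ_sdiff)

lemma gen_sdiff_swap:
  assumes "e \<in> edges D" "e' \<in> edges D"
  shows "L.gen (sdiff s e' e) = \<ominus>\<^bsub>L\<^esub> L.gen (sdiff s e e')" "L.gen (sdiff (\<not> s) e e') = \<ominus>\<^bsub>L\<^esub> L.gen (sdiff s e e')"
  using assms L_gen_minus[of "sdiff s e e'"] keys_sdiff[of e "edges D" e' s]
  by (auto simp: sdiff_swap[of s e' e]) (auto simp: sdiff_def split: if_splits)

text \<open>Either e - e' vanishes in \<alpha>, or it equals w - w' up to sign, and then the product
  is a square up to sign.\<close>

lemma glued_vanish:
  assumes "w \<in> edges D" "w' \<in> edges D" "e \<in> edges D" "e' \<in> edges D"
    and "glued (circle_of D \<alpha>) w w' e e'"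
  shows "proj \<alpha> (L.gen (sdiff s w w') \<odot> L.gen (frag_of e - frag_of e')) = \<zero>\<^bsub>K \<alpha>\<^esub>"
proof -
  have *: "frag_of e - frag_of e' = sdiff True e e'" by (simp add: sdiff_def)
  have sq: "proj \<alpha> (L.gen (sdiff s w w')) \<otimes>\<^bsub>K \<alpha>\<^esub> proj \<alpha> (L.gen (sdiff t w w')) = \<zero>\<^bsub>K \<alpha>\<^esub>" for t
  proof -
    have "L.gen (sdiff t w w') = L.gen (sdiff s w w') \<or> L.gen (sdiff t w w') = \<ominus>\<^bsub>L\<^esub> L.gen (sdiff s w w')"
      using gen_sdiff_swap(2)[of w w' s] assms by (cases "s = t") auto
    moreover have "L.gen (sdiff s w w') \<odot> L.gen (sdiff s w w') = \<zero>\<^bsub>L\<^esub>"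
      using assms by (intro L.gen_square) (simp add: keys_sdiff)
    moreover have "proj \<alpha> (L.gen (sdiff s w w')) \<otimes>\<^bsub>K \<alpha>\<^esub> proj \<alpha> (L.gen (sdiff t w w')) = proj \<alpha> (L.gen (sdiff s w w') \<odot> L.gen (sdiff t w w'))"
      using assms by (simp add: keys_sdiff)
    ultimately show ?thesis using assms by (auto simp: keys_sdiff L.E.r_minus simp del: proj.hom_mult)
  qed
  have prod: "proj \<alpha> (L.gen (sdiff s w w') \<odot> L.gen (frag_of e - frag_of e'))
     = proj \<alpha> (L.gen (sdiff s w w')) \<otimes>\<^bsub>K \<alpha>\<^esub> proj \<alpha> (L.gen (sdiff True e e'))"
    unfolding * using assms by (simp add: keys_sdiff)
  consider "circle_of D \<alpha> e = circle_of D \<alpha> e'"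
    | "circle_of D \<alpha> e = circle_of D \<alpha> w" "circle_of D \<alpha> e' = circle_of D \<alpha> w'"
    | "circle_of D \<alpha> e = circle_of D \<alpha> w'" "circle_of D \<alpha> e' = circle_of D \<alpha> w"
    using assms(5) by (auto simp: glued_def)
  then show ?thesis
  proof cases
    case 1
    then show ?thesis
      unfolding prod using assms proj_sdiff_zero[of e e' \<alpha> True] by (simp add: keys_sdiff)
  next
    case 2
    then show ?thesis
      unfolding prod using assms sq[of True] proj_sdiff_eq[of e e' w w' \<alpha> True] by simp
  next
    case 3
    have "sdiff True w' w = sdiff False w w'" by (simp add: sdiff_def)
    then show ?thesis
      unfolding prod using assms 3 sq[of False] proj_sdiff_eq[of e e' w' w \<alpha> True] by simp
  qed
qed

section \<open>Multipliers of surgeries and of reverse surgeries\<close>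

definition split_gen :: "('v \<Rightarrow> bool) \<Rightarrow> 'v \<Rightarrow> 'e edge_ext" where
  "split_gen ar c = L.gen (sdiff (ar c) (strand D c West) (strand D c East))"

text \<open>The tail and head arcs SW and NE, represented by ends of the overstrand.
  \<open>W\<close> and \<open>E\<close> would give the same element in the 0-resolution, where the
  reverse map takes its values; with \<open>S\<close> and \<open>N\<close> the element bounded by
  the homotopy has the same formula in both resolutions.\<close>

definition back_gen :: "('v \<Rightarrow> bool) \<Rightarrow> 'v \<Rightarrow> 'e edge_ext" where
  "back_gen ar c = L.gen (sdiff (ar c) (strand D c South) (strand D c North))"

definition edge_factor :: "('v \<Rightarrow> bool) \<Rightarrow> 'v set \<Rightarrow> 'v \<Rightarrow> 'e edge_ext" where
  "edge_factor ar \<alpha> c = (if merges D \<alpha> c then \<one>\<^bsub>L\<^esub> else split_gen ar c)"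

definition back_factor :: "('v \<Rightarrow> bool) \<Rightarrow> 'v set \<Rightarrow> 'v \<Rightarrow> 'e edge_ext" where
  "back_factor ar \<alpha> c = (if merges D \<alpha> c then back_gen ar c else \<one>\<^bsub>L\<^esub>)"

text \<open>The map of the reverse surgery at \<open>c\<close>, from the resolution \<open>insert c \<alpha>\<close> to \<open>\<alpha>\<close>.\<close>

definition back_map :: "('v \<Rightarrow> bool) \<Rightarrow> 'v set \<Rightarrow> 'v \<Rightarrow> 'e ext \<Rightarrow> 'e ext" where
  "back_map ar \<alpha> c x = proj \<alpha> (back_factor ar \<alpha> c \<odot> lift (insert c \<alpha>) x)"

lemma split_gen_closed [simp]: "c \<in> crossings D \<Longrightarrow> split_gen ar c \<in> carrier L"
  and back_gen_closed [simp]: "c \<in> crossings D \<Longrightarrow> back_gen ar c \<in> carrier L"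
  by (simp_all add: split_gen_def back_gen_def keys_sdiff strand_edge)

lemma edge_factor_closed [simp]: "c \<in> crossings D \<Longrightarrow> edge_factor ar \<alpha> c \<in> carrier L"
  and back_factor_closed [simp]: "c \<in> crossings D \<Longrightarrow> back_factor ar \<alpha> c \<in> carrier L"
  by (simp_all add: edge_factor_def back_factor_def)

lemma factor_edge_factor: "c \<in> crossings D \<Longrightarrow> factor (edge_factor ar \<alpha> c)"
  and factor_back_factor: "c \<in> crossings D \<Longrightarrow> factor (back_factor ar \<alpha> c)"
  by (simp_all add: edge_factor_def back_factor_def split_gen_def back_gen_def factor_one factor_gen keys_sdiff strand_edge)

lemma proj_coarser_vanish:
  assumes "circle_of D \<beta> e = circle_of D \<beta> e'" "e \<in> edges D" "e' \<in> edges D"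
  shows "proj \<beta> (\<one>\<^bsub>L\<^esub> \<odot> L.gen (frag_of e - frag_of e')) = \<zero>\<^bsub>K \<beta>\<^esub>"
  using proj_sdiff_zero[OF assms(2,3,1), of True] keys_sdiff[OF assms(2,3), of True] by (simp add: sdiff_def)

text \<open>For a merge the target has coarser circles, and any two representatives agree there. For
  a split they may differ by the two new circles, but the multiplier is the difference of these
  circles and kills the discrepancy (\<open>glued_vanish\<close>).\<close>

lemma edge_factor_transport:
  assumes c: "c \<in> crossings D" "c \<notin> \<alpha>" and y: "y \<in> carrier L"
  shows "proj (insert c \<alpha>) (edge_factor ar \<alpha> c \<odot> lift \<alpha> (proj \<alpha> y)) = proj (insert c \<alpha>) (edge_factor ar \<alpha> c \<odot> y)"
proof (rule transport_lift[OF factor_edge_factor[OF c(1)] _ y])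
  fix e e' assume e: "e \<in> edges D" "e' \<in> edges D" "circle_of D \<alpha> e = circle_of D \<alpha> e'"
  show "proj (insert c \<alpha>) (edge_factor ar \<alpha> c \<odot> L.gen (frag_of e - frag_of e')) = \<zero>\<^bsub>K (insert c \<alpha>)\<^esub>"
  proof (cases "merges D \<alpha> c")
    case True
    then show ?thesis
      unfolding edge_factor_def using proj_coarser_vanish[OF merge_circle_of[OF c True e(3)] e(1,2)] by simp
  next
    case False
    have "glued (circle_of D (insert c \<alpha>)) (strand D c West) (strand D c East) e e'"
      using split_glued[OF c False] e by blast
    then show ?thesis
      unfolding edge_factor_def split_gen_def using glued_vanish[of "strand D c West" "strand D c East" e e'] False e c
      by (simp add: strand_edge)
  qed
qed

lemma back_factor_transport:
  assumes c: "c \<in> crossings D" "c \<notin> \<alpha>" and y: "y \<in> carrier L"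
  shows "proj \<alpha> (back_factor ar \<alpha> c \<odot> lift (insert c \<alpha>) (proj (insert c \<alpha>) y)) = proj \<alpha> (back_factor ar \<alpha> c \<odot> y)"
proof (rule transport_lift[OF factor_back_factor[OF c(1)] _ y])
  fix e e' assume e: "e \<in> edges D" "e' \<in> edges D" "circle_of D (insert c \<alpha>) e = circle_of D (insert c \<alpha>) e'"
  show "proj \<alpha> (back_factor ar \<alpha> c \<odot> L.gen (frag_of e - frag_of e')) = \<zero>\<^bsub>K \<alpha>\<^esub>"
  proof (cases "merges D \<alpha> c")
    case False
    then show ?thesis
      unfolding back_factor_def using proj_coarser_vanish[OF split_circle_of[OF c False e(3)] e(1,2)] by simp
  next
    case True
    have "glued (circle_of D \<alpha>) (strand D c West) (strand D c East) e e'"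
      using merge_glued[OF c True] e by blast
    then have "glued (circle_of D \<alpha>) (strand D c South) (strand D c North) e e'"
      using circle_of_partner0[OF c] by (simp add: glued_def)
    then show ?thesis
      unfolding back_factor_def back_gen_def using glued_vanish[of "strand D c South" "strand D c North" e e'] True e c
      by (simp add: strand_edge)
  qed
qed

lemma back_map_proj:
  "\<lbrakk>c \<in> crossings D; c \<notin> \<alpha>; y \<in> carrier L\<rbrakk>
    \<Longrightarrow> back_map ar \<alpha> c (proj (insert c \<alpha>) y) = proj \<alpha> (back_factor ar \<alpha> c \<odot> y)"
  unfolding back_map_def by (rule back_factor_transport)

lemma super_circle_circle_of:
  assumes coarser: "\<And>e'. circle_of D \<alpha> e = circle_of D \<alpha> e' \<Longrightarrow> circle_of D \<beta> e = circle_of D \<beta> e'" and e: "e \<in> edges D"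
  shows "super_circle D \<beta> (circle_of D \<alpha> e) = circle_of D \<beta> e"
  unfolding super_circle_def
proof (rule the_equality)
  show "circle_of D \<beta> e \<in> circles D \<beta> \<and> circle_of D \<alpha> e \<subseteq> circle_of D \<beta> e"
  proof
    show "circle_of D \<alpha> e \<subseteq> circle_of D \<beta> e"
      using coarser unfolding subset_iff mem_circle_of by blast
  qed (rule circle_in[OF e])
next
  fix C assume C: "C \<in> circles D \<beta> \<and> circle_of D \<alpha> e \<subseteq> C"
  then obtain e' where "C = circle_of D \<beta> e'" by (auto simp: circles_def)
  moreover have "e \<in> C" using C circle_of_self[of e \<alpha>] by blast
  ultimately show "C = circle_of D \<beta> e" by (simp add: mem_circle_of)
qed

lemma collapse_proj:
  assumes coarser: "\<And>e e'. circle_of D \<alpha> e = circle_of D \<alpha> e' \<Longrightarrow> circle_of D \<beta> e = circle_of D \<beta> e'"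
    and y: "y \<in> carrier L"
  shows "collapse D \<beta> (proj \<alpha> y) = proj \<beta> y"
proof -
  let ?s = "frag_extend (\<lambda>C. frag_of (super_circle D \<beta> C))"
  have s: "super_circle D \<beta> (circle_of D \<alpha> e) = circle_of D \<beta> e" if "e \<in> edges D" for e
    using super_circle_circle_of[of \<alpha> e \<beta>] coarser that by blast
  have s_hom: "?s \<in> hom (circle_group D \<alpha>) (circle_group D \<beta>)"
    unfolding circle_group_def by (rule frag_hom) (auto simp: circles_def s)
  have c_hom: "collapse D \<beta> \<in> ring_hom (K \<alpha>) (K \<beta>)"
    unfolding collapse_def by (intro ext_map_hom comm_group_circle_group s_hom)
  have comp: "(\<lambda>y. collapse D \<beta> (proj \<alpha> y)) \<in> ring_hom L (K \<beta>)"
    using ring_hom_trans[OF proj.homh c_hom] by (simp add: o_def)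
  show ?thesis
  proof (rule ext_alg_hom_eqI[OF comm_group_edge_group K.E.ring_axioms comp proj.homh _ y])
    fix a assume "a \<in> carrier (edge_group D)"
    then have a: "edge_chain a" by simp
    have "?s (circ \<alpha> a) = circ \<beta> a"
      using a by (induction a rule: frag_induct_on) (auto simp: frag_extend_diff s)
    then show "collapse D \<beta> (proj \<alpha> (L.gen a)) = proj \<beta> (L.gen a)"
      using a unfolding proj_gen[OF a] collapse_def
      by (subst ext_map_gen[OF comm_group_circle_group comm_group_circle_group s_hom]) (auto simp: keys_circ)
  qed
qed

text \<open>For a split, all preimages of \<open>proj \<alpha> y\<close> under
  \<open>collapse\<close> come from elements w with
  \<open>proj \<alpha> w = proj \<alpha> y\<close>, and the multiplier has the same effect on all of
  these. So the set under \<open>the_elem\<close> is a singleton.\<close>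

lemma edge_map_proj:
  assumes c: "c \<in> crossings D" "c \<notin> \<alpha>" and y: "y \<in> carrier L"
  shows "edge_map D ar \<alpha> c (proj \<alpha> y) = proj (insert c \<alpha>) (edge_factor ar \<alpha> c \<odot> y)"
proof (cases "merges D \<alpha> c")
  case True
  then show ?thesis
    using collapse_proj[OF merge_circle_of[OF c True] y] y by (simp add: edge_map_def edge_factor_def)
next
  case False
  let ?\<beta> = "insert c \<alpha>"
  have sf: "split_factor D ar \<alpha> c = proj ?\<beta> (split_gen ar c)"
  proof -
    have "proj ?\<beta> (split_gen ar c) = K.gen ?\<beta> (sdiff (ar c) (end_circle ?\<beta> c West) (end_circle ?\<beta> c East))"
      using c by (simp add: split_gen_def proj_gen keys_sdiff strand_edge circ_sdiff)
    then show ?thesis by (simp add: split_factor_def Let_def sdiff_def)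
  qed
  have "{split_factor D ar \<alpha> c \<otimes>\<^bsub>circle_alg D ?\<beta>\<^esub> z | z. z \<in> carrier (circle_alg D ?\<beta>) \<and> collapse D \<alpha> z = proj \<alpha> y}
    = {proj ?\<beta> (edge_factor ar \<alpha> c \<odot> y)}" (is "?A = _")
  proof -
    have "split_factor D ar \<alpha> c \<otimes>\<^bsub>K ?\<beta>\<^esub> z = proj ?\<beta> (edge_factor ar \<alpha> c \<odot> y)"
      if z: "z \<in> carrier (K ?\<beta>)" "collapse D \<alpha> z = proj \<alpha> y" for z
    proof -
      obtain w where w: "w \<in> carrier L" "z = proj ?\<beta> w" using proj_surj[OF z(1)] .
      have "proj \<alpha> w = proj \<alpha> y"
        using collapse_proj[OF split_circle_of[OF c False] w(1)] z w by simp
      then have "proj ?\<beta> (edge_factor ar \<alpha> c \<odot> w) = proj ?\<beta> (edge_factor ar \<alpha> c \<odot> y)"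
        using edge_factor_transport[OF c w(1), of ar] edge_factor_transport[OF c y, of ar] by simp
      then show ?thesis using w False c by (simp add: sf edge_factor_def)
    qed
    moreover have "proj ?\<beta> y \<in> carrier (K ?\<beta>)" "collapse D \<alpha> (proj ?\<beta> y) = proj \<alpha> y"
      using y collapse_proj[OF split_circle_of[OF c False] y] by simp_all
    ultimately show ?thesis unfolding circle_alg_def by blast
  qed
  then show ?thesis using False unfolding edge_map_def Let_def by simp
qed

lemma edge_map_closed:
  assumes c: "c \<in> crossings D" "c \<notin> \<alpha>" and x: "x \<in> carrier (K \<alpha>)"
  shows "edge_map D ar \<alpha> c x \<in> carrier (K (insert c \<alpha>))"
proof -
  obtain y where "y \<in> carrier L" "x = proj \<alpha> y" using proj_surj[OF x] .
  then show ?thesis using edge_map_proj[OF c, of y ar] c by (simp del: proj.hom_mult)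
qed

end

section \<open>Faces of the cube\<close>

lemma (in ring) add_pow_signs:
  assumes "x \<in> carrier R"
  shows "[(1::int)] \<cdot> x = x" "[(-1::int)] \<cdot> x = \<ominus> x"
  using assms add.int_pow_1[of x] add.int_pow_neg[of x 1] by simp_all

text \<open>
  The exterior algebra of \<open>\<int>\<^sup>2\<close> on the basis \<open>1, e\<^sub>1, e\<^sub>2, e\<^sub>1 \<and> e\<^sub>2\<close>. Homomorphisms to it detect
  that the two compositions around a face are not 2-torsion, so that their relative sign is unique.
\<close>

definition exterior2 :: "(int \<times> int \<times> int \<times> int) ring" where
  "exterior2 = \<lparr>carrier = UNIV,
     monoid.mult = (\<lambda>(a, b, c, d) (a', b', c', d'). (a * a', a * b' + b * a', a * c' + c * a', a * d' + d * a' + b * c' - c * b')),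
     one = (1, 0, 0, 0), zero = (0, 0, 0, 0),
     add = (\<lambda>(a, b, c, d) (a', b', c', d'). (a + a', b + b', c + c', d + d'))\<rparr>"

lemma ring_exterior2: "ring exterior2"
proof (rule ringI)
  show "abelian_group exterior2"
  proof (rule abelian_groupI)
    fix x assume "x \<in> carrier exterior2"
    obtain a b c d where "x = (a, b, c, d)" by (cases x)
    then show "\<exists>y\<in>carrier exterior2. y \<oplus>\<^bsub>exterior2\<^esub> x = \<zero>\<^bsub>exterior2\<^esub>"
      by (intro bexI[of _ "(-a, -b, -c, -d)"]) (auto simp: exterior2_def)
  qed (auto simp: exterior2_def)
  show "Group.monoid exterior2"
    by (rule monoidI) (auto simp: exterior2_def algebra_simps)
qed (auto simp: exterior2_def algebra_simps)

lemma lookup_sdiff: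
  "Poly_Mapping.lookup (sdiff s x y) z = (if s then 1 else -1) * (of_bool (x = z) - of_bool (y = z))"
  by (auto simp: sdiff_def lookup_minus)

context link_diagram
begin

section \<open>Elements that differ from their negatives\<close>

lemma exterior2_hom:
  obtains \<psi> where "\<psi> \<in> ring_hom (K \<gamma>) exterior2"
    "\<And>a. circle_chain \<gamma> a \<Longrightarrow> \<psi> (K.gen \<gamma> a) = (0, Poly_Mapping.lookup a X, Poly_Mapping.lookup a Y, 0)"
proof -
  obtain \<psi> where "\<psi> \<in> ring_hom (K \<gamma>) exterior2"
    "\<And>a. a \<in> carrier (circle_group D \<gamma>) \<Longrightarrow> \<psi> (K.gen \<gamma> a) = (0, Poly_Mapping.lookup a X, Poly_Mapping.lookup a Y, 0)"
    by (rule ext_alg_universal[OF comm_group_circle_group ring_exterior2,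
          where \<phi> = "\<lambda>a. (0, Poly_Mapping.lookup a X, Poly_Mapping.lookup a Y, 0)"])
      (auto simp: exterior2_def lookup_add)
  then show ?thesis using that by auto
qed

text \<open>The additive group of \<open>exterior2\<close> has no torsion, so an element equal to
  its own negative is sent to 0.\<close>

lemma exterior2_detect:
  assumes \<psi>: "\<psi> \<in> ring_hom (K \<gamma>) exterior2" and z: "z \<in> carrier (K \<gamma>)" and "\<psi> z \<noteq> (0, 0, 0, 0)"
  shows "z \<noteq> \<ominus>\<^bsub>K \<gamma>\<^esub> z"
proof
  interpret ring_hom_ring "K \<gamma>" exterior2 \<psi>
    by (intro ring_hom_ringI2 K.E.ring_axioms ring_exterior2 \<psi>)
  assume "z = \<ominus>\<^bsub>K \<gamma>\<^esub> z"
  then have "z \<oplus>\<^bsub>K \<gamma>\<^esub> z = \<zero>\<^bsub>K \<gamma>\<^esub>" using z K.E.r_neg[of z \<gamma>] by simp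
  then have "\<psi> z \<oplus>\<^bsub>exterior2\<^esub> \<psi> z = (0, 0, 0, 0)"
    using z hom_add[of z z] hom_zero by (simp add: exterior2_def)
  then show False using assms(3) by (cases "\<psi> z") (auto simp: exterior2_def)
qed

lemma proj_split_gen:
  "c \<in> crossings D \<Longrightarrow> proj \<gamma> (split_gen ar c) = K.gen \<gamma> (sdiff (ar c) (end_circle \<gamma> c West) (end_circle \<gamma> c East))"
  "c \<in> crossings D \<Longrightarrow> proj \<gamma> (back_gen ar c) = K.gen \<gamma> (sdiff (ar c) (end_circle \<gamma> c South) (end_circle \<gamma> c North))"
  by (simp_all add: split_gen_def back_gen_def proj_gen keys_sdiff strand_edge circ_sdiff)

lemma keys_sdiff_circles:
  "c \<in> crossings D \<Longrightarrow> circle_chain \<gamma> (sdiff s (end_circle \<gamma> c p) (end_circle \<gamma> c q))"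
  by (intro keys_sdiff circle_in strand_edge)

lemma split_gen_detect:
  assumes c: "c \<in> crossings D" and sep: "end_circle \<gamma> c West \<noteq> end_circle \<gamma> c East"
  shows "proj \<gamma> (split_gen ar c) \<noteq> \<ominus>\<^bsub>K \<gamma>\<^esub> proj \<gamma> (split_gen ar c)"
proof -
  \<comment> \<open>\<open>{}\<close> is a dummy for the second coordinate. The coefficient at the
    circle of W, which is 1 or -1, already detects the element.\<close>
  obtain \<psi> where \<psi>: "\<psi> \<in> ring_hom (K \<gamma>) exterior2"
    "\<And>a. circle_chain \<gamma> a \<Longrightarrow> \<psi> (K.gen \<gamma> a)
       = (0, Poly_Mapping.lookup a (end_circle \<gamma> c West), Poly_Mapping.lookup a {}, 0)"
    using exterior2_hom[of \<gamma> "end_circle \<gamma> c West" "{}" thesis] by blast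
  show ?thesis
    by (rule exterior2_detect[OF \<psi>(1)])
      (use c sep in \<open>auto simp: proj_split_gen \<psi>(2) keys_sdiff_circles lookup_sdiff\<close>)
qed

text \<open>The pairs of circles at c and at c' are different, so some circle Q at c' does not occur
  at c. In the coordinates given by Q and the circle of W at c, the product has
  \<open>e\<^sub>1 \<and> e\<^sub>2\<close>-coefficient 1 or -1.\<close>

lemma split_gen_pair_detect:
  assumes c: "c \<in> crossings D" "c' \<in> crossings D"
    and sep: "end_circle \<gamma> c West \<noteq> end_circle \<gamma> c East"
      "end_circle \<gamma> c' West \<noteq> end_circle \<gamma> c' East"
      "\<not> glued (circle_of D \<gamma>) (strand D c' West) (strand D c' East) (strand D c West) (strand D c East)"
  shows "proj \<gamma> (split_gen ar c' \<odot> split_gen ar c) \<noteq> \<ominus>\<^bsub>K \<gamma>\<^esub> proj \<gamma> (split_gen ar c' \<odot> split_gen ar c)"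
proof -
  let ?C = "\<lambda>c p. end_circle \<gamma> c p"
  obtain Q where Q: "Q = ?C c' West \<or> Q = ?C c' East" "Q \<noteq> ?C c West" "Q \<noteq> ?C c East"
    using sep unfolding glued_def by metis
  obtain \<psi> where \<psi>: "\<psi> \<in> ring_hom (K \<gamma>) exterior2"
    "\<And>a. circle_chain \<gamma> a \<Longrightarrow> \<psi> (K.gen \<gamma> a)
       = (0, Poly_Mapping.lookup a (?C c West), Poly_Mapping.lookup a Q, 0)"
    using exterior2_hom[of \<gamma> "?C c West" Q thesis] by blast
  have "\<psi> (proj \<gamma> (split_gen ar c' \<odot> split_gen ar c)) = \<psi> (proj \<gamma> (split_gen ar c')) \<otimes>\<^bsub>exterior2\<^esub> \<psi> (proj \<gamma> (split_gen ar c))"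
    using c ring_hom_mult[OF \<psi>(1)] by simp
  also have "\<dots> \<noteq> (0, 0, 0, 0)"
    using c Q sep by (auto simp: proj_split_gen \<psi>(2) keys_sdiff_circles lookup_sdiff exterior2_def)
  finally show ?thesis
    using exterior2_detect[OF \<psi>(1)] c by simp
qed

section \<open>Signs of faces\<close>

lemma face_map_proj:
  assumes "c \<in> crossings D" "c' \<in> crossings D" "c \<noteq> c'" "c \<notin> b" "c' \<notin> b" "y \<in> carrier L"
  shows "face_map D ar b c c' (proj b y)
    = proj (insert c' (insert c b)) (edge_factor ar (insert c b) c' \<odot> (edge_factor ar b c \<odot> y))"
  using assms by (simp add: face_map_def edge_map_proj del: proj.hom_mult)

text \<open>By \<open>rel\<close> the sign s meets the definite description in
  \<open>face_sign\<close>; a second sign would make the value at x its own negative.\<close>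

lemma face_sign_eqI:
  assumes s: "s \<in> {1, -1}" and c: "c \<in> crossings D" "c' \<in> crossings D" "c \<noteq> c'" "c \<notin> b" "c' \<notin> b"
    and rel: "\<And>x. x \<in> carrier (K b) \<Longrightarrow> face_map D ar b c c' x = [s] \<cdot>\<^bsub>K (insert c' (insert c b))\<^esub> face_map D ar b c' c x"
    and x: "x \<in> carrier (K b)" "face_map D ar b c c' x \<noteq> \<ominus>\<^bsub>K (insert c' (insert c b))\<^esub> face_map D ar b c c' x"
  shows "face_sign D ar b c c' = s"
proof -
  let ?\<gamma> = "insert c' (insert c b)"
  have cl: "face_map D ar b c c' x \<in> carrier (K ?\<gamma>)" "face_map D ar b c' c x \<in> carrier (K ?\<gamma>)" if "x \<in> carrier (K b)" for x
    using that c edge_map_closed[of c b x ar] edge_map_closed[of c' "insert c b" _ ar]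
      edge_map_closed[of c' b x ar] edge_map_closed[of c "insert c' b" _ ar]
    by (auto simp: face_map_def insert_commute)
  have nz: "face_map D ar b c c' x \<noteq> \<zero>\<^bsub>K ?\<gamma>\<^esub>" using x(2) K.E.minus_zero[of ?\<gamma>] by metis
  then have nz': "face_map D ar b c' c x \<noteq> \<zero>\<^bsub>K ?\<gamma>\<^esub>"
    using rel[OF x(1)] s K.E.add_pow_signs[of "\<zero>\<^bsub>K ?\<gamma>\<^esub>" ?\<gamma>] by auto
  have "(THE s. s \<in> {1, -1} \<and> (\<forall>x \<in> carrier (K b). face_map D ar b c c' x = [s] \<cdot>\<^bsub>K ?\<gamma>\<^esub> face_map D ar b c' c x)) = s"
  proof (rule the_equality)
    fix t :: int assume t: "t \<in> {1, -1} \<and> (\<forall>x \<in> carrier (K b). face_map D ar b c c' x = [t] \<cdot>\<^bsub>K ?\<gamma>\<^esub> face_map D ar b c' c x)"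
    show "t = s"
    proof (rule ccontr)
      assume "t \<noteq> s"
      then have "face_map D ar b c c' x = \<ominus>\<^bsub>K ?\<gamma>\<^esub> face_map D ar b c c' x"
        using t s rel[OF x(1)] x(1) cl[OF x(1)] K.E.add_pow_signs[of "face_map D ar b c' c x" ?\<gamma>] by force
      then show False using x(2) by blast
    qed
  qed (use s rel in blast)
  then show ?thesis
    using nz nz' x(1) unfolding face_sign_def face_map_nonzero_def circle_alg_def insert_commute[of c c'] by auto
qed

text \<open>
  The first two letters say whether the surgeries at \<open>c\<close> and then \<open>c'\<close> merge or split circles, the last two
  letters refer to \<open>c'\<close> and then \<open>c\<close>. Counting circles excludes the other combinations.
\<close>

lemma face_types:
  assumes c: "c \<in> crossings D" "c' \<in> crossings D" "c \<noteq> c'" "c \<notin> b" "c' \<notin> b"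
  obtains
    (MMMM) "merges D b c" "merges D (insert c b) c'" "merges D b c'" "merges D (insert c' b) c"
  | (SSSS) "\<not> merges D b c" "\<not> merges D (insert c b) c'" "\<not> merges D b c'" "\<not> merges D (insert c' b) c"
  | (MSSM) "merges D b c" "\<not> merges D (insert c b) c'" "\<not> merges D b c'" "merges D (insert c' b) c"
  | (SMMS) "\<not> merges D b c" "merges D (insert c b) c'" "merges D b c'" "\<not> merges D (insert c' b) c"
  | (MSMS) "merges D b c" "\<not> merges D (insert c b) c'" "merges D b c'" "\<not> merges D (insert c' b) c"
  | (SMSM) "\<not> merges D b c" "merges D (insert c b) c'" "\<not> merges D b c'" "merges D (insert c' b) c"
  using merges_count[OF c] by (auto simp: of_bool_def split: if_splits)

lemma gens_anticomm:
  assumes "c \<in> crossings D" "c' \<in> crossings D" "y \<in> carrier L"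
  shows "split_gen ar c' \<odot> (split_gen ar c \<odot> y) = \<ominus>\<^bsub>L\<^esub> (split_gen ar c \<odot> (split_gen ar c' \<odot> y))"
    and "back_gen ar c \<odot> (split_gen ar c' \<odot> y) = \<ominus>\<^bsub>L\<^esub> (split_gen ar c' \<odot> (back_gen ar c \<odot> y))"
proof -
  have "split_gen ar c' \<odot> split_gen ar c = \<ominus>\<^bsub>L\<^esub> (split_gen ar c \<odot> split_gen ar c')"
    "back_gen ar c \<odot> split_gen ar c' = \<ominus>\<^bsub>L\<^esub> (split_gen ar c' \<odot> back_gen ar c)"
    unfolding split_gen_def back_gen_def using assms by (intro L.gen_anticomm; simp add: keys_sdiff strand_edge)+
  then show "split_gen ar c' \<odot> (split_gen ar c \<odot> y) = \<ominus>\<^bsub>L\<^esub> (split_gen ar c \<odot> (split_gen ar c' \<odot> y))"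
    "back_gen ar c \<odot> (split_gen ar c' \<odot> y) = \<ominus>\<^bsub>L\<^esub> (split_gen ar c' \<odot> (back_gen ar c \<odot> y))"
    using assms by (simp_all add: L.E.l_minus flip: L.E.m_assoc)
qed

lemma sdiff_match:
  assumes "(x = u \<and> y = v) \<or> (x = v \<and> y = u)"
  shows "sdiff s x y = sdiff t u v \<or> sdiff s x y = - sdiff t u v"
  using assms by (auto simp: sdiff_def)

lemma face_map_sign_exists:
  assumes c: "c \<in> crossings D" "c' \<in> crossings D" "c \<noteq> c'" "c \<notin> b" "c' \<notin> b"
  shows "\<exists>s \<in> {1, -1 :: int}. \<forall>x \<in> carrier (K b).
    face_map D ar b c c' x = [s] \<cdot>\<^bsub>K (insert c' (insert c b))\<^esub> face_map D ar b c' c x"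
    (is "\<exists>s \<in> _. ?rel s")
proof -
  let ?\<gamma> = "insert c' (insert c b)"
  have \<gamma>: "insert c (insert c' b) = ?\<gamma>" by (rule insert_commute)
  let ?u = "edge_factor ar (insert c b) c'" and ?v = "edge_factor ar b c"
    and ?u' = "edge_factor ar (insert c' b) c" and ?v' = "edge_factor ar b c'"
  have rel: "?rel s"
    if "s \<in> {1, -1}" "\<And>y. y \<in> carrier L \<Longrightarrow> proj ?\<gamma> (?u \<odot> (?v \<odot> y)) = [s] \<cdot>\<^bsub>K ?\<gamma>\<^esub> proj ?\<gamma> (?u' \<odot> (?v' \<odot> y))" for s
  proof
    fix x assume x: "x \<in> carrier (K b)"
    obtain y where y: "y \<in> carrier L" "x = proj b y" using proj_surj[OF x] .
    show "face_map D ar b c c' x = [s] \<cdot>\<^bsub>K ?\<gamma>\<^esub> face_map D ar b c' c x"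
      unfolding y(2) face_map_proj[OF c y(1)] face_map_proj[OF c(2,1) c(3)[symmetric] c(5,4) y(1)] \<gamma>
      by (rule that(2)[OF y(1)])
  qed
  have one: "?rel 1" if "\<And>y. y \<in> carrier L \<Longrightarrow> proj ?\<gamma> (?u \<odot> (?v \<odot> y)) = proj ?\<gamma> (?u' \<odot> (?v' \<odot> y))"
    using c by (intro rel) (auto simp: that K.E.add_pow_signs simp del: proj.hom_mult)
  have minus: "?rel (-1)" if "\<And>y. y \<in> carrier L \<Longrightarrow> proj ?\<gamma> (?u \<odot> (?v \<odot> y)) = \<ominus>\<^bsub>K ?\<gamma>\<^esub> proj ?\<gamma> (?u' \<odot> (?v' \<odot> y))"
    using c by (intro rel) (auto simp: that K.E.add_pow_signs simp del: proj.hom_mult)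
  show ?thesis
    using c
  proof (cases rule: face_types)
    case MMMM
    then have "?rel 1" using c by (intro one) (simp add: edge_factor_def)
    then show ?thesis by blast
  next
    case SSSS
    then have "?rel (-1)" using c
      by (intro minus) (simp add: edge_factor_def gens_anticomm(1)[of c c'] proj.hom_a_inv del: proj.hom_mult)
    then show ?thesis by blast
  next
    case MSSM
    then have "?rel 1" using c by (intro one) (simp add: edge_factor_def)
    then show ?thesis by blast
  next
    case SMMS
    then have "?rel 1" using c by (intro one) (simp add: edge_factor_def)
    then show ?thesis by blast
  next
    case MSMS
    have sep: "end_circle ?\<gamma> c West \<noteq> end_circle ?\<gamma> c East"
      using split_separates[of c "insert c' b"] MSMS(4) c unfolding \<gamma> by blast
    have "glued (circle_of D ?\<gamma>) (strand D c' West) (strand D c' East) (strand D c West) (strand D c East)"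
      using split_glued[of c' "insert c b"] MSMS(2) merge_joins[OF c(1,4) MSMS(1)] c by blast
    then have "(end_circle ?\<gamma> c' West = end_circle ?\<gamma> c West \<and> end_circle ?\<gamma> c' East = end_circle ?\<gamma> c East)
      \<or> (end_circle ?\<gamma> c' West = end_circle ?\<gamma> c East \<and> end_circle ?\<gamma> c' East = end_circle ?\<gamma> c West)"
      using glued_match[OF _ sep] by metis
    from sdiff_match[OF this] have "proj ?\<gamma> (split_gen ar c') = proj ?\<gamma> (split_gen ar c) \<or> proj ?\<gamma> (split_gen ar c') = \<ominus>\<^bsub>K ?\<gamma>\<^esub> proj ?\<gamma> (split_gen ar c)"
      using c K_gen_minus[OF keys_sdiff_circles[OF c(1)]] by (metis proj_split_gen(1))
    then show ?thesis
    proof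
      assume "proj ?\<gamma> (split_gen ar c') = proj ?\<gamma> (split_gen ar c)"
      then have "?rel 1" using c MSMS by (intro one) (simp add: edge_factor_def)
      then show ?thesis by blast
    next
      assume "proj ?\<gamma> (split_gen ar c') = \<ominus>\<^bsub>K ?\<gamma>\<^esub> proj ?\<gamma> (split_gen ar c)"
      then have "?rel (-1)" using c MSMS by (intro minus) (simp add: edge_factor_def K.E.l_minus)
      then show ?thesis by blast
    qed
  next
    case SMSM
    have "proj ?\<gamma> (split_gen ar c) = \<zero>\<^bsub>K ?\<gamma>\<^esub>" "proj ?\<gamma> (split_gen ar c') = \<zero>\<^bsub>K ?\<gamma>\<^esub>"
      using merge_joins[of c "insert c' b"] merge_joins[of c' "insert c b"] SMSM c unfolding \<gamma>
      by (simp_all add: proj_split_gen)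
    then have "?rel 1" using c SMSM by (intro one) (simp add: edge_factor_def)
    then show ?thesis by blast
  qed
qed

text \<open>A value that is not its own negative determines the sign, which is then
  \<open>face_sign\<close>. At a value that is its own negative either sign serves.\<close>

lemma face_map_sign:
  assumes c: "c \<in> crossings D" "c' \<in> crossings D" "c \<noteq> c'" "c \<notin> b" "c' \<notin> b"
    and fs: "face_sign D ar b c c' \<in> {1, -1}" and x: "x \<in> carrier (K b)"
  shows "face_map D ar b c c' x = [face_sign D ar b c c'] \<cdot>\<^bsub>K (insert c' (insert c b))\<^esub> face_map D ar b c' c x"
proof -
  let ?\<gamma> = "insert c' (insert c b)"
  have cl: "face_map D ar b c c' x \<in> carrier (K ?\<gamma>)" "face_map D ar b c' c x \<in> carrier (K ?\<gamma>)"
    using x c edge_map_closed[of c b x ar] edge_map_closed[of c' "insert c b" _ ar]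
      edge_map_closed[of c' b x ar] edge_map_closed[of c "insert c' b" _ ar]
    by (auto simp: face_map_def insert_commute)
  obtain s :: int where s: "s \<in> {1, -1}"
    "\<forall>x \<in> carrier (K b). face_map D ar b c c' x = [s] \<cdot>\<^bsub>K ?\<gamma>\<^esub> face_map D ar b c' c x"
    using face_map_sign_exists[OF c] by blast
  show ?thesis
  proof (cases "face_map D ar b c c' x = \<ominus>\<^bsub>K ?\<gamma>\<^esub> face_map D ar b c c' x")
    case False
    then show ?thesis using face_sign_eqI[OF s(1) c _ x False] s(2) x by simp
  next
    case True
    have "face_map D ar b c c' x = [s] \<cdot>\<^bsub>K ?\<gamma>\<^esub> face_map D ar b c' c x" using s(2) x by blast
    then have "face_map D ar b c' c x = face_map D ar b c c' x" "\<ominus>\<^bsub>K ?\<gamma>\<^esub> face_map D ar b c' c x = face_map D ar b c c' x"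
      using s(1) True cl K.E.add_pow_signs[OF cl(2)] K.E.minus_minus[OF cl(2)] by auto
    then show ?thesis using fs K.E.add_pow_signs[OF cl(2)] by auto
  qed
qed

text \<open>The composition takes 1 to the product of the two factors, so a single product has to be
  tested.\<close>

lemma face_sign_value:
  assumes c: "c \<in> crossings D" "c' \<in> crossings D" "c \<noteq> c'" "c \<notin> b" "c' \<notin> b" and s: "s \<in> {1, -1}"
    and rel: "\<And>y. y \<in> carrier L \<Longrightarrow> edge_factor ar (insert c b) c' \<odot> (edge_factor ar b c \<odot> y)
      = [s] \<cdot>\<^bsub>L\<^esub> (edge_factor ar (insert c' b) c \<odot> (edge_factor ar b c' \<odot> y))"
    and detect: "proj (insert c' (insert c b)) (edge_factor ar (insert c b) c' \<odot> edge_factor ar b c)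
      \<noteq> \<ominus>\<^bsub>K (insert c' (insert c b))\<^esub> proj (insert c' (insert c b)) (edge_factor ar (insert c b) c' \<odot> edge_factor ar b c)"
  shows "face_sign D ar b c c' = s"
proof (rule face_sign_eqI[OF s c])
  let ?\<gamma> = "insert c' (insert c b)"
  have \<gamma>: "insert c (insert c' b) = ?\<gamma>" by (rule insert_commute)
  show "proj b \<one>\<^bsub>L\<^esub> \<in> carrier (K b)" by simp
  have "face_map D ar b c c' (proj b \<one>\<^bsub>L\<^esub>) = proj ?\<gamma> (edge_factor ar (insert c b) c' \<odot> edge_factor ar b c)"
    using face_map_proj[OF c, of "\<one>\<^bsub>L\<^esub>" ar] c by (simp del: proj.hom_one)
  then show "face_map D ar b c c' (proj b \<one>\<^bsub>L\<^esub>) \<noteq> \<ominus>\<^bsub>K ?\<gamma>\<^esub> face_map D ar b c c' (proj b \<one>\<^bsub>L\<^esub>)"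
    using detect by metis
  fix x assume x: "x \<in> carrier (K b)"
  obtain y where y: "y \<in> carrier L" "x = proj b y" using proj_surj[OF x] .
  have cl: "edge_factor ar (insert c' b) c \<odot> (edge_factor ar b c' \<odot> y) \<in> carrier L"
    using c y by simp
  have "proj ?\<gamma> ([s] \<cdot>\<^bsub>L\<^esub> z) = [s] \<cdot>\<^bsub>K ?\<gamma>\<^esub> proj ?\<gamma> z" if "z \<in> carrier L" for z
    using s that L.E.add_pow_signs[of z] K.E.add_pow_signs[of "proj ?\<gamma> z" ?\<gamma>] by (auto simp: proj.hom_a_inv)
  then show "face_map D ar b c c' x = [s] \<cdot>\<^bsub>K ?\<gamma>\<^esub> face_map D ar b c' c x"
    unfolding y(2) face_map_proj[OF c y(1)] face_map_proj[OF c(2,1) c(3)[symmetric] c(5,4) y(1)] \<gamma> rel[OF y(1)]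
    using cl by blast
qed

text \<open>Whatever the direction of the arrow, the signed difference of W and E is tail minus head
  for the ends that have the arrow on their left. This links the factors of the surgeries to the
  type Y pattern.\<close>

lemma sdiff_tail_head:
  "sdiff (s c) (C (f c West)) (C (f c East)) = frag_of (C (f c (tail_left (s c)))) - frag_of (C (f c (head_left (s c))))"
  by (cases "s c") (auto simp: sdiff_def)

text \<open>The reverse surgery at \<open>c\<close> commutes with the surgery at \<open>c'\<close> up to the sign that makes it a homotopy.\<close>

lemma back_map_edge_map:
  assumes c: "c \<in> crossings D" "c' \<in> crossings D" "c \<noteq> c'" "c \<notin> b" "c' \<notin> b"
    and fs: "face_sign D ar b c c' \<in> {1, -1}" and x: "x \<in> carrier (K (insert c b))"
  shows "back_map ar (insert c' b) c (edge_map D ar (insert c b) c' x)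
    = [((if merges D b c' then 1 else -1) * face_sign D ar b c c')] \<cdot>\<^bsub>K (insert c' b)\<^esub> edge_map D ar b c' (back_map ar b c x)"
proof -
  let ?\<gamma> = "insert c' (insert c b)" and ?\<beta> = "insert c' b"
  have \<gamma>: "insert c (insert c' b) = ?\<gamma>" by (rule insert_commute)
  obtain y where y: "y \<in> carrier L" "x = proj (insert c b) y" using proj_surj[OF x] .
  have "edge_map D ar (insert c b) c' x = proj ?\<gamma> (edge_factor ar (insert c b) c' \<odot> y)"
    unfolding y(2) using c y by (intro edge_map_proj) auto
  then have lhs: "back_map ar ?\<beta> c (edge_map D ar (insert c b) c' x)
    = proj ?\<beta> (back_factor ar ?\<beta> c \<odot> (edge_factor ar (insert c b) c' \<odot> y))"
    using back_map_proj[of c ?\<beta> "edge_factor ar (insert c b) c' \<odot> y" ar] c y by (simp add: \<gamma> del: proj.hom_mult)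
  have "back_map ar b c x = proj b (back_factor ar b c \<odot> y)"
    unfolding y(2) using c y by (intro back_map_proj) auto
  then have rhs: "edge_map D ar b c' (back_map ar b c x) = proj ?\<beta> (edge_factor ar b c' \<odot> (back_factor ar b c \<odot> y))"
    using edge_map_proj[of c' b "back_factor ar b c \<odot> y" ar] c y by (simp del: proj.hom_mult)
  have cl: "edge_factor ar b c' \<odot> (back_factor ar b c \<odot> y) \<in> carrier L" using c y by simp
  note signs = K.E.add_pow_signs[OF proj.hom_closed[OF cl]]
  show ?thesis
    using c
  proof (cases rule: face_types)
    case MMMM
    have "proj ?\<gamma> \<one>\<^bsub>L\<^esub> \<noteq> \<ominus>\<^bsub>K ?\<gamma>\<^esub> proj ?\<gamma> \<one>\<^bsub>L\<^esub>"
    proof -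
      obtain \<psi> where \<psi>: "\<psi> \<in> ring_hom (K ?\<gamma>) exterior2"
        using exterior2_hom[of ?\<gamma> "{}" "{}" thesis] by blast
      show ?thesis
        by (rule exterior2_detect[OF \<psi>]) (use ring_hom_one[OF \<psi>] in \<open>simp_all add: exterior2_def\<close>)
    qed
    then have "face_sign D ar b c c' = 1"
      using c MMMM by (intro face_sign_value) (auto simp: edge_factor_def L.E.add_pow_signs simp del: proj.hom_one)
    then show ?thesis unfolding lhs rhs using MMMM c y
      by (simp add: edge_factor_def back_factor_def K.E.add_pow_signs)
  next
    case SSSS
    have sep: "end_circle ?\<gamma> c West \<noteq> end_circle ?\<gamma> c East"
      using split_separates[of c "insert c' b"] SSSS c unfolding \<gamma> by blast
    have sep': "end_circle ?\<gamma> c' West \<noteq> end_circle ?\<gamma> c' East"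
      using split_separates[of c' "insert c b"] SSSS c by blast
    have "\<not> glued (circle_of D ?\<gamma>) (strand D c' West) (strand D c' East) (strand D c West) (strand D c East)"
      using split_glued[of c' "insert c b"] split_separates[of c b] SSSS c by blast
    note split_gen_pair_detect[OF c(1,2) sep sep' this, of ar]
    then have "face_sign D ar b c c' = -1"
      using c SSSS by (intro face_sign_value)
        (auto simp: edge_factor_def L.E.add_pow_signs gens_anticomm(1)[of c c'] simp del: proj.hom_mult)
    then show ?thesis unfolding lhs rhs using SSSS c y
      by (simp add: edge_factor_def back_factor_def K.E.add_pow_signs)
  next
    case MSSM
    have "end_circle ?\<gamma> c' West \<noteq> end_circle ?\<gamma> c' East"
      using split_separates[of c' "insert c b"] MSSM c by blast
    then have "face_sign D ar b c c' = 1"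
      using c MSSM split_gen_detect[of c' ?\<gamma> ar]
      by (intro face_sign_value) (auto simp: edge_factor_def L.E.add_pow_signs)
    then show ?thesis unfolding lhs rhs using MSSM c y
      by (simp add: edge_factor_def back_factor_def K.E.add_pow_signs gens_anticomm(2) proj.hom_a_inv del: proj.hom_mult)
  next
    case SMMS
    have "end_circle ?\<gamma> c West \<noteq> end_circle ?\<gamma> c East"
      using split_separates[of c "insert c' b"] SMMS c unfolding \<gamma> by blast
    then have "face_sign D ar b c c' = 1"
      using c SMMS split_gen_detect[of c ?\<gamma> ar]
      by (intro face_sign_value) (auto simp: edge_factor_def L.E.add_pow_signs)
    then show ?thesis unfolding lhs rhs using SMMS c y
      by (simp add: edge_factor_def back_factor_def K.E.add_pow_signs)
  next
    case MSMS
    \<comment> \<open>Both sides will be 0: at \<open>?\<beta>\<close> the ends W and E of either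
      crossing lie on one circle, which kills the difference in each multiplier.\<close>
    have "end_circle ?\<beta> c West = end_circle ?\<beta> c East"
      "end_circle ?\<beta> c' West = end_circle ?\<beta> c' East"
      using MSMS(4) merge_joins[OF c(2,5) MSMS(3)] by (auto simp: merges_def)
    then have "proj ?\<beta> (split_gen ar c') = \<zero>\<^bsub>K ?\<beta>\<^esub>" "proj ?\<beta> (back_gen ar c) = \<zero>\<^bsub>K ?\<beta>\<^esub>"
      using c circle_of_partner0[of c ?\<beta>] by (simp_all add: proj_split_gen)
    then show ?thesis unfolding lhs rhs using MSMS c y fs K.E.add_pow_signs[of "\<zero>\<^bsub>K ?\<beta>\<^esub>" ?\<beta>]
      by (auto simp: edge_factor_def back_factor_def)
  next
    case SMSM
    let ?C = "\<lambda>c p. end_circle ?\<beta> c p"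
    have fz: "face_map D ar b c c' x = \<zero>\<^bsub>K ?\<gamma>\<^esub>" if x: "x \<in> carrier (K b)" for x
    proof -
      obtain y where y: "y \<in> carrier L" "x = proj b y" using proj_surj[OF x] .
      have "proj ?\<gamma> (split_gen ar c) = \<zero>\<^bsub>K ?\<gamma>\<^esub>"
        using merge_joins[of c "insert c' b"] SMSM c unfolding \<gamma> by (simp add: proj_split_gen)
      then show ?thesis
        unfolding y(2) face_map_proj[OF c y(1)] using SMSM c y by (simp add: edge_factor_def)
    qed
    \<comment> \<open>The compositions vanish, so the pattern decides; together with
      \<open>hr\<close> below it says that the two tails lie on one circle of
      \<open>?\<beta>\<close>.\<close>
    have sgn: "face_sign D ar b c c' = (if ?C c (tail_left (ar c)) = ?C c' (head_right (ar c')) then -1 else 1)"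
      using negative_pattern_iff[OF c SMSM(1,3,2,4), of ar] fz
      unfolding face_sign_def face_map_nonzero_def circle_alg_def by auto
    have hr: "?C c' (head_right (ar c')) = ?C c' (tail_left (ar c'))"
      using circle_of_partner1[of c' ?\<beta>] c by (cases "ar c'") auto
    have sep: "?C c West \<noteq> ?C c East" using SMSM(4) by (simp add: merges_def)
    have "glued (circle_of D ?\<beta>) (strand D c' West) (strand D c' East) (strand D c West) (strand D c East)"
      using split_glued[OF c(2,5) SMSM(3)] SMSM(1) by (simp add: merges_def)
    from glued_match[OF this sep]
    have match: "(?C c (tail_left (ar c)) = ?C c' (tail_left (ar c')) \<and> ?C c (head_left (ar c)) = ?C c' (head_left (ar c')))
      \<or> (?C c (tail_left (ar c)) = ?C c' (head_left (ar c')) \<and> ?C c (head_left (ar c)) = ?C c' (tail_left (ar c')))"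
      by (cases "ar c"; cases "ar c'") auto
    have tl: "?C c (tail_left (ar c)) \<noteq> ?C c (head_left (ar c))" using sep by (cases "ar c") auto
    have b: "proj ?\<beta> (back_gen ar c) = K.gen ?\<beta> (frag_of (?C c (tail_left (ar c))) - frag_of (?C c (head_left (ar c))))"
      using circle_of_partner0[of c ?\<beta>] c
      by (simp add: proj_split_gen sdiff_tail_head[of ar c "circle_of D ?\<beta>" "strand D"])
    have g: "proj ?\<beta> (split_gen ar c') = K.gen ?\<beta> (frag_of (?C c' (tail_left (ar c'))) - frag_of (?C c' (head_left (ar c'))))"
      using c by (simp add: proj_split_gen sdiff_tail_head[of ar c' "circle_of D ?\<beta>" "strand D"])
    have k: "Poly_Mapping.keys (frag_of (?C c' (tail_left (ar c'))) - frag_of (?C c' (head_left (ar c')))) \<subseteq> circles D ?\<beta>"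
      using keys_sdiff_circles[OF c(2), of True ?\<beta> "tail_left (ar c')" "head_left (ar c')"] by (simp add: sdiff_def)
    \<comment> \<open>Both multipliers are tail minus head for the same two circles. They are equal
      if the tails share a circle, which is when the face sign is -1, and opposite
      otherwise.\<close>
    have "proj ?\<beta> (back_gen ar c) = [(- face_sign D ar b c c')] \<cdot>\<^bsub>K ?\<beta>\<^esub> proj ?\<beta> (split_gen ar c')"
    proof (cases "?C c (tail_left (ar c)) = ?C c' (tail_left (ar c'))")
      case True
      then have "?C c (head_left (ar c)) = ?C c' (head_left (ar c'))" using match tl by metis
      then have "proj ?\<beta> (back_gen ar c) = proj ?\<beta> (split_gen ar c')" unfolding b g True by simp
      then show ?thesis using True sgn hr c by (simp add: K.E.add_pow_signs)
    next
      case False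
      then have m: "?C c (tail_left (ar c)) = ?C c' (head_left (ar c'))" "?C c (head_left (ar c)) = ?C c' (tail_left (ar c'))"
        using match by metis+
      have "proj ?\<beta> (back_gen ar c) = \<ominus>\<^bsub>K ?\<beta>\<^esub> proj ?\<beta> (split_gen ar c')"
        using K_gen_minus[OF k] unfolding b g m by simp
      then show ?thesis using False sgn hr c by (simp add: K.E.add_pow_signs)
    qed
    moreover have "[s] \<cdot>\<^bsub>K ?\<beta>\<^esub> p \<otimes>\<^bsub>K ?\<beta>\<^esub> q = [s] \<cdot>\<^bsub>K ?\<beta>\<^esub> (p \<otimes>\<^bsub>K ?\<beta>\<^esub> q)"
      if "s \<in> {1, -1}" "p \<in> carrier (K ?\<beta>)" "q \<in> carrier (K ?\<beta>)" for s :: int and p q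
      using that K.E.add_pow_signs[OF that(2)] K.E.add_pow_signs[of "p \<otimes>\<^bsub>K ?\<beta>\<^esub> q" ?\<beta>] by (auto simp: K.E.l_minus)
    moreover have "- face_sign D ar b c c' \<in> {1, -1}" using fs by auto
    ultimately show ?thesis unfolding lhs rhs using SMSM c y by (simp add: edge_factor_def back_factor_def)
  qed
qed

end

section \<open>The complex and the null-homotopy\<close>

text \<open>Signed edge maps, dots and homotopies are additive without being multiplicative, so they
  are treated as maps of the underlying additive groups.\<close>

locale ring_add_hom = R: ring R + S: ring S
  for R :: "('a, 'm) ring_scheme" and S :: "('b, 'n) ring_scheme" and h :: "'a \<Rightarrow> 'b" +
  assumes closed [simp]: "x \<in> carrier R \<Longrightarrow> h x \<in> carrier S"
    and add: "\<lbrakk>x \<in> carrier R; y \<in> carrier R\<rbrakk> \<Longrightarrow> h (x \<oplus>\<^bsub>R\<^esub> y) = h x \<oplus>\<^bsub>S\<^esub> h y"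
begin

lemma hom: "h \<in> hom (add_monoid R) (add_monoid S)"
  by (rule homI) (auto simp: add)

lemma zero: "h \<zero>\<^bsub>R\<^esub> = \<zero>\<^bsub>S\<^esub>"
  using hom_one[OF hom R.a_group S.a_group] by simp

lemma int_mult: "x \<in> carrier R \<Longrightarrow> h ([(k :: int)] \<cdot>\<^bsub>R\<^esub> x) = [k] \<cdot>\<^bsub>S\<^esub> h x"
  using hom_int_pow[OF hom _ R.a_group S.a_group, of x k] by (simp add: add_pow_def)

lemma finsum: "\<lbrakk>finite A; f \<in> A \<rightarrow> carrier R\<rbrakk> \<Longrightarrow> h (finsum R f A) = finsum S (\<lambda>x. h (f x)) A"
proof (induction A rule: finite_induct)
  case (insert a A)
  then have "f a \<in> carrier R" "f \<in> A \<rightarrow> carrier R" by auto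
  then show ?case using insert by (simp add: add Pi_def)
qed (simp add: zero)

end

context ring
begin

lemma int_mult_closed [simp]: "x \<in> carrier R \<Longrightarrow> [(k :: int)] \<cdot> x \<in> carrier R"
  by (rule add.int_pow_closed)

lemma int_mult_add: "\<lbrakk>x \<in> carrier R; y \<in> carrier R\<rbrakk> \<Longrightarrow> [(k :: int)] \<cdot> (x \<oplus> y) = [k] \<cdot> x \<oplus> [k] \<cdot> y"
  by (rule add.int_pow_distrib)

lemma int_mult_int_mult: "x \<in> carrier R \<Longrightarrow> [(k :: int)] \<cdot> ([l] \<cdot> x) = [(k * l)] \<cdot> x"
  using add.int_pow_pow[of x k l] by (simp add: mult.commute)

lemma int_mult_plus: "x \<in> carrier R \<Longrightarrow> [(k :: int)] \<cdot> x \<oplus> [l] \<cdot> x = [(k + l)] \<cdot> x"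
  using add.int_pow_mult[of x k l] by simp

lemma int_mult_zero_left: "[(0 :: int)] \<cdot> x = \<zero>"
  by (simp add: add_pow_def)

lemma ring_add_hom_int_mult: "ring_add_hom R R (\<lambda>x. [(k :: int)] \<cdot> x)"
  by unfold_locales (auto simp: int_mult_add)

text \<open>Comparing the double sum with its transpose would only show that twice the sum is 0.
  Instead the induction splits off one row and the matching column, which cancel term by
  term.\<close>

lemma finsum_antisym_pairs:
  assumes "finite A" "\<And>a b. \<lbrakk>a \<in> A; b \<in> A; a \<noteq> b\<rbrakk> \<Longrightarrow> f a b \<in> carrier R"
    and "\<And>a b. \<lbrakk>a \<in> A; b \<in> A; a \<noteq> b\<rbrakk> \<Longrightarrow> f a b \<oplus> f b a = \<zero>"
  shows "(\<Oplus>a\<in>A. \<Oplus>b\<in>A - {a}. f a b) = \<zero>"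
  using assms
proof (induction A rule: finite_induct)
  case (insert x A)
  have A: "(\<lambda>a. f a x) \<in> A \<rightarrow> carrier R" "(\<lambda>b. f x b) \<in> A \<rightarrow> carrier R"
    and inner: "(\<lambda>a. \<Oplus>b\<in>A - {a}. f a b) \<in> A \<rightarrow> carrier R"
    using insert by (auto intro!: insert.prems finsum_closed)
  have step: "(\<Oplus>b\<in>insert x A - {a}. f a b) = f a x \<oplus> (\<Oplus>b\<in>A - {a}. f a b)" if "a \<in> A" for a
  proof -
    have "insert x A - {a} = insert x (A - {a})" using that insert.hyps by auto
    moreover have "f a x \<in> carrier R" "f a \<in> A - {a} \<rightarrow> carrier R"
      using insert.prems(1)[of a] insert.hyps that by auto
    ultimately show ?thesis
      using insert.hyps by simp
  qed
  have "(\<Oplus>a\<in>insert x A. \<Oplus>b\<in>insert x A - {a}. f a b)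
      = (\<Oplus>b\<in>A. f x b) \<oplus> (\<Oplus>a\<in>A. \<Oplus>b\<in>insert x A - {a}. f a b)"
    using insert A step inner by (subst finsum_insert) (auto simp: Pi_def)
  also have "(\<Oplus>a\<in>A. \<Oplus>b\<in>insert x A - {a}. f a b) = (\<Oplus>a\<in>A. f a x \<oplus> (\<Oplus>b\<in>A - {a}. f a b))"
    using step A inner by (intro finsum_cong') (auto simp: Pi_def)
  also have "\<dots> = (\<Oplus>a\<in>A. f a x) \<oplus> (\<Oplus>a\<in>A. \<Oplus>b\<in>A - {a}. f a b)"
    by (rule finsum_addf[OF A(1) inner])
  also have "(\<Oplus>a\<in>A. \<Oplus>b\<in>A - {a}. f a b) = \<zero>"
    using insert by auto
  also have "(\<Oplus>b\<in>A. f x b) \<oplus> ((\<Oplus>a\<in>A. f a x) \<oplus> \<zero>) = (\<Oplus>a\<in>A. f x a \<oplus> f a x)"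
    using A by (simp add: finsum_addf)
  also have "\<dots> = \<zero>"
    using insert by (intro add.finprod_one_eqI) auto
  finally show ?case .
qed simp

end

lemma ring_add_hom_comp:
  assumes "ring_add_hom R S f" "ring_add_hom S T g"
  shows "ring_add_hom R T (\<lambda>x. g (f x))"
proof -
  interpret f: ring_add_hom R S f by fact
  interpret g: ring_add_hom S T g by fact
  show ?thesis by unfold_locales (auto simp: f.add g.add)
qed

section \<open>Signed edge maps, dots and the homotopy at single vertices\<close>

locale signed_diagram = link_diagram D
  for D :: "('v, 'e) diagram" +
  fixes ar :: "'v \<Rightarrow> bool" and \<epsilon> :: "'v set \<Rightarrow> 'v \<Rightarrow> int"
  assumes valid: "valid_sign_assignment D ar \<epsilon>"
begin

lemma eps: "\<lbrakk>\<alpha> \<subseteq> crossings D; c \<in> crossings D; c \<notin> \<alpha>\<rbrakk> \<Longrightarrow> \<epsilon> \<alpha> c \<in> {1, -1}"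
  using valid unfolding valid_sign_assignment_def by blast

lemma eps_face:
  assumes "b \<subseteq> crossings D" "c \<in> crossings D" "c' \<in> crossings D" "c \<noteq> c'" "c \<notin> b" "c' \<notin> b"
  shows "\<epsilon> b c * \<epsilon> (insert c b) c' * \<epsilon> b c' * \<epsilon> (insert c' b) c * face_sign D ar b c c' = -1"
    and "face_sign D ar b c c' \<in> {1, -1}"
    and "\<epsilon> b c * \<epsilon> (insert c b) c' * face_sign D ar b c c' = - (\<epsilon> b c' * \<epsilon> (insert c' b) c)"
proof -
  show *: "\<epsilon> b c * \<epsilon> (insert c b) c' * \<epsilon> b c' * \<epsilon> (insert c' b) c * face_sign D ar b c c' = -1"
    using valid assms unfolding valid_sign_assignment_def by blast
  have "\<epsilon> b c \<in> {1, -1}" "\<epsilon> (insert c b) c' \<in> {1, -1}" "\<epsilon> b c' \<in> {1, -1}" "\<epsilon> (insert c' b) c \<in> {1, -1}"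
    using assms by (intro eps; simp)+
  then show "face_sign D ar b c c' \<in> {1, -1}"
    "\<epsilon> b c * \<epsilon> (insert c b) c' * face_sign D ar b c c' = - (\<epsilon> b c' * \<epsilon> (insert c' b) c)"
    using * by auto
qed

lemma edge_map_hom:
  assumes c: "c \<in> crossings D" "c \<notin> \<alpha>"
  shows "ring_add_hom (K \<alpha>) (K (insert c \<alpha>)) (edge_map D ar \<alpha> c)"
proof unfold_locales
  fix x y assume x: "x \<in> carrier (K \<alpha>)"
  then show "edge_map D ar \<alpha> c x \<in> carrier (K (insert c \<alpha>))" by (rule edge_map_closed[OF c])
  assume y: "y \<in> carrier (K \<alpha>)"
  obtain v where v: "v \<in> carrier L" "x = proj \<alpha> v" using proj_surj[OF x] .
  obtain w where w: "w \<in> carrier L" "y = proj \<alpha> w" using proj_surj[OF y] .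
  show "edge_map D ar \<alpha> c (x \<oplus>\<^bsub>K \<alpha>\<^esub> y) = edge_map D ar \<alpha> c x \<oplus>\<^bsub>K (insert c \<alpha>)\<^esub> edge_map D ar \<alpha> c y"
    unfolding v(2) w(2) proj.hom_add[OF v(1) w(1), symmetric]
    using c v w by (simp add: edge_map_proj L.E.r_distr del: proj.hom_mult flip: proj.hom_add)
qed

lemma back_map_hom:
  assumes c: "c \<in> crossings D" "c \<notin> \<alpha>"
  shows "ring_add_hom (K (insert c \<alpha>)) (K \<alpha>) (back_map ar \<alpha> c)"
  by unfold_locales (use c in \<open>simp_all add: back_map_def K.E.r_distr\<close>)

text \<open>In contrast to \<open>edge_map\<close>, the first argument is the target of the edge of the cube.\<close>

definition sedge :: "'v set \<Rightarrow> 'v \<Rightarrow> 'e ext \<Rightarrow> 'e ext" where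
  "sedge \<beta> c x = [(\<epsilon> (\<beta> - {c}) c)] \<cdot>\<^bsub>K \<beta>\<^esub> edge_map D ar (\<beta> - {c}) c x"

lemma sedge_hom:
  assumes "c \<in> crossings D" "c \<in> \<beta>"
  shows "ring_add_hom (K (\<beta> - {c})) (K \<beta>) (sedge \<beta> c)"
proof -
  have "insert c (\<beta> - {c}) = \<beta>" using assms by auto
  then show ?thesis
    using ring_add_hom_comp[OF edge_map_hom[of c "\<beta> - {c}"] K.E.ring_add_hom_int_mult] assms
    by (simp add: sedge_def[abs_def])
qed

text \<open>The face relation contributes \<open>face_sign\<close>, and validity makes its product
  with the four edge signs -1, so the two terms are opposite.\<close>

lemma sedge_anticomm:
  assumes \<gamma>: "\<gamma> \<subseteq> crossings D" and c: "c \<in> \<gamma>" "c' \<in> \<gamma>" "c \<noteq> c'" and x: "x \<in> carrier (K (\<gamma> - {c} - {c'}))"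
  shows "sedge \<gamma> c (sedge (\<gamma> - {c}) c' x) \<oplus>\<^bsub>K \<gamma>\<^esub> sedge \<gamma> c' (sedge (\<gamma> - {c'}) c x) = \<zero>\<^bsub>K \<gamma>\<^esub>"
proof -
  define b where "b = \<gamma> - {c} - {c'}"
  have g: "\<gamma> - {c} = insert c' b" "\<gamma> - {c'} = insert c b" "\<gamma> = insert c' (insert c b)" "c \<notin> b" "c' \<notin> b"
    "insert c' b - {c'} = b" "insert c b - {c} = b" "insert c (insert c' b) = \<gamma>"
    using c by (auto simp: b_def)
  have cr: "c \<in> crossings D" "c' \<in> crossings D" "b \<subseteq> crossings D" using \<gamma> c b_def by auto
  note sides = cr(1,2) c(3) g(4,5)
  interpret E1: ring_add_hom "K b" "K (insert c b)" "edge_map D ar b c" by (rule edge_map_hom) (use sides in auto)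
  interpret E2: ring_add_hom "K b" "K (insert c' b)" "edge_map D ar b c'" by (rule edge_map_hom) (use sides in auto)
  interpret E3: ring_add_hom "K (insert c b)" "K \<gamma>" "edge_map D ar (insert c b) c'"
    unfolding g(3) by (rule edge_map_hom) (use sides in auto)
  interpret E4: ring_add_hom "K (insert c' b)" "K \<gamma>" "edge_map D ar (insert c' b) c"
    unfolding g(8)[symmetric] by (rule edge_map_hom) (use sides in auto)
  have xb: "x \<in> carrier (K b)" using x by (simp add: b_def)
  have 1: "sedge \<gamma> c' (sedge (\<gamma> - {c'}) c x) = [(\<epsilon> (insert c b) c' * \<epsilon> b c)] \<cdot>\<^bsub>K \<gamma>\<^esub> face_map D ar b c c' x"
    using xb by (simp add: sedge_def g(2,7) E3.int_mult K.E.int_mult_int_mult face_map_def)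
  have 2: "sedge \<gamma> c (sedge (\<gamma> - {c}) c' x) = [(\<epsilon> (insert c' b) c * \<epsilon> b c')] \<cdot>\<^bsub>K \<gamma>\<^esub> face_map D ar b c' c x"
    using xb by (simp add: sedge_def g(1,6) E4.int_mult K.E.int_mult_int_mult face_map_def)
  have F: "face_map D ar b c' c x \<in> carrier (K \<gamma>)" using xb by (simp add: face_map_def)
  have "face_map D ar b c c' x = [face_sign D ar b c c'] \<cdot>\<^bsub>K \<gamma>\<^esub> face_map D ar b c' c x"
    unfolding g(3) by (rule face_map_sign[OF sides eps_face(2)[OF cr(3) sides] xb])
  then have "sedge \<gamma> c' (sedge (\<gamma> - {c'}) c x) = [(\<epsilon> (insert c b) c' * \<epsilon> b c * face_sign D ar b c c')] \<cdot>\<^bsub>K \<gamma>\<^esub> face_map D ar b c' c x"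
    unfolding 1 using F by (simp add: K.E.int_mult_int_mult)
  moreover have "\<epsilon> (insert c' b) c * \<epsilon> b c' + \<epsilon> (insert c b) c' * \<epsilon> b c * face_sign D ar b c c' = 0"
    using eps_face(3)[OF cr(3) sides] by (simp add: mult.commute)
  ultimately show ?thesis
    unfolding 2 using F by (simp add: K.E.int_mult_plus K.E.int_mult_zero_left)
qed

definition dot_at :: "'v set \<Rightarrow> ('e \<Rightarrow>\<^sub>0 int) \<Rightarrow> 'e ext \<Rightarrow> 'e ext" where
  "dot_at \<alpha> m x = [((-1::int) ^ dot_exponent D \<alpha>)] \<cdot>\<^bsub>K \<alpha>\<^esub> (proj \<alpha> (L.gen m) \<otimes>\<^bsub>K \<alpha>\<^esub> x)"

lemma dot_at_hom:
  assumes "edge_chain m"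
  shows "ring_add_hom (K \<alpha>) (K \<alpha>) (dot_at \<alpha> m)"
  by unfold_locales (use assms in \<open>auto simp: dot_at_def K.E.r_distr K.E.int_mult_add\<close>)

lemma dot_exponent_remove:
  assumes "c \<in> \<beta>" "\<beta> \<subseteq> crossings D"
  shows "(-1::int) ^ dot_exponent D \<beta> = (if merges D (\<beta> - {c}) c then 1 else -1) * (-1) ^ dot_exponent D (\<beta> - {c})"
proof -
  have c: "c \<in> crossings D" "c \<notin> \<beta> - {c}" "\<beta> - {c} \<subseteq> crossings D" using assms by auto
  have "dot_exponent D \<beta> = dot_exponent D (\<beta> - {c}) + (if merges D (\<beta> - {c}) c then 0 else 1)"
    using dot_exponent_insert[OF c] insert_Diff[OF assms(1)] by simp
  then show ?thesis by simp
qed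

text \<open>
  The factor of a split anticommutes with the dot; the sign of the dotted cobordism compensates.
\<close>

lemma sedge_dot_at:
  assumes c: "c \<in> \<beta>" "\<beta> \<subseteq> crossings D" and m: "edge_chain m" and x: "x \<in> carrier (K (\<beta> - {c}))"
  shows "sedge \<beta> c (dot_at (\<beta> - {c}) m x) = dot_at \<beta> m (sedge \<beta> c x)"
proof -
  let ?a = "\<beta> - {c}"
  have c': "c \<in> crossings D" "c \<notin> ?a" and ins: "insert c ?a = \<beta>" using c by auto
  interpret E: ring_add_hom "K ?a" "K \<beta>" "edge_map D ar ?a c" using edge_map_hom[OF c'] ins by simp
  obtain y where y: "y \<in> carrier L" "x = proj ?a y" using proj_surj[OF x] .
  let ?u = "edge_factor ar ?a c" and ?s = "(if merges D ?a c then 1 else -1) :: int"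
  have comm: "?u \<odot> (L.gen m \<odot> y) = [?s] \<cdot>\<^bsub>L\<^esub> (L.gen m \<odot> (?u \<odot> y))"
  proof (cases "merges D ?a c")
    case True
    then show ?thesis using m y by (simp add: edge_factor_def L.E.add_pow_signs)
  next
    case False
    have "split_gen ar c \<odot> L.gen m = \<ominus>\<^bsub>L\<^esub> (L.gen m \<odot> split_gen ar c)"
      unfolding split_gen_def using m c' by (intro L.gen_anticomm) (auto simp: keys_sdiff strand_edge)
    then show ?thesis using False m y c'
      by (simp add: edge_factor_def L.E.add_pow_signs L.E.l_minus flip: L.E.m_assoc)
  qed
  interpret p: ring_add_hom L "K \<beta>" "proj \<beta>" by unfold_locales auto
  have "edge_map D ar ?a c (proj ?a (L.gen m) \<otimes>\<^bsub>K ?a\<^esub> x) = edge_map D ar ?a c (proj ?a (L.gen m \<odot> y))"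
    using m y by simp
  also have "\<dots> = proj \<beta> ([?s] \<cdot>\<^bsub>L\<^esub> (L.gen m \<odot> (?u \<odot> y)))"
    using edge_map_proj[OF c', of "L.gen m \<odot> y" ar] m y comm ins by simp
  also have "\<dots> = [?s] \<cdot>\<^bsub>K \<beta>\<^esub> (proj \<beta> (L.gen m) \<otimes>\<^bsub>K \<beta>\<^esub> proj \<beta> (?u \<odot> y))"
    using m y c' by (simp add: p.int_mult del: proj.hom_mult)
      (subst proj.hom_mult, simp_all)
  also have "proj \<beta> (?u \<odot> y) = edge_map D ar ?a c x"
    using edge_map_proj[OF c' y(1), of ar] y ins by simp
  finally have E: "edge_map D ar ?a c (proj ?a (L.gen m) \<otimes>\<^bsub>K ?a\<^esub> x)
    = [?s] \<cdot>\<^bsub>K \<beta>\<^esub> (proj \<beta> (L.gen m) \<otimes>\<^bsub>K \<beta>\<^esub> edge_map D ar ?a c x)" .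
  show ?thesis
    using m x dot_exponent_remove[OF c]
    by (simp add: sedge_def dot_at_def E.int_mult E K.E.int_mult_int_mult K.E.add_pow_rdistr_int mult.assoc mult.left_commute mult.commute)
qed

text \<open>On the diagonal \<epsilon> \<alpha> c cancels the sign of the edge that is undone, and
  the sign of the dotted cobordism remains. Off the diagonal, the change of the dot exponent along
  c' cancels the merge-or-split sign of \<open>back_map_edge_map\<close>.\<close>

definition homotopy_at :: "'v \<Rightarrow> 'v set \<Rightarrow> 'e ext \<Rightarrow> 'e ext" where
  "homotopy_at c \<alpha> x = [((-1) ^ dot_exponent D \<alpha> * \<epsilon> \<alpha> c)] \<cdot>\<^bsub>K \<alpha>\<^esub> back_map ar \<alpha> c x"

definition crossing_diff :: "'v \<Rightarrow> ('e \<Rightarrow>\<^sub>0 int)" where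
  "crossing_diff c = sdiff (ar c) (strand D c South) (strand D c North)"

lemma homotopy_at_hom:
  assumes "c \<in> crossings D" "c \<notin> \<alpha>"
  shows "ring_add_hom (K (insert c \<alpha>)) (K \<alpha>) (homotopy_at c \<alpha>)"
  unfolding homotopy_at_def[abs_def]
  by (rule ring_add_hom_comp[OF back_map_hom[OF assms] K.E.ring_add_hom_int_mult])

text \<open>Of the two multipliers one is 1 and the other is \<open>split_gen\<close> or
  \<open>back_gen\<close>; these agree in \<alpha>, where W is joined to S and E to N.\<close>

lemma homotopy_diagonal0:
  assumes c: "c \<in> crossings D" "c \<notin> \<alpha>" and \<alpha>: "\<alpha> \<subseteq> crossings D" and x: "x \<in> carrier (K \<alpha>)"
  shows "homotopy_at c \<alpha> (sedge (insert c \<alpha>) c x) = dot_at \<alpha> (crossing_diff c) x"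
proof -
  interpret B: ring_add_hom "K (insert c \<alpha>)" "K \<alpha>" "back_map ar \<alpha> c" by (rule back_map_hom[OF c])
  interpret E: ring_add_hom "K \<alpha>" "K (insert c \<alpha>)" "edge_map D ar \<alpha> c" by (rule edge_map_hom[OF c])
  have ins: "insert c \<alpha> - {c} = \<alpha>" using c by auto
  obtain y where y: "y \<in> carrier L" "x = proj \<alpha> y" using proj_surj[OF x] .
  have "proj \<alpha> (split_gen ar c) = proj \<alpha> (back_gen ar c)"
    using circle_of_partner0[OF c] c by (simp add: proj_split_gen)
  then have "back_map ar \<alpha> c (edge_map D ar \<alpha> c x) = proj \<alpha> (back_gen ar c) \<otimes>\<^bsub>K \<alpha>\<^esub> x"
    unfolding y(2) using c y edge_map_proj[OF c y(1), of ar] back_map_proj[OF c, of "edge_factor ar \<alpha> c \<odot> y" ar]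
    by (simp add: edge_factor_def back_factor_def split: if_splits)
  moreover have "\<epsilon> \<alpha> c * \<epsilon> \<alpha> c = 1" using eps[OF \<alpha> c] by auto
  ultimately show ?thesis
    using x c by (simp add: homotopy_at_def sedge_def ins B.int_mult K.E.int_mult_int_mult dot_at_def mult.assoc
        crossing_diff_def flip: back_gen_def)
qed

text \<open>In the 1-resolution \<open>split_gen\<close> is minus \<open>back_gen\<close>. This sign
  occurs only if c splits a circle, and that is when the dot exponent jumps.\<close>

lemma homotopy_diagonal1:
  assumes c: "c \<in> \<alpha>" and \<alpha>: "\<alpha> \<subseteq> crossings D" and x: "x \<in> carrier (K \<alpha>)"
  shows "sedge \<alpha> c (homotopy_at c (\<alpha> - {c}) x) = dot_at \<alpha> (crossing_diff c) x"
proof -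
  let ?b = "\<alpha> - {c}"
  have c': "c \<in> crossings D" "c \<notin> ?b" and b: "?b \<subseteq> crossings D" and ins: "insert c ?b = \<alpha>" using c \<alpha> by auto
  interpret B: ring_add_hom "K \<alpha>" "K ?b" "back_map ar ?b c" using back_map_hom[OF c'] ins by simp
  interpret E: ring_add_hom "K ?b" "K \<alpha>" "edge_map D ar ?b c" using edge_map_hom[OF c'] ins by simp
  obtain y where y: "y \<in> carrier L" "x = proj \<alpha> y" using proj_surj[OF x] .
  have "sdiff (ar c) (end_circle \<alpha> c West) (end_circle \<alpha> c East)
     = - sdiff (ar c) (end_circle \<alpha> c South) (end_circle \<alpha> c North)"
    using circle_of_partner1[OF c'(1) c] by (simp flip: sdiff_swap)
  then have g: "proj \<alpha> (split_gen ar c) = \<ominus>\<^bsub>K \<alpha>\<^esub> proj \<alpha> (back_gen ar c)"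
    using c' by (simp add: proj_split_gen K_gen_minus keys_sdiff_circles)
  have "edge_map D ar ?b c (back_map ar ?b c x) = proj \<alpha> (edge_factor ar ?b c \<odot> (back_factor ar ?b c \<odot> y))"
    unfolding y(2) using c' y edge_map_proj[OF c', of "back_factor ar ?b c \<odot> y" ar] back_map_proj[OF c' y(1), of ar] ins by simp
  also have "\<dots> = [((if merges D ?b c then 1 else -1) :: int)] \<cdot>\<^bsub>K \<alpha>\<^esub> (proj \<alpha> (back_gen ar c) \<otimes>\<^bsub>K \<alpha>\<^esub> x)"
    unfolding y(2) using c' y g by (simp add: edge_factor_def back_factor_def K.E.add_pow_signs K.E.l_minus)
  finally have EB: "edge_map D ar ?b c (back_map ar ?b c x) = [((if merges D ?b c then 1 else -1) :: int)] \<cdot>\<^bsub>K \<alpha>\<^esub> (proj \<alpha> (back_gen ar c) \<otimes>\<^bsub>K \<alpha>\<^esub> x)" .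
  have coef: "\<epsilon> ?b c * ((-1) ^ dot_exponent D ?b * \<epsilon> ?b c) * (if merges D ?b c then 1 else -1) = (-1::int) ^ dot_exponent D \<alpha>"
    using eps[OF b c'] dot_exponent_remove[OF c \<alpha>] by auto
  have "sedge \<alpha> c (homotopy_at c ?b x)
     = [(\<epsilon> ?b c * ((-1) ^ dot_exponent D ?b * \<epsilon> ?b c) * (if merges D ?b c then 1 else -1))] \<cdot>\<^bsub>K \<alpha>\<^esub> (proj \<alpha> (back_gen ar c) \<otimes>\<^bsub>K \<alpha>\<^esub> x)"
    using x c' by (simp add: homotopy_at_def sedge_def E.int_mult EB K.E.int_mult_int_mult)
  then show ?thesis
    unfolding coef by (simp add: dot_at_def crossing_diff_def back_gen_def)
qed

text \<open>Once the dot exponents are compared, what is left is the product of four edge signs and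
  the face sign, which is -1.\<close>

lemma homotopy_off_diagonal:
  assumes \<alpha>: "\<alpha> \<subseteq> crossings D" and c: "c \<in> crossings D" "c \<notin> \<alpha>" and c': "c' \<in> \<alpha>"
    and x: "x \<in> carrier (K (insert c \<alpha> - {c'}))"
  shows "sedge \<alpha> c' (homotopy_at c (\<alpha> - {c'}) x) \<oplus>\<^bsub>K \<alpha>\<^esub> homotopy_at c \<alpha> (sedge (insert c \<alpha>) c' x) = \<zero>\<^bsub>K \<alpha>\<^esub>"
proof -
  define b where "b = \<alpha> - {c'}"
  have g: "\<alpha> = insert c' b" "insert c \<alpha> - {c'} = insert c b" "insert c \<alpha> = insert c' (insert c b)" "c \<notin> b" "c' \<notin> b"
    using c c' by (auto simp: b_def)
  have cr: "c' \<in> crossings D" "c \<noteq> c'" "b \<subseteq> crossings D" using \<alpha> c c' b_def by auto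
  note sides = c(1) cr(1,2) g(4,5)
  have xb: "x \<in> carrier (K (insert c b))" using x by (simp add: g(2))
  interpret E1: ring_add_hom "K b" "K \<alpha>" "edge_map D ar b c'"
    unfolding g(1) by (rule edge_map_hom) (use sides in auto)
  interpret E2: ring_add_hom "K (insert c b)" "K (insert c \<alpha>)" "edge_map D ar (insert c b) c'"
    unfolding g(3) by (rule edge_map_hom) (use sides in auto)
  interpret B1: ring_add_hom "K (insert c b)" "K b" "back_map ar b c" by (rule back_map_hom) (use sides in auto)
  interpret B2: ring_add_hom "K (insert c \<alpha>)" "K \<alpha>" "back_map ar \<alpha> c" by (rule back_map_hom) (use c in auto)
  let ?\<sigma> = "(if merges D b c' then 1 else -1) :: int" and ?f = "face_sign D ar b c c'"
  let ?z = "edge_map D ar b c' (back_map ar b c x)"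
  have z: "?z \<in> carrier (K \<alpha>)" using xb by simp
  have 1: "sedge \<alpha> c' (homotopy_at c (\<alpha> - {c'}) x) = [(\<epsilon> b c' * ((-1) ^ dot_exponent D b * \<epsilon> b c))] \<cdot>\<^bsub>K \<alpha>\<^esub> ?z"
    using xb by (simp add: sedge_def homotopy_at_def E1.int_mult K.E.int_mult_int_mult flip: b_def)
  have "back_map ar \<alpha> c (edge_map D ar (insert c b) c' x) = [(?\<sigma> * ?f)] \<cdot>\<^bsub>K \<alpha>\<^esub> ?z"
    using back_map_edge_map[OF sides eps_face(2)[OF cr(3) sides] xb] unfolding g(1) .
  then have "homotopy_at c \<alpha> (sedge (insert c \<alpha>) c' x)
      = [((-1) ^ dot_exponent D \<alpha> * \<epsilon> \<alpha> c * (\<epsilon> (insert c b) c' * (?\<sigma> * ?f)))] \<cdot>\<^bsub>K \<alpha>\<^esub> ?z"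
    using xb z by (simp add: sedge_def homotopy_at_def g(2) B2.int_mult K.E.int_mult_int_mult)
  moreover have "(-1) ^ dot_exponent D \<alpha> * \<epsilon> \<alpha> c * (\<epsilon> (insert c b) c' * (?\<sigma> * ?f)) = - (\<epsilon> b c' * ((-1) ^ dot_exponent D b * \<epsilon> b c))"
  proof -
    have S: "(-1::int) ^ dot_exponent D \<alpha> = ?\<sigma> * (-1) ^ dot_exponent D b"
      using dot_exponent_remove[OF c' \<alpha>] by (simp add: b_def)
    have e: "\<epsilon> b c \<in> {1, -1}" "\<epsilon> (insert c b) c' \<in> {1, -1}" "\<epsilon> b c' \<in> {1, -1}" "\<epsilon> \<alpha> c \<in> {1, -1}"
      using cr sides \<alpha> c by (intro eps; simp)+
    note e = e eps_face(2)[OF cr(3) sides]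
    have k: "\<epsilon> \<alpha> c * \<epsilon> (insert c b) c' * ?f = - (\<epsilon> b c' * \<epsilon> b c)"
      using eps_face(1)[OF cr(3) sides] e unfolding g(1)[symmetric] by auto
    have s: "?\<sigma> * ?\<sigma> = 1" by simp
    have "(-1) ^ dot_exponent D \<alpha> * \<epsilon> \<alpha> c * (\<epsilon> (insert c b) c' * (?\<sigma> * ?f))
      = (?\<sigma> * ?\<sigma>) * (-1) ^ dot_exponent D b * (\<epsilon> \<alpha> c * \<epsilon> (insert c b) c' * ?f)"
      unfolding S by (simp only: ac_simps)
    then show ?thesis unfolding s k by (simp add: ac_simps)
  qed
  ultimately show ?thesis
    unfolding 1 using z by (simp add: K.E.int_mult_plus K.E.int_mult_zero_left del: minus_add_distrib)
qed

end

section \<open>Endomorphisms of subquotients\<close>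

text \<open>The functions are extensional, so that ring laws checked on the carrier hold as
  equations between functions.\<close>

definition end_ring :: "('a, 'm) monoid_scheme \<Rightarrow> ('a \<Rightarrow> 'a) ring" where
  "end_ring M = \<lparr>carrier = hom M M \<inter> extensional (carrier M),
     monoid.mult = (\<lambda>f g. \<lambda>x \<in> carrier M. f (g x)),
     one = (\<lambda>x \<in> carrier M. x), zero = (\<lambda>x \<in> carrier M. \<one>\<^bsub>M\<^esub>),
     add = (\<lambda>f g. \<lambda>x \<in> carrier M. f x \<otimes>\<^bsub>M\<^esub> g x)\<rparr>"

section \<open>The endomorphism ring, and homomorphisms out of a quotient\<close>

context comm_group
begin

lemma end_closed: "\<lbrakk>f \<in> carrier (end_ring G); x \<in> carrier G\<rbrakk> \<Longrightarrow> f x \<in> carrier G"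
  by (auto simp: end_ring_def hom_def)

lemma end_mult: "\<lbrakk>f \<in> carrier (end_ring G); x \<in> carrier G; y \<in> carrier G\<rbrakk> \<Longrightarrow> f (x \<otimes> y) = f x \<otimes> f y"
  by (auto simp: end_ring_def hom_def)

lemma end_eqI:
  assumes "f \<in> carrier (end_ring G)" "g \<in> carrier (end_ring G)" "\<And>x. x \<in> carrier G \<Longrightarrow> f x = g x"
  shows "f = g"
  using assms by (auto simp: end_ring_def intro: extensionalityI)

lemma end_restrictI:
  assumes "\<And>x. x \<in> carrier G \<Longrightarrow> f x \<in> carrier G"
    "\<And>x y. \<lbrakk>x \<in> carrier G; y \<in> carrier G\<rbrakk> \<Longrightarrow> f (x \<otimes> y) = f x \<otimes> f y"
  shows "restrict f (carrier G) \<in> carrier (end_ring G)"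
  using assms by (auto simp: end_ring_def hom_def)

lemma end_ring_simps:
  "f \<otimes>\<^bsub>end_ring G\<^esub> g = (\<lambda>x \<in> carrier G. f (g x))" "\<one>\<^bsub>end_ring G\<^esub> = (\<lambda>x \<in> carrier G. x)"
  "\<zero>\<^bsub>end_ring G\<^esub> = (\<lambda>x \<in> carrier G. \<one>)" "f \<oplus>\<^bsub>end_ring G\<^esub> g = (\<lambda>x \<in> carrier G. f x \<otimes> g x)"
  by (simp_all add: end_ring_def)

lemma ring_end_ring: "ring (end_ring G)"
proof -
  have add: "f \<oplus>\<^bsub>end_ring G\<^esub> g \<in> carrier (end_ring G)"
    if "f \<in> carrier (end_ring G)" "g \<in> carrier (end_ring G)" for f g
    unfolding end_ring_simps using that by (intro end_restrictI) (auto simp: end_closed end_mult m_ac)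
  have mult: "f \<otimes>\<^bsub>end_ring G\<^esub> g \<in> carrier (end_ring G)"
    if "f \<in> carrier (end_ring G)" "g \<in> carrier (end_ring G)" for f g
    unfolding end_ring_simps using that by (intro end_restrictI) (auto simp: end_closed end_mult)
  have one: "\<one>\<^bsub>end_ring G\<^esub> \<in> carrier (end_ring G)" and zero: "\<zero>\<^bsub>end_ring G\<^esub> \<in> carrier (end_ring G)"
    unfolding end_ring_simps by (intro end_restrictI; simp)+
  have inv: "restrict (\<lambda>x. inv (f x)) (carrier G) \<in> carrier (end_ring G)" if "f \<in> carrier (end_ring G)" for f
    using that by (intro end_restrictI) (auto simp: end_closed end_mult inv_mult)
  show ?thesis
  proof (rule ringI)
    show "abelian_group (end_ring G)"
    proof (rule abelian_groupI)
      fix f assume f: "f \<in> carrier (end_ring G)"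
      show "\<exists>g\<in>carrier (end_ring G). g \<oplus>\<^bsub>end_ring G\<^esub> f = \<zero>\<^bsub>end_ring G\<^esub>"
        by (rule bexI[OF _ inv[OF f]], rule end_eqI[OF add[OF inv[OF f] f] zero])
          (use f in \<open>simp add: end_ring_simps end_closed\<close>)
      show "\<zero>\<^bsub>end_ring G\<^esub> \<oplus>\<^bsub>end_ring G\<^esub> f = f"
        by (rule end_eqI[OF add[OF zero f] f]) (use f in \<open>simp add: end_ring_simps end_closed\<close>)
      fix g assume g: "g \<in> carrier (end_ring G)"
      show "f \<oplus>\<^bsub>end_ring G\<^esub> g = g \<oplus>\<^bsub>end_ring G\<^esub> f"
        by (rule end_eqI[OF add[OF f g] add[OF g f]]) (use f g in \<open>simp add: end_ring_simps end_closed m_comm\<close>)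
      fix h assume h: "h \<in> carrier (end_ring G)"
      show "f \<oplus>\<^bsub>end_ring G\<^esub> g \<oplus>\<^bsub>end_ring G\<^esub> h = f \<oplus>\<^bsub>end_ring G\<^esub> (g \<oplus>\<^bsub>end_ring G\<^esub> h)"
        by (rule end_eqI[OF add[OF add[OF f g] h] add[OF f add[OF g h]]])
          (use f g h in \<open>simp add: end_ring_simps end_closed m_assoc\<close>)
    qed (use add zero in auto)
    show "Group.monoid (end_ring G)"
    proof (rule monoidI)
      fix f assume f: "f \<in> carrier (end_ring G)"
      show "\<one>\<^bsub>end_ring G\<^esub> \<otimes>\<^bsub>end_ring G\<^esub> f = f"
        by (rule end_eqI[OF mult[OF one f] f]) (use f in \<open>simp add: end_ring_simps end_closed\<close>)
      show "f \<otimes>\<^bsub>end_ring G\<^esub> \<one>\<^bsub>end_ring G\<^esub> = f"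
        by (rule end_eqI[OF mult[OF f one] f]) (use f in \<open>simp add: end_ring_simps end_closed\<close>)
      fix g h assume g: "g \<in> carrier (end_ring G)" and h: "h \<in> carrier (end_ring G)"
      show "f \<otimes>\<^bsub>end_ring G\<^esub> g \<otimes>\<^bsub>end_ring G\<^esub> h = f \<otimes>\<^bsub>end_ring G\<^esub> (g \<otimes>\<^bsub>end_ring G\<^esub> h)"
        by (rule end_eqI[OF mult[OF mult[OF f g] h] mult[OF f mult[OF g h]]])
          (use f g h in \<open>simp add: end_ring_simps end_closed\<close>)
    qed (use mult one in auto)
    fix f g h assume f: "f \<in> carrier (end_ring G)" and g: "g \<in> carrier (end_ring G)" and h: "h \<in> carrier (end_ring G)"
    show "(f \<oplus>\<^bsub>end_ring G\<^esub> g) \<otimes>\<^bsub>end_ring G\<^esub> h = f \<otimes>\<^bsub>end_ring G\<^esub> h \<oplus>\<^bsub>end_ring G\<^esub> g \<otimes>\<^bsub>end_ring G\<^esub> h"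
      by (rule end_eqI[OF mult[OF add[OF f g] h] add[OF mult[OF f h] mult[OF g h]]])
        (use f g h in \<open>simp add: end_ring_simps end_closed\<close>)
    show "h \<otimes>\<^bsub>end_ring G\<^esub> (f \<oplus>\<^bsub>end_ring G\<^esub> g) = h \<otimes>\<^bsub>end_ring G\<^esub> f \<oplus>\<^bsub>end_ring G\<^esub> h \<otimes>\<^bsub>end_ring G\<^esub> g"
      by (rule end_eqI[OF mult[OF h add[OF f g]] add[OF mult[OF h f] mult[OF h g]]])
        (use f g h in \<open>simp add: end_ring_simps end_closed end_mult\<close>)
  qed
qed

lemma hom_factors_generate:
  assumes H: "group H" and h: "h \<in> hom G H" and S: "S \<subseteq> carrier G" and kill: "\<And>s. s \<in> S \<Longrightarrow> h s = \<one>\<^bsub>H\<^esub>"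
  obtains g where "g \<in> hom (G Mod generate G S) H" "\<And>x. x \<in> carrier G \<Longrightarrow> g (generate G S #> x) = h x"
proof -
  interpret h: group_hom G H h
    using H h by (simp add: group_hom_def group_hom_axioms_def is_group)
  let ?N = "generate G S"
  have sub: "subgroup ?N G" by (rule generate_is_subgroup[OF S])
  then have norm: "?N \<lhd> G" by (rule subgroup_imp_normal)
  have "?N \<subseteq> kernel G H h"
    using generate_subgroup_incl[OF _ h.subgroup_kernel, of S] S kill by (auto simp: kernel_def)
  then have ker: "h n = \<one>\<^bsub>H\<^esub>" if "n \<in> ?N" for n using that by (auto simp: kernel_def)
  have eq: "h x = h y" if "x \<in> carrier G" "y \<in> carrier G" "?N #> x = ?N #> y" for x y
  proof -
    have "x \<in> ?N #> y" using rcos_self[OF that(1) sub] that(3) by simp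
    then obtain n where "n \<in> ?N" "x = n \<otimes> y" by (auto simp: r_coset_def)
    then show ?thesis using ker that(2) subgroup.mem_carrier[OF sub] by simp
  qed
  obtain g where "g \<in> hom (G Mod ?N) H" "\<And>x. x \<in> carrier G \<Longrightarrow> g (?N #> x) = h x"
    using FactGroup_universal[OF h norm eq] by blast
  then show ?thesis using that by blast
qed

end

section \<open>Maps induced on a subquotient\<close>

locale subquotient = comm_group C for C :: "('a, 'm) monoid_scheme" (structure) +
  fixes Z B
  assumes Z: "subgroup Z C" and B: "subgroup B C" and BZ: "B \<subseteq> Z"
begin

abbreviation "H \<equiv> subgroup_generated C Z Mod B"

lemma Z_carrier: "x \<in> Z \<Longrightarrow> x \<in> carrier C"
  by (rule subgroup.mem_carrier[OF Z])

lemma comm_group_H: "comm_group H"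
proof -
  interpret S: comm_group "subgroup_generated C Z"
    by (rule abelian_subgroup_generated) (rule comm_group_axioms)
  have "subgroup B (subgroup_generated C Z)"
    using B BZ Z by (simp add: subgroup_subgroup_generated_iff subgroup.carrier_subgroup_generated_subgroup)
  then show ?thesis by (rule S.abelian_FactGroup)
qed

lemma carrier_H: "carrier H = (\<lambda>x. B #> x) ` Z"
  by (simp add: carrier_FactGroup subgroup.carrier_subgroup_generated_subgroup[OF Z] r_coset_def)

lemma coset_mult: "\<lbrakk>x \<in> Z; y \<in> Z\<rbrakk> \<Longrightarrow> (B #> x) \<otimes>\<^bsub>H\<^esub> (B #> y) = B #> (x \<otimes> y)"
proof -
  assume xy: "x \<in> Z" "y \<in> Z"
  have "B \<lhd> C" by (rule subgroup_imp_normal[OF B])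
  then have "(B #> x) <#> (B #> y) = B #> (x \<otimes> y)"
    using xy Z_carrier by (simp add: normal.rcos_sum)
  then show ?thesis by (simp add: set_mult_def)
qed

lemma coset_eq:
  assumes "x \<in> Z" "y \<in> Z" "b \<in> B" "x = b \<otimes> y"
  shows "B #> x = B #> y"
  using assms repr_independence[of x B y] B Z_carrier by (auto simp: r_coset_def)

text \<open>The representative does not matter as soon as f preserves Z and B
  (\<open>induced_coset\<close>). The restriction to the carrier is what membership in
  \<open>end_ring\<close> demands.\<close>

definition induced :: "('a \<Rightarrow> 'a) \<Rightarrow> 'a set \<Rightarrow> 'a set" where
  "induced f = (\<lambda>X \<in> carrier H. B #> f (SOME x. x \<in> Z \<and> X = B #> x))"

lemma induced_coset:
  assumes f: "f \<in> hom C C" "f ` Z \<subseteq> Z" "f ` B \<subseteq> B" and x: "x \<in> Z"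
  shows "induced f (B #> x) = B #> f x"
proof -
  define y where "y = (SOME y. y \<in> Z \<and> B #> x = B #> y)"
  have y: "y \<in> Z" "B #> x = B #> y"
    using someI[of "\<lambda>y. y \<in> Z \<and> B #> x = B #> y" x] x by (auto simp: y_def)
  have "y \<in> B #> x" using rcos_self[OF Z_carrier[OF y(1)] B] y(2) by simp
  then obtain b where b: "b \<in> B" "y = b \<otimes> x" by (auto simp: r_coset_def)
  have "f y = f b \<otimes> f x"
    unfolding b(2) using hom_mult[OF f(1)] b(1) B x Z_carrier subgroup.mem_carrier by metis
  then have "B #> f y = B #> f x"
    using f x y(1) b(1) by (intro coset_eq[of _ _ "f b"]) auto
  then show ?thesis
    using x by (simp add: induced_def carrier_H y_def)
qed

lemma induced_end:
  assumes f: "f \<in> hom C C" "f ` Z \<subseteq> Z" "f ` B \<subseteq> B"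
  shows "induced f \<in> carrier (end_ring H)"
proof -
  interpret Q: comm_group H by (rule comm_group_H)
  have "restrict (induced f) (carrier H) \<in> carrier (end_ring H)"
  proof (rule Q.end_restrictI)
    fix X assume "X \<in> carrier H"
    then obtain x where x: "x \<in> Z" "X = B #> x" by (auto simp: carrier_H)
    then show "induced f X \<in> carrier H" using f by (auto simp: induced_coset carrier_H)
    fix Y assume "Y \<in> carrier H"
    then obtain y where y: "y \<in> Z" "Y = B #> y" by (auto simp: carrier_H)
    have "x \<otimes> y \<in> Z" using x y Z by (simp add: subgroup.m_closed)
    moreover have "f (x \<otimes> y) = f x \<otimes> f y" using hom_mult[OF f(1)] x y Z_carrier by blast
    moreover have "f x \<in> Z" "f y \<in> Z" using f x y by auto
    ultimately show "induced f (X \<otimes>\<^bsub>H\<^esub> Y) = induced f X \<otimes>\<^bsub>H\<^esub> induced f Y"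
      unfolding x(2) y(2) by (simp only: coset_mult x y induced_coset[OF f])
  qed
  moreover have "restrict (induced f) (carrier H) = induced f"
    by (rule ext) (simp add: induced_def)
  ultimately show ?thesis by simp
qed

end

section \<open>The action on homology\<close>

context signed_diagram
begin

abbreviation "Ch \<equiv> chain_group D"
abbreviation "V \<equiv> vertices D"
abbreviation "\<delta> \<equiv> differential D ar \<epsilon>"

lemma chain_simps:
  "carrier (Ch i) = (\<Pi>\<^sub>E \<alpha>\<in>V i. carrier (K \<alpha>))"
  "x \<otimes>\<^bsub>Ch i\<^esub> y = (\<lambda>\<alpha>\<in>V i. x \<alpha> \<oplus>\<^bsub>K \<alpha>\<^esub> y \<alpha>)"
  "\<one>\<^bsub>Ch i\<^esub> = (\<lambda>\<alpha>\<in>V i. \<zero>\<^bsub>K \<alpha>\<^esub>)"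
  by (simp_all add: chain_group_def circle_alg_def)

lemma chain_at: "\<lbrakk>x \<in> carrier (Ch i); \<alpha> \<in> V i\<rbrakk> \<Longrightarrow> x \<alpha> \<in> carrier (K \<alpha>)"
  by (auto simp: chain_simps)

lemma chain_eqI:
  "\<lbrakk>x \<in> carrier (Ch i); y \<in> carrier (Ch i); \<And>\<alpha>. \<alpha> \<in> V i \<Longrightarrow> x \<alpha> = y \<alpha>\<rbrakk> \<Longrightarrow> x = y"
  unfolding chain_simps by (rule PiE_ext)

lemma comm_group_chain: "comm_group (Ch i)"
proof -
  interpret group "Ch i"
    unfolding chain_group_def circle_alg_def by (rule product_group) (rule K.E.a_group)
  show ?thesis
  proof (rule group_comm_groupI)
    fix x y assume "x \<in> carrier (Ch i)" "y \<in> carrier (Ch i)"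
    then show "x \<otimes>\<^bsub>Ch i\<^esub> y = y \<otimes>\<^bsub>Ch i\<^esub> x"
      by (intro chain_eqI[OF m_closed m_closed]) (auto simp: chain_simps(2) chain_at K.E.a_comm)
  qed
qed

sublocale C: comm_group "Ch i" for i by (rule comm_group_chain)

lemma V_subset: "\<alpha> \<in> V i \<Longrightarrow> \<alpha> \<subseteq> crossings D"
  by (simp add: vertices_def)

lemma V_finite: "\<alpha> \<in> V i \<Longrightarrow> finite \<alpha>"
  using V_subset finite_crossings finite_subset by blast

lemma V_remove: "\<lbrakk>\<alpha> \<in> V i; c \<in> \<alpha>\<rbrakk> \<Longrightarrow> \<alpha> - {c} \<in> V (i - 1)"
  using V_finite[of \<alpha> i] card_gt_0_iff[of \<alpha>] by (auto simp: vertices_def)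

lemma V_insert: "\<lbrakk>\<alpha> \<in> V i; c \<in> crossings D; c \<notin> \<alpha>\<rbrakk> \<Longrightarrow> insert c \<alpha> \<in> V (i + 1)"
  using V_finite[of \<alpha> i] by (auto simp: vertices_def)

lemma differential_at:
  "\<beta> \<in> V (i + 1) \<Longrightarrow> \<delta> i x \<beta> = (\<Oplus>\<^bsub>K \<beta>\<^esub>c\<in>\<beta>. sedge \<beta> c (x (\<beta> - {c})))"
  by (simp add: differential_def sedge_def circle_alg_def)

lemma sedge_closed:
  assumes "\<beta> \<subseteq> crossings D" "c \<in> \<beta>" "z \<in> carrier (K (\<beta> - {c}))"
  shows "sedge \<beta> c z \<in> carrier (K \<beta>)"
  using ring_add_hom.closed[OF sedge_hom[of c \<beta>] assms(3)] assms by blast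

lemma sedge_chain_closed:
  assumes "x \<in> carrier (Ch i)" "\<beta> \<in> V (i + 1)"
  shows "(\<lambda>c. sedge \<beta> c (x (\<beta> - {c}))) \<in> \<beta> \<rightarrow> carrier (K \<beta>)"
  using assms V_remove[of \<beta> "i + 1"] V_subset[of \<beta>] chain_at[of x i] by (auto intro!: sedge_closed)

lemma differential_closed: "x \<in> carrier (Ch i) \<Longrightarrow> \<delta> i x \<in> carrier (Ch (i + 1))"
  unfolding chain_simps(1)[of "i + 1"]
proof (rule PiE_I)
  fix \<beta> assume x: "x \<in> carrier (Ch i)" and \<beta>: "\<beta> \<in> V (i + 1)"
  show "\<delta> i x \<beta> \<in> carrier (K \<beta>)"
    unfolding differential_at[OF \<beta>] by (rule K.E.finsum_closed[OF sedge_chain_closed[OF x \<beta>]])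
qed (simp add: differential_def)

lemma differential_hom: "\<delta> i \<in> hom (Ch i) (Ch (i + 1))"
proof (rule homI)
  fix x y assume x: "x \<in> carrier (Ch i)" and y: "y \<in> carrier (Ch i)"
  show "\<delta> i (x \<otimes>\<^bsub>Ch i\<^esub> y) = \<delta> i x \<otimes>\<^bsub>Ch (i + 1)\<^esub> \<delta> i y"
  proof (rule chain_eqI)
    fix \<beta> assume \<beta>: "\<beta> \<in> V (i + 1)"
    have "sedge \<beta> c ((x \<otimes>\<^bsub>Ch i\<^esub> y) (\<beta> - {c})) = sedge \<beta> c (x (\<beta> - {c})) \<oplus>\<^bsub>K \<beta>\<^esub> sedge \<beta> c (y (\<beta> - {c}))"
      if c: "c \<in> \<beta>" for c
    proof -
      have v: "\<beta> - {c} \<in> V i" using V_remove[OF \<beta> c] by simp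
      have "ring_add_hom (K (\<beta> - {c})) (K \<beta>) (sedge \<beta> c)" using sedge_hom V_subset[OF \<beta>] c by blast
      from ring_add_hom.add[OF this chain_at[OF x v] chain_at[OF y v]] show ?thesis
        using v by (simp add: chain_simps(2))
    qed
    then have "\<delta> i (x \<otimes>\<^bsub>Ch i\<^esub> y) \<beta> = (\<Oplus>\<^bsub>K \<beta>\<^esub>c\<in>\<beta>. sedge \<beta> c (x (\<beta> - {c})) \<oplus>\<^bsub>K \<beta>\<^esub> sedge \<beta> c (y (\<beta> - {c})))"
      unfolding differential_at[OF \<beta>] using sedge_chain_closed[OF x \<beta>] sedge_chain_closed[OF y \<beta>]
      by (intro K.E.finsum_cong') (auto simp: Pi_def)
    then show "\<delta> i (x \<otimes>\<^bsub>Ch i\<^esub> y) \<beta> = (\<delta> i x \<otimes>\<^bsub>Ch (i + 1)\<^esub> \<delta> i y) \<beta>"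
      using \<beta> K.E.finsum_addf[OF sedge_chain_closed[OF x \<beta>] sedge_chain_closed[OF y \<beta>]]
      by (simp add: chain_simps(2) differential_at)
  qed (use x y in \<open>auto intro!: differential_closed\<close>)
qed (rule differential_closed)

text \<open>At \<gamma> this is a double sum over ordered pairs of distinct crossings of \<gamma>,
  and exchanging the two crossings changes the sign of the term.\<close>

lemma differential_differential:
  assumes x: "x \<in> carrier (Ch i)"
  shows "\<delta> (i + 1) (\<delta> i x) = \<one>\<^bsub>Ch (i + 1 + 1)\<^esub>"
proof (rule chain_eqI)
  fix \<gamma> assume \<gamma>: "\<gamma> \<in> V (i + 1 + 1)"
  have sub: "\<gamma> \<subseteq> crossings D" using V_subset[OF \<gamma>] .
  have xc: "x (\<gamma> - {c} - {c'}) \<in> carrier (K (\<gamma> - {c} - {c'}))" if "c \<in> \<gamma>" "c' \<in> \<gamma>" "c \<noteq> c'" for c c'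
    using V_remove[OF V_remove[OF \<gamma> that(1)], of c'] that chain_at[OF x] by simp
  have "sedge \<gamma> c (\<delta> i x (\<gamma> - {c})) = (\<Oplus>\<^bsub>K \<gamma>\<^esub>c'\<in>\<gamma> - {c}. sedge \<gamma> c (sedge (\<gamma> - {c}) c' (x (\<gamma> - {c} - {c'}))))"
    if c: "c \<in> \<gamma>" for c
  proof -
    have v: "\<gamma> - {c} \<in> V (i + 1)" using V_remove[OF \<gamma> c] by (simp add: add.commute)
    have h: "ring_add_hom (K (\<gamma> - {c})) (K \<gamma>) (sedge \<gamma> c)" using sedge_hom sub c by blast
    show ?thesis
      unfolding differential_at[OF v] using V_finite[OF v] sedge_chain_closed[OF x v] by (rule ring_add_hom.finsum[OF h])
  qed
  moreover have cl: "sedge \<gamma> c (sedge (\<gamma> - {c}) c' (x (\<gamma> - {c} - {c'}))) \<in> carrier (K \<gamma>)"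
    if "c \<in> \<gamma>" "c' \<in> \<gamma>" "c \<noteq> c'" for c c'
    using that sub xc by (intro sedge_closed) auto
  ultimately have "\<delta> (i + 1) (\<delta> i x) \<gamma>
      = (\<Oplus>\<^bsub>K \<gamma>\<^esub>c\<in>\<gamma>. \<Oplus>\<^bsub>K \<gamma>\<^esub>c'\<in>\<gamma> - {c}. sedge \<gamma> c (sedge (\<gamma> - {c}) c' (x (\<gamma> - {c} - {c'}))))"
    unfolding differential_at[OF \<gamma>] by (intro K.E.finsum_cong') (auto intro!: K.E.finsum_closed)
  also have "\<dots> = \<zero>\<^bsub>K \<gamma>\<^esub>"
  proof (rule K.E.finsum_antisym_pairs[OF V_finite[OF \<gamma>] cl])
    fix c c' assume c: "c \<in> \<gamma>" "c' \<in> \<gamma>" "c \<noteq> c'"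
    have "\<gamma> - {c'} - {c} = \<gamma> - {c} - {c'}" by auto
    then show "sedge \<gamma> c (sedge (\<gamma> - {c}) c' (x (\<gamma> - {c} - {c'}))) \<oplus>\<^bsub>K \<gamma>\<^esub> sedge \<gamma> c' (sedge (\<gamma> - {c'}) c (x (\<gamma> - {c'} - {c}))) = \<zero>\<^bsub>K \<gamma>\<^esub>"
      using sedge_anticomm[OF sub c xc[OF c]] by simp
  qed
  finally show "\<delta> (i + 1) (\<delta> i x) \<gamma> = \<one>\<^bsub>Ch (i + 1 + 1)\<^esub> \<gamma>"
    using \<gamma> by (simp add: chain_simps(3))
qed (rule differential_closed[OF differential_closed[OF x]] C.one_closed)+

section \<open>Dots as chain maps\<close>

definition dot :: "int \<Rightarrow> ('e \<Rightarrow>\<^sub>0 int) \<Rightarrow> ('v set \<Rightarrow> 'e ext) \<Rightarrow> ('v set \<Rightarrow> 'e ext)" where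
  "dot i m x = (\<lambda>\<alpha> \<in> V i. dot_at \<alpha> m (x \<alpha>))"

lemma dot_map_eq: "e \<in> edges D \<Longrightarrow> dot_map D e i x = dot i (frag_of e) x"
  by (simp add: dot_map_def dot_def dot_at_def circle_alg_def proj_gen keys_frag_of)

lemma dot_at_closed: "\<lbrakk>edge_chain m; z \<in> carrier (K \<alpha>)\<rbrakk> \<Longrightarrow> dot_at \<alpha> m z \<in> carrier (K \<alpha>)"
  by (rule ring_add_hom.closed[OF dot_at_hom])

lemma dot_closed: "\<lbrakk>edge_chain m; x \<in> carrier (Ch i)\<rbrakk> \<Longrightarrow> dot i m x \<in> carrier (Ch i)"
  unfolding dot_def by (auto simp: chain_simps intro!: dot_at_closed)

lemma dot_hom: "edge_chain m \<Longrightarrow> dot i m \<in> hom (Ch i) (Ch i)"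
proof (rule homI)
  fix x y assume m: "edge_chain m" and xy: "x \<in> carrier (Ch i)" "y \<in> carrier (Ch i)"
  show "dot i m (x \<otimes>\<^bsub>Ch i\<^esub> y) = dot i m x \<otimes>\<^bsub>Ch i\<^esub> dot i m y"
    by (rule chain_eqI[OF dot_closed[OF m C.m_closed[OF xy]] C.m_closed[OF dot_closed[OF m] dot_closed[OF m]]])
      (use m xy in \<open>auto simp: dot_def chain_simps(2) ring_add_hom.add[OF dot_at_hom] chain_at\<close>)
qed (rule dot_closed)

lemma dot_add:
  assumes m: "edge_chain m" "edge_chain m'" and x: "x \<in> carrier (Ch i)"
  shows "dot i (m + m') x = dot i m x \<otimes>\<^bsub>Ch i\<^esub> dot i m' x"
proof (rule chain_eqI[OF dot_closed[OF _ x] C.m_closed[OF dot_closed[OF m(1) x] dot_closed[OF m(2) x]]])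
  show "edge_chain (m + m')" using keys_add[of m m'] m by blast
  fix \<alpha> assume "\<alpha> \<in> V i"
  moreover have "L.gen (m + m') = L.gen m \<oplus>\<^bsub>L\<^esub> L.gen m'" using L.gen_mult[of m m'] m by simp
  ultimately show "dot i (m + m') x \<alpha> = (dot i m x \<otimes>\<^bsub>Ch i\<^esub> dot i m' x) \<alpha>"
    using m chain_at[OF x] by (simp add: dot_def chain_simps(2) dot_at_def K.E.l_distr K.E.int_mult_add)
qed

lemma dot_square:
  assumes m: "edge_chain m" and x: "x \<in> carrier (Ch i)"
  shows "dot i m (dot i m x) = \<one>\<^bsub>Ch i\<^esub>"
proof (rule chain_eqI[OF dot_closed[OF m dot_closed[OF m x]] C.one_closed])
  fix \<alpha> assume \<alpha>: "\<alpha> \<in> V i"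
  have "proj \<alpha> (L.gen m) \<otimes>\<^bsub>K \<alpha>\<^esub> proj \<alpha> (L.gen m) = \<zero>\<^bsub>K \<alpha>\<^esub>"
    using proj.hom_mult[of "L.gen m" "L.gen m" \<alpha>] m L.gen_square[of m] by simp
  then have "proj \<alpha> (L.gen m) \<otimes>\<^bsub>K \<alpha>\<^esub> (proj \<alpha> (L.gen m) \<otimes>\<^bsub>K \<alpha>\<^esub> x \<alpha>) = \<zero>\<^bsub>K \<alpha>\<^esub>"
    using chain_at[OF x \<alpha>] m by (simp flip: K.E.m_assoc)
  moreover have "[(k::int)] \<cdot>\<^bsub>K \<alpha>\<^esub> \<zero>\<^bsub>K \<alpha>\<^esub> = \<zero>\<^bsub>K \<alpha>\<^esub>" for k
    by (rule ring_add_hom.zero[OF K.E.ring_add_hom_int_mult])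
  ultimately show "dot i m (dot i m x) \<alpha> = \<one>\<^bsub>Ch i\<^esub> \<alpha>"
    using \<alpha> m chain_at[OF x \<alpha>] by (simp add: dot_def chain_simps(3) dot_at_def K.E.add_pow_rdistr_int)
qed

lemma dot_differential:
  assumes m: "edge_chain m" and x: "x \<in> carrier (Ch i)"
  shows "\<delta> i (dot i m x) = dot (i + 1) m (\<delta> i x)"
proof (rule chain_eqI[OF differential_closed[OF dot_closed[OF m x]] dot_closed[OF m differential_closed[OF x]]])
  fix \<beta> assume \<beta>: "\<beta> \<in> V (i + 1)"
  have "sedge \<beta> c (dot i m x (\<beta> - {c})) = dot_at \<beta> m (sedge \<beta> c (x (\<beta> - {c})))" if c: "c \<in> \<beta>" for c
  proof -
    have v: "\<beta> - {c} \<in> V i" using V_remove[OF \<beta> c] by simp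
    then show ?thesis using sedge_dot_at[OF c V_subset[OF \<beta>] m chain_at[OF x v]] by (simp add: dot_def)
  qed
  then have "\<delta> i (dot i m x) \<beta> = (\<Oplus>\<^bsub>K \<beta>\<^esub>c\<in>\<beta>. dot_at \<beta> m (sedge \<beta> c (x (\<beta> - {c}))))"
    unfolding differential_at[OF \<beta>] using sedge_chain_closed[OF x \<beta>]
    by (intro K.E.finsum_cong') (auto simp: Pi_def intro!: dot_at_closed[OF m])
  also have "\<dots> = dot_at \<beta> m (\<delta> i x \<beta>)"
    unfolding differential_at[OF \<beta>]
    using ring_add_hom.finsum[OF dot_at_hom[OF m] V_finite[OF \<beta>] sedge_chain_closed[OF x \<beta>]] by simp
  finally show "\<delta> i (dot i m x) \<beta> = dot (i + 1) m (\<delta> i x) \<beta>" using \<beta> by (simp add: dot_def)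
qed

section \<open>The null-homotopy\<close>

definition homotopy :: "'v \<Rightarrow> int \<Rightarrow> ('v set \<Rightarrow> 'e ext) \<Rightarrow> ('v set \<Rightarrow> 'e ext)" where
  "homotopy c i x = (\<lambda>\<alpha> \<in> V i. if c \<in> \<alpha> then \<zero>\<^bsub>K \<alpha>\<^esub> else homotopy_at c \<alpha> (x (insert c \<alpha>)))"

lemma homotopy_closed:
  assumes c: "c \<in> crossings D" and x: "x \<in> carrier (Ch (i + 1))"
  shows "homotopy c i x \<in> carrier (Ch i)"
  using V_insert[of _ i c] c chain_at[OF x]
  by (auto simp: homotopy_def chain_simps(1) intro!: ring_add_hom.closed[OF homotopy_at_hom])

lemma homotopy_one:
  assumes c: "c \<in> crossings D"
  shows "homotopy c i \<one>\<^bsub>Ch (i + 1)\<^esub> = \<one>\<^bsub>Ch i\<^esub>"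
  by (rule chain_eqI[OF homotopy_closed[OF c C.one_closed] C.one_closed])
    (use V_insert[of _ i c] c in \<open>auto simp: homotopy_def chain_simps(3) ring_add_hom.zero[OF homotopy_at_hom]\<close>)

lemma keys_crossing_diff: "c \<in> crossings D \<Longrightarrow> edge_chain (crossing_diff c)"
  by (simp add: crossing_diff_def keys_sdiff strand_edge)

text \<open>If c is in \<alpha>, the homotopy vanishes at \<alpha> and at
  \<open>\<alpha> - {c'}\<close> for every other c', and the term of c in the differential gives the
  dot. If c is not in \<alpha>, the dot comes from the term of c in the second summand; each other
  term there cancels against the term of the same c' in the first summand.\<close>

lemma null_homotopy:
  assumes c: "c \<in> crossings D" and x: "x \<in> carrier (Ch i)"
  shows "\<delta> (i - 1) (homotopy c (i - 1) x) \<otimes>\<^bsub>Ch i\<^esub> homotopy c i (\<delta> i x) = dot i (crossing_diff c) x"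
proof (rule chain_eqI)
  have Hx: "homotopy c (i - 1) x \<in> carrier (Ch (i - 1))" using homotopy_closed[OF c, of x "i - 1"] x by simp
  have dx: "\<delta> i x \<in> carrier (Ch (i + 1))" by (rule differential_closed[OF x])
  show "\<delta> (i - 1) (homotopy c (i - 1) x) \<otimes>\<^bsub>Ch i\<^esub> homotopy c i (\<delta> i x) \<in> carrier (Ch i)"
    using differential_closed[OF Hx] homotopy_closed[OF c dx] by simp
  show "dot i (crossing_diff c) x \<in> carrier (Ch i)" by (rule dot_closed[OF keys_crossing_diff[OF c] x])
  fix \<alpha> assume \<alpha>: "\<alpha> \<in> V i"
  have \<alpha>': "\<alpha> \<in> V (i - 1 + 1)" and sub: "\<alpha> \<subseteq> crossings D" and fin: "finite \<alpha>"
    using \<alpha> V_subset V_finite by auto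
  let ?t = "\<lambda>c'. sedge \<alpha> c' (homotopy c (i - 1) x (\<alpha> - {c'}))"
  have tc: "?t \<in> \<alpha> \<rightarrow> carrier (K \<alpha>)" by (rule sedge_chain_closed[OF Hx \<alpha>'])
  have v: "\<alpha> - {c'} \<in> V (i - 1)" if "c' \<in> \<alpha>" for c' by (rule V_remove[OF \<alpha> that])
  have "(\<Oplus>\<^bsub>K \<alpha>\<^esub>c'\<in>\<alpha>. ?t c') \<oplus>\<^bsub>K \<alpha>\<^esub> homotopy c i (\<delta> i x) \<alpha> = dot_at \<alpha> (crossing_diff c) (x \<alpha>)"
  proof (cases "c \<in> \<alpha>")
    case True
    have z: "?t c' = \<zero>\<^bsub>K \<alpha>\<^esub>" if "c' \<in> \<alpha> - {c}" for c'
    proof -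
      have "homotopy c (i - 1) x (\<alpha> - {c'}) = \<zero>\<^bsub>K (\<alpha> - {c'})\<^esub>"
        using that True v[of c'] by (auto simp: homotopy_def)
      then show ?thesis using ring_add_hom.zero[OF sedge_hom[of c' \<alpha>]] that sub by auto
    qed
    have tcc: "?t c = dot_at \<alpha> (crossing_diff c) (x \<alpha>)"
      using homotopy_diagonal1[OF True sub chain_at[OF x \<alpha>]] v[OF True] insert_Diff[OF True] by (simp add: homotopy_def)
    have "(\<Oplus>\<^bsub>K \<alpha>\<^esub>c'\<in>insert c (\<alpha> - {c}). ?t c') = ?t c \<oplus>\<^bsub>K \<alpha>\<^esub> (\<Oplus>\<^bsub>K \<alpha>\<^esub>c'\<in>\<alpha> - {c}. ?t c')"
      using fin tc True by (intro K.E.finsum_insert) auto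
    also have "(\<Oplus>\<^bsub>K \<alpha>\<^esub>c'\<in>\<alpha> - {c}. ?t c') = \<zero>\<^bsub>K \<alpha>\<^esub>"
      using z by (intro K.E.add.finprod_one_eqI) auto
    finally show ?thesis
      unfolding insert_Diff[OF True] using True \<alpha> tc tcc by (auto simp: homotopy_def Pi_def)
  next
    case False
    let ?\<beta> = "insert c \<alpha>"
    have \<beta>: "?\<beta> \<in> V (i + 1)" by (rule V_insert[OF \<alpha> c False])
    let ?s = "\<lambda>c'. sedge ?\<beta> c' (x (?\<beta> - {c'}))"
    have sc: "?s \<in> ?\<beta> \<rightarrow> carrier (K ?\<beta>)" by (rule sedge_chain_closed[OF x \<beta>])
    have ins: "?\<beta> - {c} = \<alpha>" using False by auto
    interpret h: ring_add_hom "K ?\<beta>" "K \<alpha>" "homotopy_at c \<alpha>" by (rule homotopy_at_hom[OF c False])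
    have hs: "(\<lambda>c'. homotopy_at c \<alpha> (?s c')) \<in> \<alpha> \<rightarrow> carrier (K \<alpha>)"
      by (intro funcsetI h.closed) (use sc in \<open>auto simp: Pi_iff\<close>)
    have "homotopy c i (\<delta> i x) \<alpha> = homotopy_at c \<alpha> (\<Oplus>\<^bsub>K ?\<beta>\<^esub>c'\<in>?\<beta>. ?s c')"
      using \<alpha> False by (simp add: homotopy_def differential_at[OF \<beta>])
    also have "\<dots> = (\<Oplus>\<^bsub>K \<alpha>\<^esub>c'\<in>?\<beta>. homotopy_at c \<alpha> (?s c'))"
      by (rule h.finsum[OF V_finite[OF \<beta>] sc])
    also have "\<dots> = homotopy_at c \<alpha> (?s c) \<oplus>\<^bsub>K \<alpha>\<^esub> (\<Oplus>\<^bsub>K \<alpha>\<^esub>c'\<in>\<alpha>. homotopy_at c \<alpha> (?s c'))"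
      using sc by (intro K.E.finsum_insert fin False hs h.closed) auto
    also have "homotopy_at c \<alpha> (?s c) = dot_at \<alpha> (crossing_diff c) (x \<alpha>)"
      unfolding ins by (rule homotopy_diagonal0[OF c False sub chain_at[OF x \<alpha>]])
    finally have "(\<Oplus>\<^bsub>K \<alpha>\<^esub>c'\<in>\<alpha>. ?t c') \<oplus>\<^bsub>K \<alpha>\<^esub> homotopy c i (\<delta> i x) \<alpha>
      = dot_at \<alpha> (crossing_diff c) (x \<alpha>) \<oplus>\<^bsub>K \<alpha>\<^esub> ((\<Oplus>\<^bsub>K \<alpha>\<^esub>c'\<in>\<alpha>. ?t c') \<oplus>\<^bsub>K \<alpha>\<^esub> (\<Oplus>\<^bsub>K \<alpha>\<^esub>c'\<in>\<alpha>. homotopy_at c \<alpha> (?s c')))"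
      using tc hs dot_at_closed[OF keys_crossing_diff[OF c] chain_at[OF x \<alpha>]] by (simp add: K.E.a_lcomm)
    also have "(\<Oplus>\<^bsub>K \<alpha>\<^esub>c'\<in>\<alpha>. ?t c') \<oplus>\<^bsub>K \<alpha>\<^esub> (\<Oplus>\<^bsub>K \<alpha>\<^esub>c'\<in>\<alpha>. homotopy_at c \<alpha> (?s c'))
      = (\<Oplus>\<^bsub>K \<alpha>\<^esub>c'\<in>\<alpha>. ?t c' \<oplus>\<^bsub>K \<alpha>\<^esub> homotopy_at c \<alpha> (?s c'))"
      by (rule K.E.finsum_addf[OF tc hs, symmetric])
    also have "\<dots> = \<zero>\<^bsub>K \<alpha>\<^esub>"
    proof (rule K.E.add.finprod_one_eqI)
      fix c' assume c': "c' \<in> \<alpha>"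
      have e: "insert c (\<alpha> - {c'}) = ?\<beta> - {c'}" using False c' by auto
      have "x (?\<beta> - {c'}) \<in> carrier (K (?\<beta> - {c'}))"
        using V_remove[OF \<beta>, of c'] c' chain_at[OF x] by simp
      from homotopy_off_diagonal[OF sub c False c' this]
      show "?t c' \<oplus>\<^bsub>K \<alpha>\<^esub> homotopy_at c \<alpha> (?s c') = \<zero>\<^bsub>K \<alpha>\<^esub>"
        using v[OF c'] False by (simp add: homotopy_def e)
    qed
    finally show ?thesis
      using dot_at_closed[OF keys_crossing_diff[OF c] chain_at[OF x \<alpha>]] by simp
  qed
  then show "(\<delta> (i - 1) (homotopy c (i - 1) x) \<otimes>\<^bsub>Ch i\<^esub> homotopy c i (\<delta> i x)) \<alpha> = dot i (crossing_diff c) x \<alpha>"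
    using \<alpha> differential_at[OF \<alpha>', of "homotopy c (i - 1) x"] by (simp add: chain_simps(2) dot_def)
qed

end

section \<open>Homology and the endomorphisms given by dots\<close>

context signed_diagram
begin

abbreviation "Zc \<equiv> cycles D ar \<epsilon>"
abbreviation "Bd \<equiv> boundaries D ar \<epsilon>"
abbreviation "Hom \<equiv> homology D ar \<epsilon>"
abbreviation "class \<equiv> homology_class D ar \<epsilon>"

lemma cycles_iff: "x \<in> Zc i \<longleftrightarrow> x \<in> carrier (Ch i) \<and> \<delta> i x = \<one>\<^bsub>Ch (i + 1)\<^esub>"
  by (simp add: cycles_def kernel_def)

lemma boundaryE:
  assumes "x \<in> Bd i"
  obtains y where "y \<in> carrier (Ch (i - 1))" "x = \<delta> (i - 1) y"
  using assms by (auto simp: boundaries_def)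

lemma group_hom_differential: "group_hom (Ch i) (Ch (i + 1)) (\<delta> i)"
  using differential_hom by (intro group_hom.intro group_hom_axioms.intro C.is_group)

lemma subquotient_homology: "subquotient (Ch i) (Zc i) (Bd i)"
proof (intro subquotient.intro subquotient_axioms.intro C.comm_group_axioms)
  show "subgroup (Zc i) (Ch i)"
    unfolding cycles_def by (rule group_hom.subgroup_kernel[OF group_hom_differential])
  show "subgroup (Bd i) (Ch i)"
    using group_hom.img_is_subgroup[OF group_hom_differential[of "i - 1"]] by (simp add: boundaries_def)
  show "Bd i \<subseteq> Zc i"
  proof
    fix x assume "x \<in> Bd i"
    then obtain y where y: "y \<in> carrier (Ch (i - 1))" "x = \<delta> (i - 1) y" by (rule boundaryE)
    then show "x \<in> Zc i"
      using differential_closed[OF y(1)] differential_differential[OF y(1)] by (simp add: cycles_iff)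
  qed
qed

sublocale SQ: subquotient "Ch i" "Zc i" "Bd i" for i by (rule subquotient_homology)

lemma Hom_eq: "Hom i = SQ.H i"
  by (simp add: homology_def)

sublocale Hom: comm_group "Hom i" for i
  unfolding Hom_eq by (rule SQ.comm_group_H)

sublocale End: ring "end_ring (Hom i)" for i
  by (rule Hom.ring_end_ring)

lemma carrier_Hom: "carrier (Hom i) = class i ` Zc i"
  unfolding Hom_eq SQ.carrier_H by (simp add: homology_class_def[abs_def])

lemma class_mult: "\<lbrakk>x \<in> Zc i; y \<in> Zc i\<rbrakk> \<Longrightarrow> class i x \<otimes>\<^bsub>Hom i\<^esub> class i y = class i (x \<otimes>\<^bsub>Ch i\<^esub> y)"
  unfolding Hom_eq homology_class_def by (rule SQ.coset_mult)

lemma class_boundary: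
  assumes "x \<in> Bd i"
  shows "class i x = \<one>\<^bsub>Hom i\<^esub>"
  using C.coset_join2[OF _ SQ.B assms] subgroup.mem_carrier[OF SQ.B assms]
  by (simp add: homology_class_def homology_def)

lemma dot_cycles: "edge_chain m \<Longrightarrow> dot i m ` Zc i \<subseteq> Zc i"
proof (rule image_subsetI)
  fix x assume m: "edge_chain m" and "x \<in> Zc i"
  then show "dot i m x \<in> Zc i"
    using hom_one[OF dot_hom[OF m] C.is_group C.is_group]
    by (simp add: cycles_iff dot_closed dot_differential)
qed

lemma dot_boundaries: "edge_chain m \<Longrightarrow> dot i m ` Bd i \<subseteq> Bd i"
proof (rule image_subsetI)
  fix x assume m: "edge_chain m" and "x \<in> Bd i"
  then obtain y where y: "y \<in> carrier (Ch (i - 1))" "x = \<delta> (i - 1) y" using boundaryE by blast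
  then have "dot i m x = \<delta> (i - 1) (dot (i - 1) m y)"
    using dot_differential[OF m y(1)] by simp
  then show "dot i m x \<in> Bd i"
    using dot_closed[OF m y(1)] by (simp add: boundaries_def)
qed

definition dot_action :: "int \<Rightarrow> ('e \<Rightarrow>\<^sub>0 int) \<Rightarrow> ('v set \<Rightarrow> 'e ext) set \<Rightarrow> ('v set \<Rightarrow> 'e ext) set" where
  "dot_action i m = SQ.induced i (dot i m)"

lemma dot_action_end: "edge_chain m \<Longrightarrow> dot_action i m \<in> carrier (end_ring (Hom i))"
  unfolding dot_action_def Hom_eq by (intro SQ.induced_end dot_hom dot_cycles dot_boundaries)

lemma dot_action_class:
  "\<lbrakk>edge_chain m; x \<in> Zc i\<rbrakk> \<Longrightarrow> dot_action i m (class i x) = class i (dot i m x)"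
  unfolding dot_action_def homology_class_def by (intro SQ.induced_coset dot_hom dot_cycles dot_boundaries)

lemma dot_action_eqI:
  assumes "edge_chain m" "g \<in> carrier (end_ring (Hom i))"
    "\<And>x. x \<in> Zc i \<Longrightarrow> class i (dot i m x) = g (class i x)"
  shows "dot_action i m = g"
proof (rule Hom.end_eqI[OF dot_action_end[OF assms(1)] assms(2)])
  fix X assume "X \<in> carrier (Hom i)"
  then obtain x where "x \<in> Zc i" "X = class i x" by (auto simp: carrier_Hom)
  then show "dot_action i m X = g X" using assms by (simp add: dot_action_class)
qed

lemma class_in: "x \<in> Zc i \<Longrightarrow> class i x \<in> carrier (Hom i)"
  by (simp add: carrier_Hom)

lemma dot_action_add:
  assumes m: "edge_chain m" "edge_chain m'"
  shows "dot_action i (m + m') = dot_action i m \<oplus>\<^bsub>end_ring (Hom i)\<^esub> dot_action i m'"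
proof (rule dot_action_eqI)
  show "edge_chain (m + m')" using keys_add[of m m'] m by blast
  show "dot_action i m \<oplus>\<^bsub>end_ring (Hom i)\<^esub> dot_action i m' \<in> carrier (end_ring (Hom i))"
    using m by (intro End.a_closed dot_action_end)
  fix x assume x: "x \<in> Zc i"
  have "dot i m x \<in> Zc i" "dot i m' x \<in> Zc i" using dot_cycles m x by blast+
  moreover have "dot i (m + m') x = dot i m x \<otimes>\<^bsub>Ch i\<^esub> dot i m' x"
    using dot_add[OF m] x by (simp add: cycles_iff)
  ultimately show "class i (dot i (m + m') x) = (dot_action i m \<oplus>\<^bsub>end_ring (Hom i)\<^esub> dot_action i m') (class i x)"
    using m x by (simp add: Hom.end_ring_simps class_in dot_action_class class_mult)
qed

lemma dot_action_hom: "dot_action i \<in> hom (edge_group D) (add_monoid (end_ring (Hom i)))"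
  by (rule homI) (simp_all add: dot_action_end dot_action_add)

lemma dot_action_zero: "dot_action i 0 = \<zero>\<^bsub>end_ring (Hom i)\<^esub>"
  using hom_one[OF dot_action_hom[of i] L.is_group End.a_group] by simp

lemma dot_action_square:
  assumes m: "edge_chain m"
  shows "dot_action i m \<otimes>\<^bsub>end_ring (Hom i)\<^esub> dot_action i m = \<zero>\<^bsub>end_ring (Hom i)\<^esub>"
proof (rule Hom.end_eqI)
  show "dot_action i m \<otimes>\<^bsub>end_ring (Hom i)\<^esub> dot_action i m \<in> carrier (end_ring (Hom i))"
    using m by (intro End.m_closed dot_action_end)
  fix X assume "X \<in> carrier (Hom i)"
  then obtain x where x: "x \<in> Zc i" "X = class i x" by (auto simp: carrier_Hom)
  have "dot i m x \<in> Zc i" using dot_cycles m x by blast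
  moreover have "dot i m (dot i m x) = \<one>\<^bsub>Ch i\<^esub>" using dot_square[OF m] x by (simp add: cycles_iff)
  moreover have "class i \<one>\<^bsub>Ch i\<^esub> = \<one>\<^bsub>Hom i\<^esub>" by (rule class_boundary[OF subgroup.one_closed[OF SQ.B]])
  ultimately show "(dot_action i m \<otimes>\<^bsub>end_ring (Hom i)\<^esub> dot_action i m) X = \<zero>\<^bsub>end_ring (Hom i)\<^esub> X"
    using m x by (simp add: Hom.end_ring_simps class_in dot_action_class)
qed simp

text \<open>On a cycle the half of the null-homotopy that contains \<open>\<delta> i x\<close> is
  trivial, so the dot takes cycles to boundaries.\<close>

lemma dot_action_crossing_diff:
  assumes c: "c \<in> crossings D"
  shows "dot_action i (crossing_diff c) = \<zero>\<^bsub>end_ring (Hom i)\<^esub>"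
proof (rule dot_action_eqI[OF keys_crossing_diff[OF c] End.zero_closed])
  fix x assume x: "x \<in> Zc i"
  then have x': "x \<in> carrier (Ch i)" "\<delta> i x = \<one>\<^bsub>Ch (i + 1)\<^esub>" by (simp_all add: cycles_iff)
  have H: "homotopy c (i - 1) x \<in> carrier (Ch (i - 1))" using homotopy_closed[OF c, of x "i - 1"] x' by simp
  have "\<delta> (i - 1) (homotopy c (i - 1) x) \<in> carrier (Ch i)" using differential_closed[OF H] by simp
  then have "dot i (crossing_diff c) x = \<delta> (i - 1) (homotopy c (i - 1) x)"
    using null_homotopy[OF c x'(1)] x'(2) homotopy_one[OF c, of i] by simp
  also have "\<dots> \<in> Bd i" using H by (simp add: boundaries_def)
  finally show "class i (dot i (crossing_diff c) x) = \<zero>\<^bsub>end_ring (Hom i)\<^esub> (class i x)"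
    using x by (simp add: class_boundary Hom.end_ring_simps class_in)
qed

lemma dot_action_overstrand:
  assumes c: "c \<in> crossings D"
  shows "dot_action i (frag_of (strand D c North) - frag_of (strand D c South)) = \<zero>\<^bsub>end_ring (Hom i)\<^esub>"
proof -
  let ?n = "frag_of (strand D c North) - frag_of (strand D c South)"
  have n: "?n = (if ar c then - crossing_diff c else crossing_diff c)"
    by (simp add: crossing_diff_def sdiff_def)
  have "dot_action i (- crossing_diff c) = \<zero>\<^bsub>end_ring (Hom i)\<^esub>"
    using dot_action_add[of "crossing_diff c" "- crossing_diff c" i] keys_crossing_diff[OF c]
      dot_action_crossing_diff[OF c, of i] dot_action_zero[of i] dot_action_end[of "- crossing_diff c" i]
    by simp
  then show ?thesis unfolding n using dot_action_crossing_diff[OF c] by simp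
qed

text \<open>A resolution sees a dot only through the circle on which it lies.\<close>

lemma dot_action_cong:
  assumes m: "edge_chain m" "edge_chain m'"
    and "\<And>\<alpha>. circ \<alpha> m = circ \<alpha> m'"
  shows "dot_action i m = dot_action i m'"
proof -
  have "dot i m = dot i m'"
    by (rule ext) (simp add: dot_def dot_at_def proj_gen m assms(3) cong: restrict_cong)
  then show ?thesis by (simp add: dot_action_def)
qed

text \<open>
  In every resolution the circles at the ends \<open>W\<close> and \<open>E\<close> are those at the ends \<open>N\<close> and \<open>S\<close>, so
  \<open>2N - W - E\<close> and \<open>N - S\<close> act by the same chain map.
\<close>

lemma dot_action_crossing:
  assumes c: "c \<in> crossings D"
  shows "dot_action i (frag_of (strand D c North) + frag_of (strand D c North) - frag_of (strand D c West) - frag_of (strand D c East)) = \<zero>\<^bsub>end_ring (Hom i)\<^esub>"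
proof -
  let ?f = "\<lambda>p. frag_of (strand D c p)"
  have k: "edge_chain (?f p)" for p using c by (simp add: keys_frag_of strand_edge)
  have k2: "edge_chain (?f North + ?f North - ?f West - ?f East)"
    by (intro order_trans[OF keys_diff] order_trans[OF keys_add] Un_least k)
  have k1: "edge_chain (?f North - ?f South)"
    by (intro order_trans[OF keys_diff] Un_least k)
  have "circ \<alpha> (?f North + ?f North - ?f West - ?f East) = circ \<alpha> (?f North - ?f South)" for \<alpha>
    using circle_of_partner0[OF c, of \<alpha>] circle_of_partner1[OF c, of \<alpha>]
    by (cases "c \<in> \<alpha>") (simp_all add: frag_extend_add frag_extend_diff)
  from dot_action_cong[OF k2 k1 this, of i] show ?thesis
    using dot_action_overstrand[OF c] by simp
qed

section \<open>The relations of the coloring group\<close>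

lemma arc_relators: "{frag_of (strand D c North) - frag_of (strand D c South) | c. c \<in> crossings D} \<subseteq> carrier (edge_group D)"
proof clarify
  fix c assume "c \<in> crossings D"
  then show "frag_of (strand D c North) - frag_of (strand D c South) \<in> carrier (edge_group D)"
    using keys_sdiff[of "strand D c North" "edges D" "strand D c South" True] by (simp add: sdiff_def strand_edge)
qed

lemma arcs_normal: "arc_relations D \<lhd> edge_group D"
  unfolding arc_relations_def by (intro L.subgroup_imp_normal L.generate_is_subgroup arc_relators)

sublocale arcs: comm_group "arcs D"
  unfolding arcs_def by (rule L.abelian_FactGroup[OF normal_imp_subgroup[OF arcs_normal]])

definition arc_class :: "('e \<Rightarrow>\<^sub>0 int) \<Rightarrow> ('e \<Rightarrow>\<^sub>0 int) set" where
  "arc_class m = arc_relations D #>\<^bsub>edge_group D\<^esub> m"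

lemma group_hom_arc_class: "group_hom (edge_group D) (arcs D) arc_class"
  using normal.r_coset_hom_Mod[OF arcs_normal] L.is_group arcs.is_group
  by (simp add: group_hom_def group_hom_axioms_def arcs_def arc_class_def[abs_def])

interpretation ac: group_hom "edge_group D" "arcs D" arc_class
  by (rule group_hom_arc_class)

text \<open>The multiplicatively written relator of \<open>col_relations\<close> as the class of one
  additive combination of edges, to which \<open>dot_action\<close> applies.\<close>

definition crossing_relator :: "'v \<Rightarrow> ('e \<Rightarrow>\<^sub>0 int) set" where
  "crossing_relator c = arc_class (frag_of (strand D c North) + frag_of (strand D c North) - frag_of (strand D c West) - frag_of (strand D c East))"

lemma crossing_relator_eq:
  assumes c: "c \<in> crossings D"
  shows "arc_of D (strand D c North) [^]\<^bsub>arcs D\<^esub> (2::nat) \<otimes>\<^bsub>arcs D\<^esub> inv\<^bsub>arcs D\<^esub> arc_of D (strand D c West)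
        \<otimes>\<^bsub>arcs D\<^esub> inv\<^bsub>arcs D\<^esub> arc_of D (strand D c East) = crossing_relator c"
proof -
  let ?f = "\<lambda>p. frag_of (strand D c p)"
  have k: "edge_chain (?f p)" for p using c by (simp add: keys_frag_of strand_edge)
  have NN: "edge_chain (?f North + ?f North)"
    by (intro order_trans[OF keys_add] Un_least k)
  have NNW: "edge_chain (?f North + ?f North - ?f West)"
    by (intro order_trans[OF keys_diff] Un_least k NN)
  have inv: "inv\<^bsub>arcs D\<^esub> arc_class (?f p) = arc_class (- ?f p)" for p
    using ac.hom_inv[of "?f p"] k[of p] by (simp add: edge_group_def)
  have "crossing_relator c = arc_class (?f North + ?f North - ?f West) \<otimes>\<^bsub>arcs D\<^esub> arc_class (- ?f East)"
    using ac.hom_mult[of "?f North + ?f North - ?f West" "- ?f East"] NNW k by (simp add: crossing_relator_def)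
  also have "arc_class (?f North + ?f North - ?f West) = arc_class (?f North + ?f North) \<otimes>\<^bsub>arcs D\<^esub> arc_class (- ?f West)"
    using ac.hom_mult[of "?f North + ?f North" "- ?f West"] NN k by simp
  also have "arc_class (?f North + ?f North) = arc_class (?f North) \<otimes>\<^bsub>arcs D\<^esub> arc_class (?f North)"
    using ac.hom_mult[of "?f North" "?f North"] k by simp
  finally show ?thesis
    using ac.hom_closed[of "?f North"] k by (simp add: inv arc_of_def numeral_2_eq_2 flip: arc_class_def)
qed

lemma col_relations_eq: "col_relations D = generate (arcs D) {crossing_relator c | c. c \<in> crossings D}"
proof -
  have "{arc_of D (strand D c North) [^]\<^bsub>arcs D\<^esub> (2::nat) \<otimes>\<^bsub>arcs D\<^esub> inv\<^bsub>arcs D\<^esub> arc_of D (strand D c West)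
        \<otimes>\<^bsub>arcs D\<^esub> inv\<^bsub>arcs D\<^esub> arc_of D (strand D c East) | c. c \<in> crossings D} = {crossing_relator c | c. c \<in> crossings D}"
    by (intro Collect_cong ex_cong1) (metis crossing_relator_eq)
  then show ?thesis by (simp add: col_relations_def)
qed

lemma crossing_relator_keys:
  "c \<in> crossings D \<Longrightarrow> edge_chain (frag_of (strand D c North) + frag_of (strand D c North) - frag_of (strand D c West) - frag_of (strand D c East))"
  by (intro order_trans[OF keys_diff] order_trans[OF keys_add] Un_least) (simp_all add: keys_frag_of strand_edge)

lemma crossing_relators: "{crossing_relator c | c. c \<in> crossings D} \<subseteq> carrier (arcs D)"
  using crossing_relator_keys ac.hom_closed by (auto simp: crossing_relator_def)

sublocale Col: comm_group "Col D"
  unfolding Col_def col_relations_eq by (intro arcs.abelian_FactGroup arcs.generate_is_subgroup crossing_relators)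

definition col_class :: "('e \<Rightarrow>\<^sub>0 int) \<Rightarrow> ('e \<Rightarrow>\<^sub>0 int) set set" where
  "col_class m = col_relations D #>\<^bsub>arcs D\<^esub> arc_class m"

lemma col_of_eq: "col_of D e = col_class (frag_of e)"
  by (simp add: col_of_def col_class_def arc_of_def arc_class_def)

lemma carrier_Col: "carrier (Col D) = col_class ` {m. edge_chain m}"
proof -
  have "carrier (edge_group D) = {m. edge_chain m}" by auto
  moreover have "carrier (arcs D) = arc_class ` carrier (edge_group D)"
    by (simp only: arcs_def carrier_FactGroup arc_class_def[abs_def])
  ultimately show ?thesis by (simp add: Col_def carrier_FactGroup col_class_def[abs_def] image_image)
qed

text \<open>\<open>Col D\<close> is a quotient in two stages, so the action of the edge group is
  factored twice: through \<open>arcs D\<close> by the overstrand relations, then by the crossing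
  relations.\<close>

lemma col_action_exists:
  obtains \<phi> where "\<phi> \<in> hom (Col D) (add_monoid (end_ring (Hom i)))"
    "\<And>m :: 'e \<Rightarrow>\<^sub>0 int. edge_chain m \<Longrightarrow> \<phi> (col_class m) = dot_action i m"
proof -
  let ?A = "add_monoid (end_ring (Hom i))"
  obtain \<phi>1 where \<phi>1: "\<phi>1 \<in> hom (arcs D) ?A" "\<And>m :: 'e \<Rightarrow>\<^sub>0 int. edge_chain m \<Longrightarrow> \<phi>1 (arc_class m) = dot_action i m"
  proof (rule L.hom_factors_generate[OF End.a_group dot_action_hom[of i] arc_relators])
    show "dot_action i s = \<one>\<^bsub>?A\<^esub>"
      if "s \<in> {frag_of (strand D c North) - frag_of (strand D c South) | c. c \<in> crossings D}" for s
      using that dot_action_overstrand by auto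
    fix g assume "g \<in> hom (edge_group D Mod generate (edge_group D) {frag_of (strand D c North) - frag_of (strand D c South) | c. c \<in> crossings D}) ?A"
      "\<And>x. x \<in> carrier (edge_group D) \<Longrightarrow>
        g (generate (edge_group D) {frag_of (strand D c North) - frag_of (strand D c South) | c. c \<in> crossings D} #>\<^bsub>edge_group D\<^esub> x) = dot_action i x"
    then show thesis using that[of g] by (simp add: arcs_def arc_class_def arc_relations_def)
  qed
  show thesis
  proof (rule arcs.hom_factors_generate[OF End.a_group \<phi>1(1) crossing_relators])
    show "\<phi>1 s = \<one>\<^bsub>?A\<^esub>" if "s \<in> {crossing_relator c | c. c \<in> crossings D}" for s
      using that dot_action_crossing \<phi>1(2)[OF crossing_relator_keys] by (auto simp: crossing_relator_def)
    fix g assume g: "g \<in> hom (arcs D Mod generate (arcs D) {crossing_relator c | c. c \<in> crossings D}) ?A"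
      "\<And>x. x \<in> carrier (arcs D) \<Longrightarrow> g (generate (arcs D) {crossing_relator c | c. c \<in> crossings D} #>\<^bsub>arcs D\<^esub> x) = \<phi>1 x"
    show thesis
    proof (rule that[of g])
      show "g \<in> hom (Col D) ?A" using g(1) by (simp add: Col_def col_relations_eq)
      fix m :: "'e \<Rightarrow>\<^sub>0 int" assume m: "edge_chain m"
      then have "arc_class m \<in> carrier (arcs D)" using ac.hom_closed[of m] by simp
      then show "g (col_class m) = dot_action i m"
        using g(2)[of "arc_class m"] \<phi>1(2)[OF m] by (simp add: col_class_def col_relations_eq)
    qed
  qed
qed

text \<open>Every element of \<open>Col D\<close> is the class of a combination of edges, whose
  action has square zero. Squares of sums then also account for the anticommutation of distinct
  dots.\<close>

lemma ext_action_exists: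
  "\<exists>\<Phi>. \<Phi> \<in> ring_hom (ext_alg (Col D)) (end_ring (Hom i)) \<and>
    (\<forall>e \<in> edges D. \<Phi> (ext_gen (Col D) (col_of D e)) = dot_action i (frag_of e))"
proof -
  obtain \<phi> where \<phi>: "\<phi> \<in> hom (Col D) (add_monoid (end_ring (Hom i)))"
    "\<And>m :: 'e \<Rightarrow>\<^sub>0 int. edge_chain m \<Longrightarrow> \<phi> (col_class m) = dot_action i m"
    using col_action_exists[of i thesis] by blast
  obtain \<Phi> where \<Phi>: "\<Phi> \<in> ring_hom (ext_alg (Col D)) (end_ring (Hom i))"
    "\<And>a. a \<in> carrier (Col D) \<Longrightarrow> \<Phi> (ext_gen (Col D) a) = \<phi> a"
  proof (rule ext_alg_universal[OF Col.comm_group_axioms End.ring_axioms, of \<phi>])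
    fix a assume a: "a \<in> carrier (Col D)"
    then obtain m where m: "edge_chain m" "a = col_class m" by (auto simp: carrier_Col)
    show "\<phi> a \<in> carrier (end_ring (Hom i))" using m by (simp add: \<phi>(2) dot_action_end)
    show "\<phi> a \<otimes>\<^bsub>end_ring (Hom i)\<^esub> \<phi> a = \<zero>\<^bsub>end_ring (Hom i)\<^esub>" using m by (simp add: \<phi>(2) dot_action_square)
    fix b assume "b \<in> carrier (Col D)"
    then show "\<phi> (a \<otimes>\<^bsub>Col D\<^esub> b) = \<phi> a \<oplus>\<^bsub>end_ring (Hom i)\<^esub> \<phi> b"
      using hom_mult[OF \<phi>(1) a] by simp
  qed (rule that)
  have "col_of D e \<in> carrier (Col D)" if "e \<in> edges D" for e
    using that by (auto simp: carrier_Col col_of_eq keys_frag_of)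
  then show ?thesis
    using \<Phi> \<phi>(2) by (intro exI[of _ \<Phi>]) (simp add: col_of_eq keys_frag_of)
qed

section \<open>The module structure on the direct sum\<close>

lemma carrier_Okh: "carrier (Okh D ar \<epsilon>) = {h. (\<forall>i. h i \<in> carrier (Hom i)) \<and> finite {i. h i \<noteq> \<one>\<^bsub>Hom i\<^esub>}}"
  unfolding Okh_def by (subst carrier_sum_group) auto

lemma Okh_mult: "h \<otimes>\<^bsub>Okh D ar \<epsilon>\<^esub> h' = (\<lambda>i. h i \<otimes>\<^bsub>Hom i\<^esub> h' i)"
  by (simp add: Okh_def restrict_UNIV)

lemma comm_group_Okh: "comm_group (Okh D ar \<epsilon>)"
proof (rule group.group_comm_groupI)
  show "Group.group (Okh D ar \<epsilon>)" unfolding Okh_def by (rule sum_group) (rule Hom.is_group)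
  fix x y assume "x \<in> carrier (Okh D ar \<epsilon>)" "y \<in> carrier (Okh D ar \<epsilon>)"
  then show "x \<otimes>\<^bsub>Okh D ar \<epsilon>\<^esub> y = y \<otimes>\<^bsub>Okh D ar \<epsilon>\<^esub> x"
    by (auto simp: Okh_mult carrier_Okh Hom.m_comm)
qed

theorem Okh_module:
  "\<exists>act. left_module (ext_alg (Col D)) (Okh D ar \<epsilon>) act \<and>
     (\<forall>e \<in> edges D. \<forall>h \<in> carrier (Okh D ar \<epsilon>). \<forall>i. \<forall>x \<in> Zc i.
        h i = class i x \<longrightarrow> act (ext_gen (Col D) (col_of D e)) h i = class i (dot_map D e i x))"
proof -
  obtain \<Phi> where \<Phi>: "\<And>i. \<Phi> i \<in> ring_hom (ext_alg (Col D)) (end_ring (Hom i))"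
    "\<And>i e. e \<in> edges D \<Longrightarrow> \<Phi> i (ext_gen (Col D) (col_of D e)) = dot_action i (frag_of e)"
    using ext_action_exists by metis
  let ?R = "ext_alg (Col D)" and ?M = "Okh D ar \<epsilon>"
  \<comment> \<open>A dot preserves the homological degree, so the ring acts on each summand
    separately.\<close>
  define act where "act r h = (\<lambda>i. \<Phi> i r (h i))" for r and h :: "int \<Rightarrow> ('v set \<Rightarrow> 'e ext) set"
  have End: "\<Phi> i r \<in> carrier (end_ring (Hom i))" if "r \<in> carrier ?R" for i r
    by (rule ring_hom_closed[OF \<Phi>(1) that])
  have one: "\<Phi> i r \<one>\<^bsub>Hom i\<^esub> = \<one>\<^bsub>Hom i\<^esub>" if "r \<in> carrier ?R" for i r
    using End[OF that, of i] hom_one[OF _ Hom.is_group Hom.is_group] by (auto simp: end_ring_def)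
  have "left_module ?R ?M act"
  proof (intro left_module.intro left_module_axioms.intro comm_group_Okh Col.ring_ext_alg)
    fix r h assume r: "r \<in> carrier ?R" and h: "h \<in> carrier ?M"
    have hi: "h i \<in> carrier (Hom i)" for i using h by (simp add: carrier_Okh)
    \<comment> \<open>Endomorphisms fix the neutral class, so the support of h cannot grow and stays
      finite.\<close>
    have "{i. act r h i \<noteq> \<one>\<^bsub>Hom i\<^esub>} \<subseteq> {i. h i \<noteq> \<one>\<^bsub>Hom i\<^esub>}"
      using one[OF r] by (auto simp: act_def)
    then have "finite {i. act r h i \<noteq> \<one>\<^bsub>Hom i\<^esub>}"
      using h finite_subset by (auto simp: carrier_Okh)
    then show "act r h \<in> carrier ?M"
      using End[OF r] hi by (simp add: carrier_Okh act_def Hom.end_closed)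
    fix s assume s: "s \<in> carrier ?R"
    show "act (r \<oplus>\<^bsub>?R\<^esub> s) h = act r h \<otimes>\<^bsub>?M\<^esub> act s h"
      using hi by (auto simp: act_def Okh_mult ring_hom_add[OF \<Phi>(1) r s] Hom.end_ring_simps)
    show "act (r \<otimes>\<^bsub>?R\<^esub> s) h = act r (act s h)"
      using hi by (auto simp: act_def ring_hom_mult[OF \<Phi>(1) r s] Hom.end_ring_simps)
  next
    fix r h h' assume r: "r \<in> carrier ?R" and h: "h \<in> carrier ?M" "h' \<in> carrier ?M"
    then show "act r (h \<otimes>\<^bsub>?M\<^esub> h') = act r h \<otimes>\<^bsub>?M\<^esub> act r h'"
      by (auto simp: act_def Okh_mult carrier_Okh Hom.end_mult[OF End[OF r]])
  next
    fix h assume "h \<in> carrier ?M"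
    then show "act \<one>\<^bsub>?R\<^esub> h = h"
      by (auto simp: act_def ring_hom_one[OF \<Phi>(1)] Hom.end_ring_simps carrier_Okh)
  qed
  moreover have "act (ext_gen (Col D) (col_of D e)) h i = class i (dot_map D e i x)"
    if "e \<in> edges D" "x \<in> Zc i" "h i = class i x" for e h i x
    using that by (simp add: act_def \<Phi>(2) dot_action_class keys_frag_of dot_map_eq)
  ultimately show ?thesis by blast
qed

end

theorem theorem6:
  fixes D :: "('v, 'e) diagram"
    and ar :: "'v \<Rightarrow> bool"
    and \<epsilon> :: "'v set \<Rightarrow> 'v \<Rightarrow> int"
  assumes "link_diagram D"
    and "valid_sign_assignment D ar \<epsilon>"
  shows "\<exists>act. left_module (ext_alg (Col D)) (Okh D ar \<epsilon>) act \<and>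
           (\<forall>e \<in> edges D. \<forall>h \<in> carrier (Okh D ar \<epsilon>). \<forall>i. \<forall>x \<in> cycles D ar \<epsilon> i.
              h i = homology_class D ar \<epsilon> i x \<longrightarrow>
              act (ext_gen (Col D) (col_of D e)) h i = homology_class D ar \<epsilon> i (dot_map D e i x))"
proof -
  interpret signed_diagram D ar \<epsilon>
    using assms by (simp add: signed_diagram_def signed_diagram_axioms_def)
  show ?thesis by (rule Okh_module)
qed

end
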